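(* Let $M>0$ and $u\in P_\infty^+(0,M)$ be such that $u\ge 0$ and $|\nabla u(0,x_2,\dots,x_n)|=0$ for all $(x_2,\dots,x_n)\in\mathbf{R}^{n-1}$. Then $\Lambda(u)=\Pi$, where $\Lambda(u)=\{x\in\overline{\mathbf{R}^n_+}:u(x)=|\nabla u(x)|=0\}$.
   Context: Let $n\ge 2$. Write $\mathbf{R}^n_+=\{x\in\mathbf{R}^n:x_1>0\}$ and $\Pi=\{x\in\mathbf{R}^n:x_1=0\}$. Standing assumptions on $F$, a real-valued function on symmetric $n\times n$ matrices: (1) $F$ is uniformly elliptic with constants $0<\lambda\le\Lambda$: $\lambda\|N\|\le F(A+N)-F(A)\le\Lambda\|N\|$ for all symmetric $A,N$ with $N\ge 0$ ($\|\cdot\|$ the spectral norm); (2) $F(tA)=tF(A)$ for all real $t$ and symmetric $A$; (3) $F$ is convex; (4) $F$ is $C^1$. (The ellipticity constant $\Lambda$ is unrelated to the set $\Lambda(u)$.) Viscosity solution: for an open set $\Omega$, a continuous $u$ satisfies $F(D^2u)=\chi_\Omega$ in an open set $U$ in the viscosity sense if for every $x^0\in U$ and all quadratic polynomials $\varphi,\psi$ such that $u-\varphi$ has a local maximum at $x^0$, respectively $u-\psi$ has a local minimum at $x^0$, one has $F(D^2\varphi(x^0))\ge\chi_\Omega(x^0)$, respectively $F(D^2\psi(x^0))\le\chi_\Omega(x^0)$. Such functions are $C^{1,\alpha}$, so $\nabla u$ is defined (up to the flat boundary where $u=0$). Class $P_\infty^+(z,M)$ (global solutions): continuous functions $u$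 on $\overline{\mathbf{R}^n_+}$ such that, for some open set $\Omega\subset\mathbf{R}^n_+$: (1) $F(D^2u)=\chi_\Omega$ in $\mathbf{R}^n_+$ in the viscosity sense; (2) $u=|\nabla u|=0$ in $\mathbf{R}^n_+\setminus\Omega$; (3) $|u(x)|\le M(|x|^2+1)$; (4) $u=0$ on $\Pi$; (5) $z\in\partial\Omega$. *)

theory Defs
  imports "HOL-Analysis.Analysis"
begin

text \<open>The index \<open>k\<close> is the distinguished coordinate written \<open>x\<^sub>1\<close> on paper: a finite index
  type carries no preferred first element, so it is passed as a parameter.\<close>

definition half_space :: "'n \<Rightarrow> (real ^ 'n) set" where
  "half_space k = {x. 0 < x $ k}"

definition flat_boundary :: "'n \<Rightarrow> (real ^ 'n) set" where
  "flat_boundary k = {x. x $ k = 0}"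

definition symmetric_matrices :: "(real ^ 'n ^ 'n) set" where
  "symmetric_matrices = {A. transpose A = A}"

definition psd :: "real ^ 'n ^ 'n \<Rightarrow> bool" where
  "psd N \<longleftrightarrow> (\<forall>x. 0 \<le> x \<bullet> (N *v x))"

abbreviation spectral_norm :: "real ^ 'n ^ 'n \<Rightarrow> real" where
  "spectral_norm N \<equiv> onorm (\<lambda>x. N *v x)"

text \<open>Operators are total functions on matrices; only their values on symmetric matrices are
  ever constrained or used.\<close>

definition uniformly_elliptic :: "real \<Rightarrow> real \<Rightarrow> (real ^ 'n ^ 'n \<Rightarrow> real) \<Rightarrow> bool" where
  "uniformly_elliptic lam Lam F \<longleftrightarrow>
     (\<forall>A\<in>symmetric_matrices. \<forall>N\<in>symmetric_matrices. psd N \<longrightarrow>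
        lam * spectral_norm N \<le> F (A + N) - F A \<and>
        F (A + N) - F A \<le> Lam * spectral_norm N)"

definition homogeneous_degree_one :: "(real ^ 'n ^ 'n \<Rightarrow> real) \<Rightarrow> bool" where
  "homogeneous_degree_one F \<longleftrightarrow> (\<forall>t. \<forall>A\<in>symmetric_matrices. F (t *\<^sub>R A) = t * F A)"

text \<open>Differentiability is relative to the subspace of symmetric matrices. The derivative is
  determined only on that subspace, but a continuous choice \<open>F'\<close> with values in functionals on
  all matrices exists iff the derivative on the subspace is continuous (compose with the
  symmetrisation, respectively restrict).\<close>

definition C1_on_symmetric :: "(real ^ 'n ^ 'n \<Rightarrow> real) \<Rightarrow> bool" where
  "C1_on_symmetric F \<longleftrightarrow>
     (\<exists>F' :: real ^ 'n ^ 'n \<Rightarrow> ((real ^ 'n ^ 'n) \<Rightarrow>\<^sub>L real).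
        (\<forall>A\<in>symmetric_matrices.
           (F has_derivative blinfun_apply (F' A)) (at A within symmetric_matrices)) \<and>
        continuous_on symmetric_matrices F')"

text \<open>Every polynomial of degree at most two has exactly one representation
  \<open>quad_poly A b c\<close> with \<open>A\<close> symmetric, and its Hessian is then \<open>A\<close> at every point.\<close>

definition quad_poly :: "real ^ 'n ^ 'n \<Rightarrow> real ^ 'n \<Rightarrow> real \<Rightarrow> real ^ 'n \<Rightarrow> real" where
  "quad_poly A b c x = c + b \<bullet> x + (x \<bullet> (A *v x)) / 2"

definition local_max_at :: "('a::topological_space \<Rightarrow> real) \<Rightarrow> 'a \<Rightarrow> bool" where
  "local_max_at f x0 \<longleftrightarrow> (\<forall>\<^sub>F x in nhds x0. f x \<le> f x0)"

definition local_min_at :: "('a::topological_space \<Rightarrow> real) \<Rightarrow> 'a \<Rightarrow> bool" where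
  "local_min_at f x0 \<longleftrightarrow> (\<forall>\<^sub>F x in nhds x0. f x0 \<le> f x)"

text \<open>\<open>F(D\<^sup>2u) = \<chi>\<^sub>\<Omega>\<close> in the open set \<open>U\<close>; the right-hand side is tested with its actual
  pointwise values, not with semicontinuous envelopes.\<close>

definition viscosity_solution ::
    "(real ^ 'n ^ 'n \<Rightarrow> real) \<Rightarrow> (real ^ 'n) set \<Rightarrow> (real ^ 'n) set \<Rightarrow> (real ^ 'n \<Rightarrow> real) \<Rightarrow> bool" where
  "viscosity_solution F \<Omega> U u \<longleftrightarrow>
     continuous_on U u \<and>
     (\<forall>x0\<in>U. \<forall>A\<in>symmetric_matrices. \<forall>b c.
        (local_max_at (\<lambda>x. u x - quad_poly A b c x) x0 \<longrightarrow> F A \<ge> indicator \<Omega> x0) \<and>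
        (local_min_at (\<lambda>x. u x - quad_poly A b c x) x0 \<longrightarrow> F A \<le> indicator \<Omega> x0))"

text \<open>\<open>\<bar>\<nabla>u(x)\<bar> = 0\<close>. The derivative is taken within the closed half-space, hence it is
  the ordinary one at interior points and the one up to the boundary on the flat part; it is
  unique there because the closed half-space is convex with nonempty interior.\<close>

definition grad_zero_at :: "'n \<Rightarrow> (real ^ 'n \<Rightarrow> real) \<Rightarrow> real ^ 'n \<Rightarrow> bool" where
  "grad_zero_at k u x \<longleftrightarrow> (u has_derivative (\<lambda>h. 0)) (at x within closure (half_space k))"

text \<open>Functions on the closed half-space are total functions whose values elsewhere are
  irrelevant.\<close>

definition P_inf_plus ::
    "(real ^ 'n ^ 'n \<Rightarrow> real) \<Rightarrow> 'n \<Rightarrow> real ^ 'n \<Rightarrow> real \<Rightarrow> (real ^ 'n \<Rightarrow> real) set" where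
  "P_inf_plus F k z M =
     {u. continuous_on (closure (half_space k)) u \<and>
         (\<exists>\<Omega>. open \<Omega> \<and> \<Omega> \<subseteq> half_space k \<and>
            viscosity_solution F \<Omega> (half_space k) u \<and>
            (\<forall>x\<in>half_space k - \<Omega>. u x = 0 \<and> grad_zero_at k u x) \<and>
            (\<forall>x\<in>closure (half_space k). \<bar>u x\<bar> \<le> M * ((norm x)\<^sup>2 + 1)) \<and>
            (\<forall>x\<in>flat_boundary k. u x = 0) \<and>
            z \<in> frontier \<Omega>)}"

definition contact_set :: "'n \<Rightarrow> (real ^ 'n \<Rightarrow> real) \<Rightarrow> (real ^ 'n) set" where
  "contact_set k u = {x \<in> closure (half_space k). u x = 0 \<and> grad_zero_at k u x}"

end

theory Submission
  imports Defs
begin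

text \<open>
  A convex function that is homogeneous of degree one for all real factors, negative ones included,
  is additive. Hence \<open>F\<close> is linear on symmetric matrices, and a linear change of variables
  turns it into the trace. The vanishing gradient on the flat boundary makes the extension of
  \<open>u\<close> by zero a nonnegative function \<open>v\<close> on the whole space with
  \<open>\<Delta>v \<le> 1\<close> everywhere and \<open>\<Delta>v \<ge> 1\<close> where \<open>v > 0\<close>,
  vanishing on the half-space \<open>\<nu> \<bullet> x \<le> 0\<close>.

  Sums of viscosity subsolutions are again subsolutions, because on small balls one of the two
  can be replaced by a harmonic polynomial. Applied to \<open>v\<close> and to the negative of a reflected
  copy of \<open>v\<close>, this yields barrier arguments for \<open>v (x + \<rho> e) - v x\<close> in the variables
  \<open>s = \<nu> \<bullet> x\<close> and \<open>\<rho>\<close>, with \<open>e\<close> orthogonal to \<open>\<nu>\<close>: first a Lipschitz bound, which implies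
  \<open>v \<le> C s\<^sup>2\<close> by a Harnack type argument, and then the following rigidity. Let \<open>c\<close> be the best
  constant in \<open>v (x + \<rho> e) - v x \<le> c s \<rho>\<close>. If \<open>c > 0\<close>, the bound \<open>C s\<^sup>2\<close> is better than \<open>c s \<rho>\<close> for
  large \<open>\<rho> / s\<close>, and by the Hopf barrier \<open>sin \<cdot> sinh\<close> this gain propagates to a smaller constant
  for all small \<open>\<rho> / s\<close>; subdividing the segment from \<open>x\<close> to \<open>x + \<rho> e\<close> then contradicts the choice
  of \<open>c\<close>. So \<open>v\<close> depends on \<open>s\<close> only and is convex in \<open>s\<close>. A zero at \<open>s = a > 0\<close> would force \<open>v\<close> to
  vanish for all \<open>s < a\<close>, which is impossible because \<open>0\<close> lies on the boundary of \<open>\<Omega>\<close>.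
\<close>

section \<open>Touching from above and comparison\<close>

text \<open>The property \<open>\<Delta>v \<le> b\<close> of supersolutions is expressed as
  \<open>subsol (\<lambda>x. - v x) U (- b)\<close>.\<close>

definition subsol :: "(real ^ 'n \<Rightarrow> real) \<Rightarrow> (real ^ 'n) set \<Rightarrow> real \<Rightarrow> bool" where
  "subsol u U a \<longleftrightarrow> (\<forall>x0\<in>U. \<forall>A\<in>symmetric_matrices. \<forall>b c.
     local_max_at (\<lambda>x. u x - quad_poly A b c x) x0 \<longrightarrow> a \<le> trace A)"

text \<open>The upper second-order jets of viscosity theory, with the little-o term spelled out as
  \<open>e * (norm z)\<^sup>2\<close> for every \<open>e\<close>. They let smooth barriers serve as
  test functions although \<open>subsol\<close> tests with quadratic polynomials only.\<close>

definition superjet :: "(real ^ 'n \<Rightarrow> real) \<Rightarrow> real ^ 'n \<Rightarrow> real ^ 'n \<Rightarrow> real ^ 'n ^ 'n \<Rightarrow> bool" where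
  "superjet H x b A \<longleftrightarrow> A \<in> symmetric_matrices \<and>
     (\<forall>e>0. \<forall>\<^sub>F z in nhds 0. H (x + z) \<le> H x + b \<bullet> z + (z \<bullet> (A *v z)) / 2 + e * (norm z)\<^sup>2)"

section \<open>Symmetric matrices and quadratic polynomials\<close>

lemma inner_transpose_mult: "(transpose T *v y) \<bullet> z = y \<bullet> (T *v z)" for T :: "real^'n^'m"
  by (simp add: dot_lmul_matrix)

lemma symmetric_matrices_inner:
  "A \<in> symmetric_matrices \<Longrightarrow> x \<bullet> (A *v y) = y \<bullet> (A *v x)"
  using inner_transpose_mult[of A x y] by (simp add: symmetric_matrices_def inner_commute)

lemma quad_poly_shift:
  assumes "A \<in> symmetric_matrices"
  shows "quad_poly A (b - A *v x0) (c - b \<bullet> x0 + (x0 \<bullet> (A *v x0)) / 2) x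
       = c + b \<bullet> (x - x0) + ((x - x0) \<bullet> (A *v (x - x0))) / 2"
  using symmetric_matrices_inner[OF assms, of x x0]
  by (simp add: quad_poly_def matrix_vector_mult_diff_distrib inner_diff_left inner_diff_right
      inner_commute field_simps)

lemma quad_poly_expand:
  assumes "A \<in> symmetric_matrices"
  shows "quad_poly A b c (x + z) = quad_poly A b c x + (b + A *v x) \<bullet> z + (z \<bullet> (A *v z)) / 2"
  using symmetric_matrices_inner[OF assms, of x z] inner_commute[of "A *v x" z]
  by (simp add: quad_poly_def inner_add_left inner_add_right matrix_vector_right_distrib field_simps)

lemma symmetric_matrices_add [intro]:
  "A \<in> symmetric_matrices \<Longrightarrow> B \<in> symmetric_matrices \<Longrightarrow> A + B \<in> symmetric_matrices"
  by (simp add: symmetric_matrices_def transpose_def vec_eq_iff)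

lemma symmetric_matrices_scaleR [intro]:
  "A \<in> symmetric_matrices \<Longrightarrow> t *\<^sub>R A \<in> symmetric_matrices"
  by (simp add: symmetric_matrices_def transpose_def vec_eq_iff)

lemma symmetric_matrices_uminus [intro]:
  "A \<in> symmetric_matrices \<Longrightarrow> - A \<in> symmetric_matrices"
  by (simp add: symmetric_matrices_def transpose_def vec_eq_iff)

lemma symmetric_matrices_mat [simp, intro]: "mat t \<in> symmetric_matrices"
  by (simp add: symmetric_matrices_def)

lemma symmetric_matrices_0 [simp, intro]: "0 \<in> symmetric_matrices"
  by (simp add: symmetric_matrices_def transpose_def vec_eq_iff)

lemma mat_eq_scaleR: "(mat t :: real^'n^'n) = t *\<^sub>R mat 1"
  by (simp add: mat_def vec_eq_iff)

lemma mat_scalar_mult: "mat (t::real) *v x = t *\<^sub>R x"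
  by (simp add: mat_def matrix_vector_mult_def vec_eq_iff if_distrib if_distribR
      cong: if_cong)

lemma trace_mat: "trace (mat t :: real^'n^'n) = real CARD('n) * t"
  by (simp add: trace_def mat_def)

lemma trace_scaleR: "trace (t *\<^sub>R A) = t * trace (A :: real^'n^'n)"
  by (simp add: trace_def sum_distrib_left)

lemma local_max_at_shift:
  fixes f :: "'a::real_normed_vector \<Rightarrow> real"
  shows "local_max_at f x0 \<longleftrightarrow> (\<forall>\<^sub>F z in nhds 0. f (x0 + z) \<le> f x0)"
proof -
  have eq: "(\<forall>\<^sub>F x in nhds x0. P x) \<longleftrightarrow> (\<forall>\<^sub>F z in nhds 0. P (x0 + z))" for P :: "'a \<Rightarrow> bool"
  proof
    assume "\<forall>\<^sub>F x in nhds x0. P x"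
    moreover have "filterlim (\<lambda>z. x0 + z) (nhds x0) (nhds 0)"
    proof -
      have "isCont (\<lambda>z. x0 + z) 0" by simp
      then show ?thesis
        by (simp add: continuous_within tendsto_nhds_iff)
    qed
    ultimately show "\<forall>\<^sub>F z in nhds 0. P (x0 + z)"
      by (simp add: filterlim_iff)
  next
    assume "\<forall>\<^sub>F z in nhds 0. P (x0 + z)"
    moreover have "filterlim (\<lambda>x. x - x0) (nhds 0) (nhds x0)"
    proof -
      have "isCont (\<lambda>x. x - x0) x0" by simp
      then show ?thesis
        by (simp add: continuous_within tendsto_nhds_iff)
    qed
    ultimately show "\<forall>\<^sub>F x in nhds x0. P x"
      by (fastforce simp: filterlim_iff)
  qed
  show ?thesis
    unfolding local_max_at_def by (rule eq)
qed

text \<open>The error term of a jet is absorbed by adding a small multiple of the identity to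
  \<open>A\<close>, which changes the trace arbitrarily little.\<close>

lemma subsol_superjet:
  fixes u :: "real ^ 'n \<Rightarrow> real"
  assumes u: "subsol u U a" and x0: "x0 \<in> U" and H: "superjet H x0 b A"
    and max: "local_max_at (\<lambda>x. u x - H x) x0"
  shows "a \<le> trace A"
proof (rule field_le_epsilon)
  fix e :: real assume e: "e > 0"
  \<comment> \<open>Chosen so that \<open>mat (2 * d)\<close> has trace \<open>e\<close>.\<close>
  define d where "d = e / (2 * real CARD('n))"
  have d: "d > 0" using e by (simp add: d_def)
  define A' where "A' = A + mat (2 * d)"
  have A: "A \<in> symmetric_matrices" using H by (simp add: superjet_def)
  then have A': "A' \<in> symmetric_matrices" by (auto simp: A'_def)
  \<comment> \<open>\<open>Q\<close> has value \<open>H x0\<close>, gradient \<open>b\<close> and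
    Hessian \<open>A'\<close> at \<open>x0\<close>, so it touches \<open>H\<close> from above
    there.\<close>
  define Q where "Q = quad_poly A' (b - A' *v x0) (H x0 - b \<bullet> x0 + (x0 \<bullet> (A' *v x0)) / 2)"
  have Q: "Q (x0 + z) = H x0 + b \<bullet> z + (z \<bullet> (A *v z)) / 2 + d * (norm z)\<^sup>2" for z
    unfolding Q_def quad_poly_shift[OF A']
    by (simp add: A'_def matrix_vector_mult_add_rdistrib mat_scalar_mult inner_add_right
        power2_norm_eq_inner add_divide_distrib)
  have "\<forall>\<^sub>F z in nhds 0. u (x0 + z) - Q (x0 + z) \<le> u x0 - Q x0"
  proof -
    have "\<forall>\<^sub>F z in nhds 0. H (x0 + z) \<le> Q (x0 + z)"
      using H d unfolding superjet_def Q by blast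
    moreover have "\<forall>\<^sub>F z in nhds 0. u (x0 + z) - H (x0 + z) \<le> u x0 - H x0"
      using max by (simp add: local_max_at_shift)
    ultimately show ?thesis
      using Q[of 0] by (auto elim: eventually_elim2)
  qed
  then have "local_max_at (\<lambda>x. u x - Q x) x0"
    by (simp add: local_max_at_shift)
  then have "a \<le> trace A'"
    using u x0 A' unfolding subsol_def Q_def by blast
  also have "trace A' = trace A + e"
    by (simp add: A'_def trace_add trace_mat d_def)
  finally show "a \<le> trace A + e" .
qed

text \<open>A positive maximum of \<open>u - H\<close> would be attained in the interior, where
  \<open>H\<close> acts as a test function whose trace is strictly below \<open>a\<close>. Only
  explicit strict barriers are compared with \<open>u\<close>.\<close>

lemma subsol_comparison:
  fixes u :: "real ^ 'n \<Rightarrow> real"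
  assumes K: "compact K" and u: "subsol u (interior K) a"
    and cont: "continuous_on K u" "continuous_on K H"
    and H: "\<And>x. x \<in> interior K \<Longrightarrow> \<exists>b A. superjet H x b A \<and> trace A < a"
    and bd: "\<And>x. x \<in> K - interior K \<Longrightarrow> u x \<le> H x"
    and x: "x \<in> K"
  shows "u x \<le> H x"
proof (rule ccontr)
  assume neg: "\<not> u x \<le> H x"
  have "continuous_on K (\<lambda>x. u x - H x)" using cont by (intro continuous_intros)
  then obtain y where y: "y \<in> K" "\<And>z. z \<in> K \<Longrightarrow> u z - H z \<le> u y - H y"
    using continuous_attains_sup[OF K] x by blast
  have "y \<in> interior K" using bd[of y] y(1) y(2)[OF x] neg by force
  then have "\<forall>\<^sub>F z in nhds y. z \<in> interior K"
    by (meson eventually_nhds open_interior)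
  then have "local_max_at (\<lambda>x. u x - H x) y"
    unfolding local_max_at_def
    by eventually_elim (use y(2) interior_subset in blast)
  with H[OF \<open>y \<in> interior K\<close>] subsol_superjet[OF u \<open>y \<in> interior K\<close>] show False by fastforce
qed

lemma superjet_quad_poly:
  assumes A: "A \<in> symmetric_matrices"
  shows "superjet (quad_poly A b c) x (b + A *v x) A"
  using A by (simp add: superjet_def quad_poly_expand)

lemma superjet_add:
  assumes "superjet f x b A" "superjet g x b' A'"
  shows "superjet (\<lambda>x. f x + g x) x (b + b') (A + A')"
  unfolding superjet_def
proof (intro conjI allI impI)
  show "A + A' \<in> symmetric_matrices" using assms by (auto simp: superjet_def)
  fix e :: real assume "e > 0"
  then have "e / 2 > 0" by simp
  then have "\<forall>\<^sub>F z in nhds 0. f (x + z) \<le> f x + b \<bullet> z + (z \<bullet> (A *v z)) / 2 + e / 2 * (norm z)\<^sup>2"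
    "\<forall>\<^sub>F z in nhds 0. g (x + z) \<le> g x + b' \<bullet> z + (z \<bullet> (A' *v z)) / 2 + e / 2 * (norm z)\<^sup>2"
    using assms unfolding superjet_def by blast+
  then show "\<forall>\<^sub>F z in nhds 0. f (x + z) + g (x + z) \<le> f x + g x + (b + b') \<bullet> z
     + (z \<bullet> ((A + A') *v z)) / 2 + e * (norm z)\<^sup>2"
    by eventually_elim
       (simp add: inner_add_left inner_add_right matrix_vector_mult_add_rdistrib field_simps)
qed

text \<open>Mean value theorem on the segment from \<open>x\<close> to \<open>x + z\<close> for
  \<open>f\<close> minus its second-order Taylor terms; the derivative of this difference is small
  because \<open>g\<close> is differentiable at \<open>x\<close>.\<close>

lemma superjet_gradient:
  fixes f :: "real ^ 'n \<Rightarrow> real"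
  assumes f: "\<And>z. z \<in> ball x r \<Longrightarrow> (f has_derivative (\<lambda>h. g z \<bullet> h)) (at z)" and r: "r > 0"
    and g: "(g has_derivative (\<lambda>h. A *v h)) (at x)" and A: "A \<in> symmetric_matrices"
  shows "superjet f x (g x) A"
  unfolding superjet_def
proof (intro conjI allI impI A)
  fix e :: real assume e: "e > 0"
  obtain d where d: "d > 0" "\<And>y. norm (y - x) < d \<Longrightarrow> norm (g y - g x - A *v (y - x)) \<le> e * norm (y - x)"
    using g e unfolding has_derivative_at_alt by blast
  have "f (x + z) \<le> f x + g x \<bullet> z + (z \<bullet> (A *v z)) / 2 + e * (norm z)\<^sup>2" if z: "norm z < min d r" for z
  proof -
    define \<phi> where "\<phi> t = f (x + t *\<^sub>R z) - t * (g x \<bullet> z) - t\<^sup>2 * ((z \<bullet> (A *v z)) / 2)" for t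
    have der: "(\<phi> has_real_derivative (g (x + t *\<^sub>R z) - g x - A *v (t *\<^sub>R z)) \<bullet> z) (at t)"
      if t: "0 \<le> t" "t \<le> 1" for t
    proof -
      have "norm (t *\<^sub>R z) < r"
        using z t mult_left_le_one_le[of "norm z" t] by auto
      then have "(f has_derivative (\<lambda>h. g (x + t *\<^sub>R z) \<bullet> h)) (at (x + t *\<^sub>R z))"
        by (intro f) (simp add: dist_norm)
      then have *: "((\<lambda>t. f (x + t *\<^sub>R z)) has_derivative (\<lambda>h. g (x + t *\<^sub>R z) \<bullet> (h *\<^sub>R z))) (at t)"
        by (rule has_derivative_compose[rotated]) (auto intro!: derivative_eq_intros)
      have "((\<lambda>t. f (x + t *\<^sub>R z)) has_real_derivative g (x + t *\<^sub>R z) \<bullet> z) (at t)"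
        unfolding has_field_derivative_def
        by (rule has_derivative_eq_rhs[OF *]) (auto simp: fun_eq_iff mult.commute)
      then show ?thesis
        unfolding \<phi>_def
        by (auto intro!: derivative_eq_intros
          simp: inner_diff_left inner_diff_right matrix_vector_mult_scaleR inner_commute)
    qed
    obtain t where t: "0 < t" "t < 1" and eq: "\<phi> 1 - \<phi> 0 = (1 - 0) * ((g (x + t *\<^sub>R z) - g x - A *v (t *\<^sub>R z)) \<bullet> z)"
      using MVT2[of 0 1 \<phi> "\<lambda>t. (g (x + t *\<^sub>R z) - g x - A *v (t *\<^sub>R z)) \<bullet> z"] der by auto
    have tz: "norm (t *\<^sub>R z) \<le> norm z"
      using t mult_left_le_one_le[of "norm z" t] by auto
    have "(g (x + t *\<^sub>R z) - g x - A *v (t *\<^sub>R z)) \<bullet> z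
          \<le> norm (g (x + t *\<^sub>R z) - g x - A *v (t *\<^sub>R z)) * norm z"
      by (rule norm_cauchy_schwarz)
    also have "\<dots> \<le> (e * norm (t *\<^sub>R z)) * norm z"
      using d(2)[of "x + t *\<^sub>R z"] tz z by (intro mult_right_mono) auto
    also have "\<dots> \<le> (e * norm z) * norm z"
      using tz e by (intro mult_right_mono mult_left_mono) auto
    finally have "\<phi> 1 - \<phi> 0 \<le> e * (norm z)\<^sup>2"
      using eq by (simp add: power2_eq_square mult.assoc)
    then show ?thesis by (simp add: \<phi>_def)
  qed
  moreover have "\<forall>\<^sub>F z in nhds (0::real^'n). norm z < min d r"
    using d(1) r by (intro order_tendstoD(2)[of norm 0]) (auto intro: tendsto_norm_zero filterlim_ident)
  ultimately show "\<forall>\<^sub>F z in nhds 0. f (x + z) \<le> f x + g x \<bullet> z + (z \<bullet> (A *v z)) / 2 + e * (norm z)\<^sup>2"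
    by (auto elim: eventually_mono)
qed

lemma subsol_subset: "subsol u U a \<Longrightarrow> V \<subseteq> U \<Longrightarrow> subsol u V a"
  unfolding subsol_def by blast

section \<open>Affine changes of variables\<close>

lemma trace_transpose_conj:
  fixes A T :: "real^'n^'n"
  shows "trace (transpose T ** A ** T) = trace (A ** (T ** transpose T))"
  using trace_mul_sym[of "transpose T" "A ** T"] by (simp add: matrix_mul_assoc)

lemma symmetric_matrices_conj:
  "A \<in> symmetric_matrices \<Longrightarrow> transpose T ** A ** T \<in> symmetric_matrices"
  by (simp add: symmetric_matrices_def matrix_transpose_mul matrix_mul_assoc)

lemma quad_poly_affine:
  fixes A T :: "real^'n^'n"
  assumes A: "A \<in> symmetric_matrices"
  shows "\<exists>b' c'. \<forall>x. quad_poly A b c (p + T *v x) = quad_poly (transpose T ** A ** T) b' c' x"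
proof -
  have "quad_poly A b c (p + T *v z) = quad_poly (transpose T ** A ** T)
     (transpose T *v (b + A *v p)) (c + b \<bullet> p + (p \<bullet> (A *v p))/2) z" for z
  proof -
    have 1: "z \<bullet> ((transpose T ** A ** T) *v z) = (T *v z) \<bullet> (A *v (T *v z))"
      unfolding matrix_vector_mul_assoc[symmetric]
      using inner_transpose_mult[of T "A *v (T *v z)" z] by (simp add: inner_commute)
    show ?thesis
      unfolding quad_poly_def 1 inner_transpose_mult
      using symmetric_matrices_inner[OF A, of p "T *v z"]
      by (simp add: inner_add_left inner_add_right matrix_vector_right_distrib inner_commute field_simps)
  qed
  then show ?thesis by blast
qed

lemma local_max_at_compose:
  assumes "local_max_at f (g x0)" "isCont g x0"
  shows "local_max_at (\<lambda>x. f (g x)) x0"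
  using assms(1) eventually_compose_filterlim[of "\<lambda>y. f y \<le> f (g x0)" "nhds (g x0)" g "nhds x0"]
    assms(2) unfolding local_max_at_def isCont_def tendsto_at_iff_tendsto_nhds by blast

lemma matrix_mul_scaleR:
  fixes A B :: "real^'n^'n"
  shows "A ** (t *\<^sub>R B) = t *\<^sub>R (A ** B)" "(t *\<^sub>R A) ** B = t *\<^sub>R (A ** B)"
  by (simp_all add: matrix_matrix_mult_def vec_eq_iff sum_distrib_left mult_ac)

text \<open>\<open>T\<close> is \<open>r\<close> times an orthogonal matrix. Pulling a test
  polynomial back by the inverse \<open>T'\<close> conjugates its Hessian by \<open>T'\<close>,
  which divides the trace by \<open>r\<^sup>2\<close>.\<close>

lemma subsol_similarity:
  fixes u :: "real^'n \<Rightarrow> real" and T :: "real^'n^'n"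
  assumes u: "subsol u U a" and T: "T ** transpose T = mat (r\<^sup>2)" and r: "r \<noteq> 0"
  shows "subsol (\<lambda>x. u (p + T *v x)) {x. p + T *v x \<in> U} (r\<^sup>2 * a)"
  unfolding subsol_def
proof (intro ballI allI impI)
  fix x0 A b c
  assume x0: "x0 \<in> {x. p + T *v x \<in> U}" and A: "A \<in> symmetric_matrices"
    and max: "local_max_at (\<lambda>x. u (p + T *v x) - quad_poly A b c x) x0"
  define T' where "T' = (1 / r\<^sup>2) *\<^sub>R transpose T"
  have "T ** T' = (1 / r\<^sup>2) *\<^sub>R (T ** transpose T)"
    by (simp add: T'_def matrix_mul_scaleR)
  also have "\<dots> = mat 1" using r by (simp add: T mat_eq_scaleR[of "r\<^sup>2"])
  finally have TT': "T ** T' = mat 1" .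
  then have T'T: "T' ** T = mat 1" by (simp add: matrix_left_right_inverse)
  define y0 where "y0 = p + T *v x0"
  define g where "g y = - (T' *v p) + T' *v y" for y
  have gT: "g (p + T *v x) = x" for x
    by (simp add: g_def matrix_vector_right_distrib matrix_vector_mul_assoc T'T)
  have Tg: "p + T *v g y = y" for y
  proof -
    have "g y = T' *v (y - p)" by (simp add: g_def matrix_vector_mult_diff_distrib)
    then show ?thesis by (simp add: matrix_vector_mul_assoc TT')
  qed
  have "isCont g y0" unfolding g_def by (intro continuous_intros)
  moreover have "g y0 = x0" by (simp add: y0_def gT)
  ultimately have "local_max_at (\<lambda>y. u (p + T *v g y) - quad_poly A b c (g y)) y0"
    using max local_max_at_compose[of "\<lambda>x. u (p + T *v x) - quad_poly A b c x" g y0] by simp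
  moreover obtain b' c' where "\<And>y. quad_poly A b c (g y) = quad_poly (transpose T' ** A ** T') b' c' y"
    using quad_poly_affine[OF A, of b c "- (T' *v p)" T'] unfolding g_def by blast
  ultimately have "local_max_at (\<lambda>y. u y - quad_poly (transpose T' ** A ** T') b' c' y) y0"
    by (simp add: Tg)
  moreover have "y0 \<in> U" using x0 by (simp add: y0_def)
  ultimately have "a \<le> trace (transpose T' ** A ** T')"
    using u symmetric_matrices_conj[OF A] unfolding subsol_def by blast
  also have "\<dots> = trace (A ** (T' ** transpose T'))" by (rule trace_transpose_conj)
  also have "T' ** transpose T' = (1 / r\<^sup>2) *\<^sub>R mat 1"
  proof -
    have "transpose T' = (1 / r\<^sup>2) *\<^sub>R T"
      by (simp add: T'_def transpose_def vec_eq_iff)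
    then have "T' ** transpose T' = (1 / r\<^sup>2) *\<^sub>R (T' ** T)"
      by (simp add: matrix_mul_scaleR)
    then show ?thesis by (simp add: T'T)
  qed
  also have "trace (A ** ((1 / r\<^sup>2) *\<^sub>R mat 1)) = trace A / r\<^sup>2"
    by (simp add: matrix_mul_scaleR trace_scaleR)
  finally show "r\<^sup>2 * a \<le> trace A" using r by (simp add: field_simps)
qed

lemma subsol_scale_shift:
  fixes u :: "real^'n \<Rightarrow> real"
  assumes "subsol u U a" "r \<noteq> 0"
  shows "subsol (\<lambda>x. u (p + r *\<^sub>R x)) {x. p + r *\<^sub>R x \<in> U} (r\<^sup>2 * a)"
proof -
  have "(mat r :: real^'n^'n) ** transpose (mat r) = mat (r\<^sup>2)"
  proof -
    have "transpose (mat r :: real^'n^'n) = mat r" by simp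
    then show ?thesis
      by (metis mat_eq_scaleR matrix_mul_scaleR(2) matrix_mul_lid power2_eq_square scaleR_scaleR)
  qed
  from subsol_similarity[OF assms(1) this assms(2), of p] show ?thesis
    by (simp add: mat_scalar_mult)
qed

lemma subsol_cmult:
  fixes u :: "real^'n \<Rightarrow> real"
  assumes u: "subsol u U a" and k: "k > 0"
  shows "subsol (\<lambda>x. k * u x) U (k * a)"
  unfolding subsol_def
proof (intro ballI allI impI)
  fix x0 A b c
  assume x0: "x0 \<in> U" and A: "A \<in> symmetric_matrices"
    and max: "local_max_at (\<lambda>x. k * u x - quad_poly A b c x) x0"
  have *: "quad_poly ((1/k) *\<^sub>R A) ((1/k) *\<^sub>R b) (c/k) x = quad_poly A b c x / k" for x
    by (simp add: quad_poly_def add_divide_distrib scaleR_matrix_vector_assoc[symmetric])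
  have "local_max_at (\<lambda>x. u x - quad_poly ((1/k) *\<^sub>R A) ((1/k) *\<^sub>R b) (c/k) x) x0"
    unfolding local_max_at_def *
  proof (rule eventually_mono[OF max[unfolded local_max_at_def]])
    fix x assume "k * u x - quad_poly A b c x \<le> k * u x0 - quad_poly A b c x0"
    then show "u x - quad_poly A b c x / k \<le> u x0 - quad_poly A b c x0 / k"
      using k divide_right_mono[of _ _ k] by (fastforce simp: diff_divide_distrib)
  qed
  then have "a \<le> trace ((1/k) *\<^sub>R A)"
    using u x0 A unfolding subsol_def by blast
  then show "k * a \<le> trace A" using k by (simp add: trace_scaleR field_simps)
qed

section \<open>Harmonic polynomials\<close>

text \<open>Total by way of \<open>frechet_derivative\<close>. It is applied to polynomials, which
  are differentiable everywhere, so the rules below are equations between functions and can be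
  iterated.\<close>

definition partial :: "'n \<Rightarrow> (real ^ 'n \<Rightarrow> real) \<Rightarrow> real ^ 'n \<Rightarrow> real" where
  "partial i p x = frechet_derivative p (at x) (axis i 1)"

definition lap :: "(real ^ 'n \<Rightarrow> real) \<Rightarrow> real ^ 'n \<Rightarrow> real" where
  "lap p x = (\<Sum>i\<in>UNIV. partial i (partial i p) x)"

lemma has_derivative_vec:
  fixes f :: "real ^ 'n \<Rightarrow> real ^ 'm"
  assumes "\<And>i. ((\<lambda>x. f x $ i) has_derivative (\<lambda>h. f' h $ i)) (at x)"
  shows "(f has_derivative f') (at x)"
  using assms by (subst has_derivative_componentwise_within) (auto simp: Basis_vec_def inner_axis)

lemma partial_eqI: "(p has_derivative p') (at x) \<Longrightarrow> partial i p x = p' (axis i 1)"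
  unfolding partial_def using frechet_derivative_at by metis

lemma poly_differentiable:
  "real_polynomial_function p \<Longrightarrow> (p has_derivative frechet_derivative p (at x)) (at x)"
  using differentiable_at_real_polynomial_function frechet_derivative_works by blast

lemma poly_has_derivative:
  assumes "real_polynomial_function (p :: real ^ 'n \<Rightarrow> real)"
  shows "(p has_derivative (\<lambda>h. (\<chi> i. partial i p x) \<bullet> h)) (at x)"
proof (rule has_derivative_eq_rhs[OF poly_differentiable[OF assms]])
  have lin: "linear (frechet_derivative p (at x))"
    using poly_differentiable[OF assms] has_derivative_linear by blast
  show "frechet_derivative p (at x) = (\<lambda>h. (\<chi> i. partial i p x) \<bullet> h)"
  proof
    fix h
    have "frechet_derivative p (at x) h = frechet_derivative p (at x) (\<Sum>i\<in>UNIV. h $ i *\<^sub>R axis i 1)"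
      by (simp add: basis_expansion flip: scalar_mult_eq_scaleR)
    also have "\<dots> = (\<Sum>i\<in>UNIV. h $ i * partial i p x)"
      by (simp add: linear_sum[OF lin] linear_scale[OF lin] partial_def)
    finally show "frechet_derivative p (at x) h = (\<chi> i. partial i p x) \<bullet> h"
      by (simp add: inner_vec_def mult.commute)
  qed
qed

lemma partial_linear: "bounded_linear f \<Longrightarrow> partial i f = (\<lambda>x. f (axis i 1))"
  using partial_eqI[OF bounded_linear_imp_has_derivative] by blast

lemma partial_const: "partial i (\<lambda>x. c) = (\<lambda>x. 0)"
  using partial_eqI[OF has_derivative_const] by blast

lemma partial_component: "partial i (\<lambda>x. x $ j) = (\<lambda>x. if i = j then 1 else 0)"
  by (simp add: partial_linear bounded_linear_vec_nth axis_def)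

lemma partial_add:
  assumes "real_polynomial_function f" "real_polynomial_function g"
  shows "partial i (\<lambda>x. f x + g x) = (\<lambda>x. partial i f x + partial i g x)"
  using partial_eqI[OF has_derivative_add[OF assms[THEN poly_differentiable]]]
  by (auto simp: partial_def)

lemma partial_mult:
  assumes "real_polynomial_function f" "real_polynomial_function g"
  shows "partial i (\<lambda>x. f x * g x) = (\<lambda>x. f x * partial i g x + partial i f x * g x)"
  using partial_eqI[OF has_derivative_mult[OF assms[THEN poly_differentiable]]]
  by (auto simp: partial_def)

lemma partial_cmult:
  assumes "real_polynomial_function f"
  shows "partial i (\<lambda>x. c * f x) = (\<lambda>x. c * partial i f x)"
  using partial_mult[OF real_polynomial_function.intros(2) assms] by (simp add: partial_const)

lemma partial_sum:
  assumes "finite I" "\<And>k. k \<in> I \<Longrightarrow> real_polynomial_function (f k)"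
  shows "partial i (\<lambda>x. \<Sum>k\<in>I. f k x) = (\<lambda>x. \<Sum>k\<in>I. partial i (f k) x)"
  using assms
proof (induction I)
  case (insert k I)
  then show ?case
    using partial_add[of "f k" "\<lambda>x. \<Sum>k\<in>I. f k x" i] by (simp add: real_polynomial_function_sum)
qed (simp add: partial_const)

lemma poly_partial: "real_polynomial_function p \<Longrightarrow> real_polynomial_function (partial i p)"
proof (induction rule: real_polynomial_function.induct)
  case (linear f)
  then show ?case by (simp add: partial_linear real_polynomial_function.intros(2))
qed (auto simp: partial_const partial_add partial_mult)

lemma partial_commute:
  "real_polynomial_function p \<Longrightarrow> partial i (partial j p) = partial j (partial i p)"
proof (induction rule: real_polynomial_function.induct)
  case (linear f)
  then show ?case by (simp add: partial_linear partial_const)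
next
  case (mult f g)
  then show ?case
    by (simp add: partial_mult partial_add poly_partial real_polynomial_function.intros fun_eq_iff algebra_simps)
qed (simp_all add: partial_const partial_add poly_partial)

text \<open>Links the two forms of the Laplacian: the Hessian of a polynomial is symmetric because
  partial derivatives commute, and its trace is \<open>lap\<close>.\<close>

lemma superjet_poly:
  assumes p: "real_polynomial_function (p :: real ^ 'n \<Rightarrow> real)"
  shows "\<exists>b A. superjet p x b A \<and> trace A = lap p x"
proof -
  define g where "g z = (\<chi> i. partial i p z)" for z
  define A where "A = (\<chi> i j. partial j (partial i p) x)"
  have "superjet p x (g x) A"
  proof (rule superjet_gradient[where r = 1])
    show "(p has_derivative (\<lambda>h. g z \<bullet> h)) (at z)" for z
      unfolding g_def by (rule poly_has_derivative[OF p])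
    show "(g has_derivative (\<lambda>h. A *v h)) (at x)"
    proof (rule has_derivative_vec)
      fix i
      show "((\<lambda>x. g x $ i) has_derivative (\<lambda>h. (A *v h) $ i)) (at x)"
        using poly_has_derivative[OF poly_partial[OF p], of i x]
        by (simp add: g_def A_def matrix_vector_mult_def inner_vec_def)
    qed
    show "A \<in> symmetric_matrices"
      using partial_commute[OF p]
      by (simp add: symmetric_matrices_def A_def transpose_def vec_eq_iff)
  qed simp
  moreover have "trace A = lap p x" by (simp add: trace_def A_def lap_def)
  ultimately show ?thesis by blast
qed

lemma lap_add:
  "real_polynomial_function f \<Longrightarrow> real_polynomial_function g \<Longrightarrow>
   lap (\<lambda>x. f x + g x) x = lap f x + lap g x"
  by (simp add: lap_def partial_add poly_partial sum.distrib)

lemma lap_cmult: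
  "real_polynomial_function f \<Longrightarrow> lap (\<lambda>x. c * f x) x = c * lap f x"
  by (simp add: lap_def partial_cmult poly_partial sum_distrib_left)

lemma lap_mult:
  assumes "real_polynomial_function f" "real_polynomial_function g"
  shows "lap (\<lambda>x. f x * g x) x
     = f x * lap g x + 2 * (\<Sum>i\<in>UNIV. partial i f x * partial i g x) + lap f x * g x"
  using assms
  by (simp add: lap_def partial_add partial_mult poly_partial real_polynomial_function.intros
      sum.distrib sum_distrib_left sum_distrib_right algebra_simps)

lemma poly_component: "real_polynomial_function (\<lambda>x. x $ j)"
  by (simp add: bounded_linear_vec_nth real_polynomial_function.intros(1))

text \<open>Homogeneity is encoded by Euler's identity.\<close>

definition harm :: "nat \<Rightarrow> (real ^ 'n \<Rightarrow> real) \<Rightarrow> bool" where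
  "harm d p \<longleftrightarrow> real_polynomial_function p \<and> (\<forall>x. lap p x = 0) \<and>
     (\<forall>x. (\<Sum>i\<in>UNIV. x $ i * partial i p x) = real d * p x)"

lemma harm_cmult: "harm d p \<Longrightarrow> harm d (\<lambda>x. c * p x)"
  by (auto simp: harm_def lap_cmult partial_cmult sum_distrib_left algebra_simps
      simp flip: sum_distrib_left)

text \<open>Euler's identity in degree zero says that the derivative along rays vanishes, so
  \<open>p\<close> is constant.\<close>

lemma harm_0_partial:
  assumes "harm 0 p"
  shows "partial i p x = 0"
proof -
  have p: "real_polynomial_function p" using assms by (simp add: harm_def)
  have const: "p x = p 0" for x
  proof -
    define \<phi> where "\<phi> t = p (t *\<^sub>R x)" for t
    have der: "(\<phi> has_real_derivative (\<chi> i. partial i p (t *\<^sub>R x)) \<bullet> x) (at t)" for t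
    proof -
      have "((\<lambda>t. p (t *\<^sub>R x)) has_derivative (\<lambda>h. (\<chi> i. partial i p (t *\<^sub>R x)) \<bullet> (h *\<^sub>R x))) (at t)"
        by (rule has_derivative_compose[OF _ poly_has_derivative[OF p]]) (auto intro!: derivative_eq_intros)
      then show ?thesis
        unfolding has_field_derivative_def \<phi>_def by (rule has_derivative_eq_rhs) (auto simp: fun_eq_iff)
    qed
    \<comment> \<open>Euler's identity yields \<open>t\<close> times the derivative, so only
      \<open>t > 0\<close> is covered; the endpoint \<open>t = 0\<close> is reached by
      continuity.\<close>
    have zero: "(\<phi> has_real_derivative 0) (at t)" if "0 < t" for t
    proof -
      have "t * ((\<chi> i. partial i p (t *\<^sub>R x)) \<bullet> x) = (\<Sum>i\<in>UNIV. (t *\<^sub>R x) $ i * partial i p (t *\<^sub>R x))"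
        by (simp add: inner_vec_def sum_distrib_left mult_ac)
      also have "\<dots> = 0" using assms unfolding harm_def by (metis mult_zero_left of_nat_0)
      finally show ?thesis using der[of t] that by simp
    qed
    have "continuous_on {0..1} \<phi>"
      using der by (intro DERIV_continuous_on) (auto intro: has_field_derivative_at_within)
    then have "\<phi> 1 = \<phi> 0"
      using zero by (intro DERIV_isconst2[of 0 1 \<phi> 1]) auto
    then show ?thesis by (simp add: \<phi>_def)
  qed
  have "p = (\<lambda>x. p 0)" using const by blast
  then show ?thesis by (metis partial_const)
qed

text \<open>Differentiating Euler's identity in direction \<open>j\<close> produces one extra copy
  of \<open>partial j p\<close>, which lowers the degree by one; the Laplacian commutes with
  \<open>partial j\<close>.\<close>

lemma harm_partial:
  assumes "harm (Suc d) p"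
  shows "harm d (partial j p)"
proof -
  have p: "real_polynomial_function p" using assms by (simp add: harm_def)
  note [simp] = p poly_partial
  have "lap (partial j p) = partial j (lap p)"
    unfolding lap_def[abs_def]
    by (simp add: partial_sum partial_commute[of _ j])
  moreover have "lap p = (\<lambda>x. 0)" using assms by (auto simp: harm_def)
  ultimately have 1: "lap (partial j p) = (\<lambda>x. 0)" by (simp add: partial_const)
  have "(\<lambda>x. \<Sum>i\<in>UNIV. x $ i * partial i p x) = (\<lambda>x. real (Suc d) * p x)"
    using assms by (simp add: harm_def)
  then have "partial j (\<lambda>x. \<Sum>i\<in>UNIV. x $ i * partial i p x) = (\<lambda>x. real (Suc d) * partial j p x)"
    by (simp add: partial_cmult)
  moreover have "partial j (\<lambda>x. \<Sum>i\<in>UNIV. x $ i * partial i p x)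
     = (\<lambda>x. (\<Sum>i\<in>UNIV. x $ i * partial i (partial j p) x) + partial j p x)"
  proof -
    have "partial j (\<lambda>x. x $ i * partial i p x)
       = (\<lambda>x. x $ i * partial i (partial j p) x + (if i = j then partial j p x else 0))" for i
      by (auto simp: partial_mult poly_component partial_component partial_commute[OF p, of j i] fun_eq_iff)
    then show ?thesis
      by (simp add: partial_sum poly_component real_polynomial_function.intros(4) sum.distrib)
  qed
  ultimately have "(\<Sum>i\<in>UNIV. x $ i * partial i (partial j p) x) = real d * partial j p x" for x
    by (auto simp: fun_eq_iff algebra_simps)
  then show ?thesis using 1 by (simp add: harm_def)
qed

text \<open>On the unit sphere this polynomial differs from \<open>x\<^sub>j h\<close> by the harmonic polynomial
  \<open>c \<partial>\<^sub>j h\<close>. So the restrictions of harmonic polynomials are closed under multiplication by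
  coordinates, and every polynomial agrees on the sphere with a harmonic one.\<close>

lemma harm_mult_component:
  assumes h: "harm (Suc d) h"
  defines "c \<equiv> 1 / (real CARD('n) + 2 * real d)"
  shows "harm (Suc (Suc d)) (\<lambda>x. x $ j * h x + (- c) * ((x \<bullet> x) * partial j h (x :: real ^ 'n)))"
proof -
  define N where "N = (\<lambda>x :: real ^ 'n. x \<bullet> x)"
  define g where "g = partial j h"
  have h': "real_polynomial_function h" using h by (simp add: harm_def)
  have g: "harm d g" unfolding g_def by (rule harm_partial[OF h])
  then have g': "real_polynomial_function g" by (simp add: harm_def)
  have Neq: "N = (\<lambda>x. \<Sum>k\<in>UNIV. x $ k * x $ k)" by (simp add: N_def inner_vec_def)
  have N': "real_polynomial_function N"
    unfolding Neq by (intro real_polynomial_function_sum) (auto intro: poly_component)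
  have pN: "partial i N = (\<lambda>x. 2 * x $ i)" for i
    unfolding Neq
    by (simp add: partial_sum partial_mult poly_component real_polynomial_function.intros(4) partial_component
        sum.distrib if_distrib if_distribR fun_eq_iff cong: if_cong)
  have lN: "lap N x = 2 * real CARD('n)" for x
    by (simp add: lap_def pN partial_cmult poly_component partial_component)
  have lx: "lap (\<lambda>x. x $ j) x = 0" for x :: "real ^ 'n"
    by (simp add: lap_def partial_component partial_const)
  note [simp] = h' g' N' poly_component poly_partial
  note [intro] = real_polynomial_function.intros
  have E1: "lap (\<lambda>x. x $ j * h x) x = 2 * g x" for x
    using h by (simp add: lap_mult lx partial_component harm_def if_distrib if_distribR g_def cong: if_cong)
  have E2: "lap (\<lambda>x. N x * g x) x = (4 * real d + 2 * real CARD('n)) * g x" for x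
  proof -
    have "(\<Sum>i\<in>UNIV. partial i N x * partial i g x) = 2 * (\<Sum>i\<in>UNIV. x $ i * partial i g x)"
      by (simp add: pN sum_distrib_left mult_ac)
    then show ?thesis using g by (simp add: lap_mult lN harm_def algebra_simps)
  qed
  \<comment> \<open>By \<open>E1\<close> and \<open>E2\<close> this is the condition for the two
    Laplacians to cancel.\<close>
  have c: "c * (4 * real d + 2 * real CARD('n)) = 2"
  proof -
    have "real CARD('n) + 2 * real d > 0" by (simp add: add_pos_nonneg)
    then show ?thesis unfolding c_def by (simp add: field_simps)
  qed
  have Ng: "real_polynomial_function (\<lambda>x. N x * g x)"
    and xh: "real_polynomial_function (\<lambda>x. x $ j * h x)"
    by (intro real_polynomial_function.intros(4); simp)+
  have cNg: "real_polynomial_function (\<lambda>x. (- c) * (N x * g x))"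
    by (intro real_polynomial_function.intros(4) real_polynomial_function.intros(2) Ng)
  have P: "partial i (\<lambda>x. x $ j * h x + (- c) * (N x * g x))
     = (\<lambda>x. x $ j * partial i h x + (if i = j then h x else 0) + (- c) * (N x * partial i g x + 2 * x $ i * g x))" for i
    unfolding partial_add[OF xh cNg] partial_cmult[OF Ng]
    by (auto simp: partial_mult partial_component pN fun_eq_iff)
  have "lap (\<lambda>x. x $ j * h x + (- c) * (N x * g x)) x = 2 * g x - c * (4 * real d + 2 * real CARD('n)) * g x" for x
    unfolding lap_add[OF xh cNg] lap_cmult[OF Ng] E1 E2 by simp
  then have L: "lap (\<lambda>x. x $ j * h x + (- c) * (N x * g x)) x = 0" for x
    by (simp add: c)
  have hE: "(\<Sum>i\<in>UNIV. x $ i * partial i h x) = real (Suc d) * h x"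
    and gE: "(\<Sum>i\<in>UNIV. x $ i * partial i g x) = real d * g x" for x
    using h g by (simp_all add: harm_def)
  have "(\<Sum>i\<in>UNIV. x $ i * partial i (\<lambda>x. x $ j * h x + (- c) * (N x * g x)) x)
     = (\<Sum>i\<in>UNIV. x $ j * (x $ i * partial i h x) + (if i = j then x $ j * h x else 0)
         + (- c) * (N x * (x $ i * partial i g x) + 2 * g x * (x $ i * x $ i)))" for x
    unfolding P by (rule sum.cong) (auto simp: algebra_simps)
  also have "\<dots> x = x $ j * (\<Sum>i\<in>UNIV. x $ i * partial i h x) + x $ j * h x
      + (- c) * (N x * (\<Sum>i\<in>UNIV. x $ i * partial i g x) + 2 * g x * N x)" for x
    unfolding sum.distrib sum_distrib_left[symmetric] by (simp add: fun_cong[OF Neq])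
  also have "\<dots> x = real (Suc (Suc d)) * (x $ j * h x + (- c) * (N x * g x))" for x
    by (simp add: hE gE algebra_simps)
  finally have E: "(\<Sum>i\<in>UNIV. x $ i * partial i (\<lambda>x. x $ j * h x + (- c) * (N x * g x)) x)
     = real (Suc (Suc d)) * (x $ j * h x + (- c) * (N x * g x))" for x .
  have "real_polynomial_function (\<lambda>x. x $ j * h x + (- c) * (N x * g x))"
    by (rule real_polynomial_function.intros(3)[OF xh cNg])
  with L E have "harm (Suc (Suc d)) (\<lambda>x. x $ j * h x + (- c) * (N x * g x))"
    by (simp add: harm_def)
  then show ?thesis by (simp add: N_def g_def)
qed

text \<open>Summands of different degrees are allowed, since replacing \<open>x \<bullet> x\<close>
  by one on the sphere destroys homogeneity.\<close>

inductive harm_sum :: "(real ^ 'n \<Rightarrow> real) \<Rightarrow> bool" where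
  harm: "harm d p \<Longrightarrow> harm_sum p"
| add: "harm_sum p \<Longrightarrow> harm_sum q \<Longrightarrow> harm_sum (\<lambda>x. p x + q x)"

lemma harm_const: "harm 0 (\<lambda>x. c)"
  by (simp add: harm_def lap_def partial_const real_polynomial_function.intros(2))

lemma harm_sum_cmult: "harm_sum p \<Longrightarrow> harm_sum (\<lambda>x. c * p x)"
  by (induction rule: harm_sum.induct)
     (auto intro: harm_sum.intros harm_cmult simp: distrib_left)

lemma harm_sum_sum:
  "finite I \<Longrightarrow> (\<And>i. i \<in> I \<Longrightarrow> harm_sum (p i)) \<Longrightarrow> harm_sum (\<lambda>x. \<Sum>i\<in>I. p i x)"
  by (induction rule: finite_induct) (auto intro: harm_sum.intros harm_const)

lemma harm_sum_poly: "harm_sum p \<Longrightarrow> real_polynomial_function p \<and> (\<forall>x. lap p x = 0)"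
  by (induction rule: harm_sum.induct)
     (auto simp: harm_def lap_add intro: real_polynomial_function.intros)

lemma harm_sum_mult_component:
  "harm_sum p \<Longrightarrow> \<exists>q. harm_sum q \<and> (\<forall>x :: real ^ 'n. norm x = 1 \<longrightarrow> x $ j * p x = q x)"
proof (induction rule: harm_sum.induct)
  case (harm d h)
  show ?case
  proof (cases d)
    \<comment> \<open>\<open>harm_mult_component\<close> starts at degree one. A constant times a
      coordinate is itself harmonic of degree one.\<close>
    case 0
    have h: "real_polynomial_function h" using harm by (simp add: harm_def)
    have p0: "partial i h = (\<lambda>x. 0)" for i
      using harm harm_0_partial[of h] 0 by (auto simp: fun_eq_iff)
    have "partial i (\<lambda>x. x $ j * h x) = (\<lambda>x. if i = j then h x else 0)" for i
      by (auto simp: partial_mult poly_component h partial_component p0)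
    moreover from this have "partial i (partial i (\<lambda>x. x $ j * h x)) = (\<lambda>x. 0)" for i
      by (cases "i = j") (auto simp: p0 partial_const)
    moreover have "real_polynomial_function (\<lambda>x. x $ j * h x)"
      by (intro real_polynomial_function.intros(4) h poly_component)
    ultimately have "harm 1 (\<lambda>x. x $ j * h x)"
      by (simp add: harm_def lap_def if_distrib if_distribR cong: if_cong)
    then show ?thesis by (blast intro: harm_sum.harm)
  next
    case (Suc e)
    define c where "c = 1 / (real CARD('n) + 2 * real e)"
    have 1: "harm_sum (\<lambda>x. x $ j * h x + (- c) * ((x \<bullet> x) * partial j h x))"
      using harm_mult_component[of e h j] harm Suc unfolding c_def by (blast intro: harm_sum.harm)
    have 2: "harm_sum (\<lambda>x. c * partial j h x)"
      using harm_partial[of e h j] harm Suc by (blast intro: harm_sum.harm harm_sum_cmult)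
    \<comment> \<open>On the unit sphere the added \<open>c * partial j h x\<close> cancels the
      correction term, because \<open>x \<bullet> x = 1\<close> there.\<close>
    show ?thesis
      by (rule exI[of _ "\<lambda>x. x $ j * h x + (- c) * ((x \<bullet> x) * partial j h x) + c * partial j h x"])
         (use harm_sum.add[OF 1 2] in \<open>auto simp: norm_eq_1\<close>)
  qed
next
  case (add p q)
  then obtain p' q' where "harm_sum p'" "harm_sum q'"
    "\<forall>x. norm x = 1 \<longrightarrow> x $ j * p x = p' x" "\<forall>x. norm x = 1 \<longrightarrow> x $ j * q x = q' x" by blast
  then show ?case
    by (intro exI[of _ "\<lambda>x. p' x + q' x"]) (auto simp: distrib_left intro: harm_sum.add)
qed

text \<open>Linear functionals are combinations of coordinates, and a product \<open>f * g\<close>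
  is absorbed one factor at a time; this requires \<open>p\<close> to vary in the induction.\<close>

lemma harm_sum_mult_poly:
  "real_polynomial_function f \<Longrightarrow> harm_sum p \<Longrightarrow>
    \<exists>q. harm_sum q \<and> (\<forall>x :: real ^ 'n. norm x = 1 \<longrightarrow> f x * p x = q x)"
proof (induction arbitrary: p rule: real_polynomial_function.induct)
  case (linear f)
  then interpret bounded_linear f by simp
  obtain q where q: "\<And>j. harm_sum (q j)" "\<And>j x. norm x = 1 \<Longrightarrow> x $ j * p x = q j x"
    using harm_sum_mult_component[OF linear.prems] by metis
  have f: "f x = (\<Sum>j\<in>UNIV. x $ j * f (axis j 1))" for x
  proof -
    have "f x = f (\<Sum>j\<in>UNIV. x $ j *\<^sub>R axis j 1)"
      by (simp add: basis_expansion flip: scalar_mult_eq_scaleR)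
    then show ?thesis by (simp add: sum scale)
  qed
  have "f x * p x = (\<Sum>j\<in>UNIV. f (axis j 1) * q j x)" if "norm x = 1" for x
    unfolding f[of x] sum_distrib_right
    by (rule sum.cong) (auto simp: q(2)[OF that, symmetric])
  moreover have "harm_sum (\<lambda>x. \<Sum>j\<in>UNIV. f (axis j 1) * q j x)"
    by (intro harm_sum_sum harm_sum_cmult q) simp
  ultimately show ?case by blast
next
  case (const c)
  then show ?case by (blast intro: harm_sum_cmult)
next
  case (add f g)
  obtain q r where "harm_sum q" "harm_sum r" "\<forall>x. norm x = 1 \<longrightarrow> f x * p x = q x"
    "\<forall>x. norm x = 1 \<longrightarrow> g x * p x = r x" using add.IH add.prems by blast
  then show ?case
    by (intro exI[of _ "\<lambda>x. q x + r x"]) (auto simp: distrib_right intro: harm_sum.add)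
next
  case (mult f g)
  obtain q where q: "harm_sum q" "\<forall>x. norm x = 1 \<longrightarrow> g x * p x = q x" using mult by blast
  obtain r where "harm_sum r" "\<forall>x. norm x = 1 \<longrightarrow> f x * q x = r x" using mult q(1) by blast
  with q show ?case by (intro exI[of _ r]) (auto simp: mult.assoc)
qed

text \<open>An approximate solution of the Dirichlet problem in the unit ball: Stone-Weierstrass on
  the sphere, followed by the harmonic polynomial with the same values there.\<close>

lemma harmonic_approximation:
  fixes f :: "real ^ 'n \<Rightarrow> real"
  assumes "continuous_on (sphere 0 1) f" "e > 0"
  obtains h where "real_polynomial_function h" "\<And>x. lap h x = 0"
    "\<And>x. norm x = 1 \<Longrightarrow> \<bar>f x - h x\<bar> < e"
proof -
  obtain g where g: "real_polynomial_function g" "\<And>x. x \<in> sphere 0 1 \<Longrightarrow> \<bar>f x - g x\<bar> < e"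
    using Stone_Weierstrass_real_polynomial_function[OF compact_sphere assms] by blast
  obtain h where h: "harm_sum h" "\<And>x. norm x = 1 \<Longrightarrow> g x * 1 = h x"
    using harm_sum_mult_poly[OF g(1) harm_sum.harm[OF harm_const[of 1]]] by blast
  show ?thesis
  proof (rule that[of h])
    fix x :: "real ^ 'n" assume "norm x = 1"
    then show "\<bar>f x - h x\<bar> < e" using g(2)[of x] h(2)[of x] by simp
  qed (use harm_sum_poly[OF h(1)] in auto)
qed

section \<open>Sums of subsolutions\<close>

text \<open>Suppose a test polynomial \<open>q\<close> has trace below \<open>a + b\<close>. On a
  small sphere a harmonic polynomial \<open>h\<close> imitates \<open>u\<close> up to a quadratic
  term. It bounds \<open>u\<close> from above inside the ball, and through
  \<open>w \<le> m + q - u\<close> on the sphere its negative yields an upper bound for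
  \<open>w\<close>. At the centre the two bounds add up to less than \<open>m\<close>.\<close>

lemma subsol_add:
  fixes u w :: "real ^ 'n \<Rightarrow> real"
  assumes U: "open U" and u: "subsol u U a" "continuous_on U u"
    and w: "subsol w U b" "continuous_on U w"
  shows "subsol (\<lambda>x. u x + w x) U (a + b)"
  unfolding subsol_def
proof (intro ballI allI impI, rule ccontr)
  fix x0 A b' c'
  assume x0: "x0 \<in> U" and A: "A \<in> symmetric_matrices"
    and max: "local_max_at (\<lambda>x. u x + w x - quad_poly A b' c' x) x0"
    and neg: "\<not> a + b \<le> trace A"
  define n where "n = real CARD('n)"
  have n: "n > 0" by (simp add: n_def)
  define d where "d = a + b - trace A"
  have d: "d > 0" using neg by (simp add: d_def)
  define q where "q = quad_poly A b' c'"
  define m where "m = u x0 + w x0 - q x0"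
  have "\<forall>\<^sub>F x in nhds x0. x \<in> U \<and> u x + w x - q x \<le> m"
    using max U x0 unfolding local_max_at_def m_def q_def
    by (intro eventually_conj eventually_nhds_in_open)
  then obtain r where r: "r > 0" and r': "\<And>x. x \<in> cball x0 r \<Longrightarrow> x \<in> U \<and> u x + w x - q x \<le> m"
    unfolding eventually_nhds by (metis open_contains_cball subsetD)
  define \<phi> where "\<phi> z = x0 + r *\<^sub>R z" for z
  have \<phi>: "\<phi> z \<in> cball x0 r" if "z \<in> cball 0 1" for z
    using that r by (simp add: \<phi>_def dist_norm)
  have \<phi>0: "\<phi> 0 = x0" by (simp add: \<phi>_def)
  have cont\<phi>: "continuous_on S \<phi>" for S unfolding \<phi>_def by (intro continuous_intros)
  have contu: "continuous_on (cball 0 1) (\<lambda>z. u (\<phi> z))" and contw: "continuous_on (cball 0 1) (\<lambda>z. w (\<phi> z))"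
    using \<phi> r' by (auto intro!: continuous_on_compose2[OF u(2) cont\<phi>] continuous_on_compose2[OF w(2) cont\<phi>])
  have sub: "interior (cball 0 1) \<subseteq> {z. \<phi> z \<in> U}"
    using \<phi> r' interior_subset[of "cball 0 (1::real)"] by (metis (no_types, lifting) interior_subset mem_Collect_eq subset_iff)
  have su: "subsol (\<lambda>z. u (\<phi> z)) (interior (cball 0 1)) (r\<^sup>2 * a)"
    using subsol_subset[OF subsol_scale_shift[OF u(1), of r x0] sub[unfolded \<phi>_def]] r
    unfolding \<phi>_def by simp
  have sw: "subsol (\<lambda>z. w (\<phi> z)) (interior (cball 0 1)) (r\<^sup>2 * b)"
    using subsol_subset[OF subsol_scale_shift[OF w(1), of r x0] sub[unfolded \<phi>_def]] r
    unfolding \<phi>_def by simp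
  obtain b'' c'' where q: "\<And>z. q (\<phi> z) = quad_poly (r\<^sup>2 *\<^sub>R A) b'' c'' z"
  proof -
    have "transpose (mat r) ** A ** mat r = r\<^sup>2 *\<^sub>R A"
      unfolding transpose_mat unfolding mat_eq_scaleR[of r]
      by (simp only: matrix_mul_scaleR matrix_mul_lid matrix_mul_rid
          scaleR_scaleR power2_eq_square)
    then show ?thesis
      using quad_poly_affine[OF A, of b' c' x0 "mat r"] that
      unfolding q_def \<phi>_def by (auto simp: mat_scalar_mult)
  qed
  \<comment> \<open>The Laplacian of \<open>\<kappa> * (z \<bullet> z)\<close> is
    \<open>r\<^sup>2 * (a - d / 4)\<close>, just below the bound \<open>r\<^sup>2 * a\<close> for
    the rescaled \<open>u\<close>; so the barrier for \<open>u\<close> is strict once its remaining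
    part is harmonic.\<close>
  define \<kappa> where "\<kappa> = r\<^sup>2 * (a - d / 4) / (2 * n)"
  have \<kappa>: "2 * \<kappa> * n = r\<^sup>2 * (a - d / 4)" using n by (simp add: \<kappa>_def)
  \<comment> \<open>The second barrier contains
    \<open>\<delta> * r\<^sup>2 * (z \<bullet> z - 1)\<close>, which vanishes on the sphere, lowers
    the centre by \<open>\<delta> * r\<^sup>2\<close> and uses up \<open>r\<^sup>2 * d / 2\<close>
    of the available defect \<open>r\<^sup>2 * d\<close>.\<close>
  define \<delta> where "\<delta> = d / (4 * n)"
  have \<delta>: "\<delta> > 0" "4 * (\<delta> * n) = d" using n d by (simp_all add: \<delta>_def)
  \<comment> \<open>The approximation errors at the centre add up to \<open>2 * \<epsilon>\<close>,
    half of the gain \<open>\<delta> * r\<^sup>2\<close>.\<close>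
  define \<epsilon> where "\<epsilon> = \<delta> * r\<^sup>2 / 4"
  have \<epsilon>: "\<epsilon> > 0" using \<delta> r by (simp add: \<epsilon>_def)
  have "continuous_on (sphere 0 1) (\<lambda>z. u (\<phi> z) - \<kappa> * (z \<bullet> z))"
    by (intro continuous_intros continuous_on_subset[OF contu]) auto
  then obtain h where h: "real_polynomial_function h" "\<And>x. lap h x = 0"
    "\<And>x. norm x = 1 \<Longrightarrow> \<bar>u (\<phi> x) - \<kappa> * (x \<bullet> x) - h x\<bar> < \<epsilon>"
    using harmonic_approximation \<epsilon> by blast
  have nh: "real_polynomial_function (\<lambda>z. - h z)" using h(1) by (rule real_polynomial_function_minus)
  have lnh: "lap (\<lambda>z. - h z) x = 0" for x
    using lap_cmult[OF h(1), of "-1" x] h(2) by simp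
  have bd: "norm z = 1" if "z \<in> cball 0 1 - interior (cball 0 1)" for z :: "real^'n"
    using that by auto
  have conth: "continuous_on S h" for S
    using h(1) continuous_on_polymonial_function real_polynomial_function_eq by blast
  have contq: "continuous_on S (quad_poly B v t)" for S B t and v :: "real ^ 'n"
    unfolding quad_poly_def by (intro continuous_intros) simp
  have "u (\<phi> 0) \<le> h 0 + quad_poly (mat (2 * \<kappa>)) 0 \<epsilon> (0 :: real ^ 'n)"
  proof (rule subsol_comparison[where x = 0 and
        H = "\<lambda>z. h z + quad_poly (mat (2 * \<kappa>)) 0 \<epsilon> z", OF compact_cball su contu])
    show "continuous_on (cball 0 1) (\<lambda>z. h z + quad_poly (mat (2 * \<kappa>)) 0 \<epsilon> z)"
      by (intro continuous_intros conth contq)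
    show "\<exists>b A. superjet (\<lambda>z. h z + quad_poly (mat (2 * \<kappa>)) 0 \<epsilon> z) x b A \<and> trace A < r\<^sup>2 * a" for x
    proof -
      obtain b1 A1 where j: "superjet h x b1 A1" "trace A1 = lap h x" using superjet_poly[OF h(1)] by blast
      note superjet_add[OF j(1) superjet_quad_poly[OF symmetric_matrices_mat, of "2*\<kappa>" 0 \<epsilon>]]
      moreover have "trace (A1 + mat (2 * \<kappa>)) < r\<^sup>2 * a"
        using \<kappa> mult_pos_pos[OF d zero_less_power[OF r, of 2]]
        by (simp add: trace_add j h(2) trace_mat n_def mult_ac algebra_simps)
      ultimately show ?thesis by blast
    qed
    show "u (\<phi> x) \<le> h x + quad_poly (mat (2 * \<kappa>)) 0 \<epsilon> x" if "x \<in> cball 0 1 - interior (cball 0 1)" for x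
      using h(3)[OF bd[OF that]] by (simp add: quad_poly_def mat_scalar_mult)
  qed auto
  \<comment> \<open>The barrier is \<open>m + q - u\<close> with \<open>u\<close> replaced by its
    lower approximation on the sphere, plus the correction with \<open>\<delta>\<close>; its trace
    is \<open>r\<^sup>2 * (b - d / 4)\<close>.\<close>
  moreover have "w (\<phi> 0) \<le> - h 0 + (quad_poly (r\<^sup>2 *\<^sub>R A) b'' c'' (0 :: real ^ 'n) + quad_poly (mat (2 * r\<^sup>2 * \<delta> - 2 * \<kappa>)) 0 (m - \<delta> * r\<^sup>2 + \<epsilon>) (0 :: real ^ 'n))"
  proof (rule subsol_comparison[where x = 0 and H = "\<lambda>z. - h z + (quad_poly (r\<^sup>2 *\<^sub>R A) b'' c'' z
          + quad_poly (mat (2 * r\<^sup>2 * \<delta> - 2 * \<kappa>)) 0 (m - \<delta> * r\<^sup>2 + \<epsilon>) z)",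
        OF compact_cball sw contw])
    show "continuous_on (cball 0 1) (\<lambda>z. - h z + (quad_poly (r\<^sup>2 *\<^sub>R A) b'' c'' z + quad_poly (mat (2 * r\<^sup>2 * \<delta> - 2 * \<kappa>)) 0 (m - \<delta> * r\<^sup>2 + \<epsilon>) z))"
      by (intro continuous_intros conth contq)
    show "\<exists>B A'. superjet (\<lambda>z. - h z + (quad_poly (r\<^sup>2 *\<^sub>R A) b'' c'' z + quad_poly (mat (2 * r\<^sup>2 * \<delta> - 2 * \<kappa>)) 0 (m - \<delta> * r\<^sup>2 + \<epsilon>) z)) x B A' \<and> trace A' < r\<^sup>2 * b" for x
    proof -
      obtain b1 A1 where j: "superjet (\<lambda>z. - h z) x b1 A1" "trace A1 = lap (\<lambda>z. - h z) x" using superjet_poly[OF nh] by blast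
      note superjet_add[OF j(1) superjet_add[OF superjet_quad_poly[OF symmetric_matrices_scaleR[OF A], of "r\<^sup>2" b'' c'']
           superjet_quad_poly[OF symmetric_matrices_mat, of "2 * r\<^sup>2 * \<delta> - 2 * \<kappa>" 0 "m - \<delta> * r\<^sup>2 + \<epsilon>"]]]
      moreover have "trace (A1 + (r\<^sup>2 *\<^sub>R A + mat (2 * r\<^sup>2 * \<delta> - 2 * \<kappa>))) < r\<^sup>2 * b"
      proof -
        have "trace (A1 + (r\<^sup>2 *\<^sub>R A + mat (2 * r\<^sup>2 * \<delta> - 2 * \<kappa>))) = r\<^sup>2 * trace A + 2 * r\<^sup>2 * (\<delta> * n) - 2 * \<kappa> * n"
          by (simp add: trace_add j lnh trace_mat trace_scaleR n_def algebra_simps)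
        also have "\<dots> = r\<^sup>2 * (trace A + d / 2 - a + d / 4)"
          unfolding \<kappa> using \<delta>(2) by (simp add: algebra_simps flip: \<delta>(2))
        also have "\<dots> < r\<^sup>2 * b"
          using r d by (intro mult_strict_left_mono) (auto simp: d_def field_simps)
        finally show ?thesis .
      qed
      ultimately show ?thesis by blast
    qed
    show "w (\<phi> x) \<le> - h x + (quad_poly (r\<^sup>2 *\<^sub>R A) b'' c'' x + quad_poly (mat (2 * r\<^sup>2 * \<delta> - 2 * \<kappa>)) 0 (m - \<delta> * r\<^sup>2 + \<epsilon>) x)"
      if x: "x \<in> cball 0 1 - interior (cball 0 1)" for x
    proof -
      have "x \<bullet> x = 1" using bd[OF x] by (simp add: norm_eq_1)
      moreover have "u (\<phi> x) + w (\<phi> x) - q (\<phi> x) \<le> m" using r' \<phi> x by blast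
      ultimately show ?thesis
        using h(3)[OF bd[OF x]] unfolding q
        by (simp add: quad_poly_def mat_scalar_mult diff_divide_distrib algebra_simps)
    qed
  qed auto
  ultimately have "u x0 + w x0 - q x0 \<le> m - \<delta> * r\<^sup>2 + 2 * \<epsilon>"
    using q[of 0] by (simp add: \<phi>0 quad_poly_def)
  moreover have "\<delta> * r\<^sup>2 > 0" using \<delta> r by simp
  ultimately show False unfolding m_def \<epsilon>_def by simp
qed

section \<open>Reflection coupling\<close>

definition outer :: "real ^ 'n \<Rightarrow> real ^ 'n ^ 'n" where
  "outer a = (\<chi> i j. a $ i * a $ j)"

lemma outer_mult: "outer a *v z = (a \<bullet> z) *\<^sub>R a"
  by (simp add: outer_def matrix_vector_mult_def vec_eq_iff inner_vec_def sum_distrib_left sum_distrib_right mult_ac)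

lemma symmetric_matrices_outer [simp, intro]: "outer a \<in> symmetric_matrices"
  by (simp add: outer_def symmetric_matrices_def transpose_def vec_eq_iff)

lemma trace_outer: "trace (outer a) = a \<bullet> a"
  by (simp add: outer_def trace_def inner_vec_def)

text \<open>The reflection matrix is symmetric and an involution, hence orthogonal: a similarity
  with factor one.\<close>

lemma subsol_reflect:
  fixes u :: "real ^ 'n \<Rightarrow> real"
  assumes u: "subsol u UNIV a" and e: "norm e = 1"
  shows "subsol (\<lambda>z. u (p + (z - (2 * (e \<bullet> z)) *\<^sub>R e))) UNIV a"
proof -
  define R where "R = mat 1 - 2 *\<^sub>R outer e"
  have R: "R *v z = z - (2 * (e \<bullet> z)) *\<^sub>R e" for z
    by (simp add: R_def matrix_vector_mult_diff_rdistrib outer_mult scaleR_matrix_vector_assoc[symmetric])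
  have "transpose R = R"
    by (simp add: R_def outer_def transpose_def mat_def vec_eq_iff)
  moreover have "R ** R = mat 1"
    unfolding matrix_eq
  proof
    fix z
    have "e \<bullet> (R *v z) = - (e \<bullet> z)" using e by (simp add: R inner_diff_right norm_eq_1)
    then show "(R ** R) *v z = mat 1 *v z"
      by (simp add: matrix_vector_mul_assoc[symmetric] R[of "R *v z"]) (simp add: R)
  qed
  ultimately have "R ** transpose R = mat (1\<^sup>2)" by simp
  from subsol_similarity[OF u this, of p] show ?thesis by (simp add: R)
qed

lemma subsol_shift:
  fixes u :: "real ^ 'n \<Rightarrow> real"
  assumes "subsol u U a"
  shows "subsol (\<lambda>z. u (p + z)) {z. p + z \<in> U} a"
  using subsol_scale_shift[OF assms, of 1 p] by simp

text \<open>Reflection coupling: \<open>X + z\<close> and \<open>Y + R z\<close>, with \<open>R\<close> the reflection along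
  \<open>e\<close>, keep \<open>X - Y\<close> on the line spanned by \<open>e\<close>.\<close>

lemma coupling_max:
  fixes v :: "real ^ 'n \<Rightarrow> real"
  assumes cont: "continuous_on UNIV v" and V: "open V" and sub: "subsol v V a"
    and super: "subsol (\<lambda>x. - v x) UNIV b" and e: "norm e = 1"
    and X: "y + \<rho> *\<^sub>R e \<in> V"
    and max: "local_max_at (\<lambda>(x, t). v (x + t *\<^sub>R e) - v x - \<Theta> x t) (y, \<rho>)"
    and jet: "superjet (\<lambda>z. \<Theta> (y + (z - (2 * (e \<bullet> z)) *\<^sub>R e)) (\<rho> + 2 * (e \<bullet> z))) 0 g M"
  shows "a + b \<le> trace M"
proof -
  define f where "f = (\<lambda>(x, t). v (x + t *\<^sub>R e) - v x - \<Theta> x t)"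
  \<comment> \<open>The second component is tuned so that the base point \<open>y + R z\<close>
    moved by it along \<open>e\<close> is exactly \<open>X0 + z\<close>.\<close>
  define k where "k z = (y + (z - (2 * (e \<bullet> z)) *\<^sub>R e), \<rho> + 2 * (e \<bullet> z))" for z
  define X0 where "X0 = y + \<rho> *\<^sub>R e"
  have cshift: "continuous_on S (\<lambda>z. v (p + z))" "continuous_on S (\<lambda>z. - v (p + (z - (2 * (e \<bullet> z)) *\<^sub>R e)))" for S p
    by (intro continuous_intros continuous_on_compose2[OF cont]; simp)+
  have "open {z. X0 + z \<in> V}"
    using open_vimage[OF V, of "\<lambda>z. X0 + z"] by (simp add: vimage_def continuous_intros)
  then have s: "subsol (\<lambda>z. v (X0 + z) + - v (y + (z - (2 * (e \<bullet> z)) *\<^sub>R e))) {z. X0 + z \<in> V} (a + b)"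
    by (intro subsol_add subsol_shift sub cshift subsol_subset[OF subsol_reflect[OF super e]]) auto
  have "local_max_at (\<lambda>z. f (k z)) 0"
  proof (rule local_max_at_compose[of f k 0])
    have "k 0 = (y, \<rho>)" by (simp add: k_def)
    then show "local_max_at f (k 0)" using max unfolding f_def by simp
    show "isCont k 0" unfolding k_def by (intro continuous_intros)
  qed
  moreover have "f (k z) = v (X0 + z) + - v (y + (z - (2 * (e \<bullet> z)) *\<^sub>R e))
     - \<Theta> (y + (z - (2 * (e \<bullet> z)) *\<^sub>R e)) (\<rho> + 2 * (e \<bullet> z))" for z
  proof -
    have eq: "y + (z - c *\<^sub>R e) + (\<rho> + c) *\<^sub>R e = X0 + z" for c
      by (simp add: X0_def scaleR_add_left)
    show ?thesis unfolding f_def k_def prod.case eq by simp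
  qed
  ultimately have "local_max_at (\<lambda>z. v (X0 + z) + - v (y + (z - (2 * (e \<bullet> z)) *\<^sub>R e))
     - \<Theta> (y + (z - (2 * (e \<bullet> z)) *\<^sub>R e)) (\<rho> + 2 * (e \<bullet> z))) 0" by simp
  then show ?thesis
    using subsol_superjet[OF s _ jet] X by (simp add: X0_def)
qed

lemma local_max_at_interior:
  assumes "x \<in> interior K" "\<And>y. y \<in> K \<Longrightarrow> f y \<le> f x"
  shows "local_max_at f x"
proof -
  have "\<forall>\<^sub>F y in nhds x. y \<in> interior K"
    using assms(1) by (intro eventually_nhds_in_open) auto
  then show ?thesis
    unfolding local_max_at_def by eventually_elim (use assms(2) interior_subset in blast)
qed

lemma norm_add_reflect:
  assumes "norm e = 1"
  shows "(norm (c + (z - (2 * (e \<bullet> z)) *\<^sub>R e)))\<^sup>2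
    = c \<bullet> c + z \<bullet> z + 2 * (c \<bullet> z) - 4 * (e \<bullet> c) * (e \<bullet> z)"
  using assms unfolding power2_norm_eq_inner
  by (simp add: inner_simps norm_eq_1 inner_commute algebra_simps)

text \<open>Maximise \<open>v (x + t *\<^sub>R e) - v x - \<Theta> x t\<close> over
  \<open>K\<close>. The difference vanishes at \<open>t = 0\<close>, and \<open>\<Theta>\<close>
  dominates it on the remaining boundary. At an interior maximum the coupling makes the concave term
  in \<open>t\<close> so negative that \<open>coupling_max\<close> fails.\<close>

lemma lipschitz_bound:
  fixes v :: "real ^ 'n \<Rightarrow> real"
  assumes cont: "continuous_on UNIV v" and nonneg: "\<And>x. 0 \<le> v x"
    and sub: "subsol v UNIV 0" and super: "subsol (\<lambda>x. - v x) UNIV (-1)"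
    and bd: "\<And>x. x \<in> cball y (2 * r) \<Longrightarrow> v x \<le> S" and r: "r > 0"
    and e: "norm e = 1" and \<rho>: "0 \<le> \<rho>" "\<rho> \<le> r"
  shows "v (y + \<rho> *\<^sub>R e) - v y \<le> ((1 + real CARD('n) / 4) * (S / r) + r / 4) * \<rho>"
proof -
  define n where "n = real CARD('n)"
  have "0 \<le> S" using nonneg[of y] bd[of y] r by simp
  \<comment> \<open>\<open>A\<close> makes \<open>\<Theta>\<close> at least \<open>S\<close> on the
    lateral boundary, and \<open>B\<close> does so at \<open>t = r\<close>. \<open>D\<close> brings
    the coupled trace \<open>2 * n * A - 8 * D\<close> to \<open>- 2\<close>, below the value
    \<open>- 1\<close> required by \<open>coupling_max\<close>.\<close>
  define A where "A = S / r\<^sup>2"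
  define D where "D = n * A / 4 + 1 / 4"
  define B where "B = S / r + D * r"
  have A: "A \<ge> 0" "A * r\<^sup>2 = S" using \<open>0 \<le> S\<close> r by (simp_all add: A_def)
  have D: "D \<ge> 0" using A by (simp add: D_def n_def)
  have B: "B * r - D * r\<^sup>2 = S" "B - D * r \<ge> 0" using r \<open>0 \<le> S\<close> by (simp_all add: B_def power2_eq_square algebra_simps)
  define \<Theta> where "\<Theta> x t = A * (norm (x - y))\<^sup>2 + B * t - D * t\<^sup>2" for x t
  define f where "f = (\<lambda>(x, t). v (x + t *\<^sub>R e) - v x - \<Theta> x t)"
  define K where "K = cball y r \<times> {0..r}"
  have Bt: "B * t - D * t\<^sup>2 \<ge> 0" if "0 \<le> t" "t \<le> r" for t
  proof -
    have "B - D * t \<ge> 0" using mult_left_mono[OF that(2) D] B(2) by simp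
    then have "t * (B - D * t) \<ge> 0" using that by simp
    then show ?thesis by (simp add: power2_eq_square algebra_simps)
  qed
  have "f (y, \<rho>) \<le> 0"
  proof (rule ccontr)
    assume pos: "\<not> f (y, \<rho>) \<le> 0"
    have "continuous_on K f"
      unfolding f_def \<Theta>_def case_prod_beta
      by (intro continuous_intros continuous_on_compose2[OF cont]; simp)
    moreover have "(y, \<rho>) \<in> K" using r \<rho> by (simp add: K_def)
    moreover have "compact K" by (simp add: K_def compact_Times)
    ultimately obtain p where p: "p \<in> K" "\<And>q. q \<in> K \<Longrightarrow> f q \<le> f p"
      using continuous_attains_sup[of K f] by blast
    obtain x t where xt: "p = (x, t)" by (cases p)
    have x: "dist y x \<le> r" and t: "0 \<le> t" "t \<le> r" using p(1) by (auto simp: K_def xt)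
    have fpos: "v (x + t *\<^sub>R e) - v x > \<Theta> x t"
      using pos p(2)[OF \<open>(y, \<rho>) \<in> K\<close>] by (simp add: xt f_def)
    have "dist y (x + t *\<^sub>R e) \<le> dist y x + dist x (x + t *\<^sub>R e)" by (rule dist_triangle)
    also have "\<dots> \<le> 2 * r" using x t e by (simp add: dist_norm)
    finally have le: "v (x + t *\<^sub>R e) - v x \<le> S" using bd[of "x + t *\<^sub>R e"] nonneg[of x] by simp
    have "\<Theta> x 0 \<ge> 0" using A by (simp add: \<Theta>_def)
    then have "t \<noteq> 0" using fpos by auto
    moreover have "t \<noteq> r"
    proof
      assume "t = r"
      moreover have "A * (norm (x - y))\<^sup>2 \<ge> 0" using A by simp
      ultimately have "\<Theta> x t \<ge> S" using B by (simp add: \<Theta>_def)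
      then show False using fpos le by simp
    qed
    moreover have "dist y x \<noteq> r"
    proof
      assume "dist y x = r"
      then have "\<Theta> x t \<ge> S" using Bt[OF t] A by (simp add: \<Theta>_def dist_norm norm_minus_commute)
      then show False using fpos le by simp
    qed
    ultimately have "p \<in> interior K" using x t by (simp add: K_def xt interior_Times)
    then have max: "local_max_at f (x, t)" using p(2) unfolding xt by (rule local_max_at_interior)
    \<comment> \<open>Under the coupling \<open>t\<close> moves by
      \<open>2 * (e \<bullet> z)\<close>, so \<open>- D * t\<^sup>2\<close> has second derivative
      \<open>- 8 * D\<close> in direction \<open>e\<close>.\<close>
    define M where "M = mat (2 * A) + (- (8 * D)) *\<^sub>R outer e"
    have M: "M \<in> symmetric_matrices" unfolding M_def by (intro symmetric_matrices_add symmetric_matrices_scaleR) simp_all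
    define c where "c = x - y"
    have "\<Theta> (x + (z - (2 * (e \<bullet> z)) *\<^sub>R e)) (t + 2 * (e \<bullet> z)) = quad_poly M
        ((2 * A) *\<^sub>R (c - (2 * (e \<bullet> c)) *\<^sub>R e) + (2 * B - 4 * D * t) *\<^sub>R e)
        (A * (c \<bullet> c) + B * t - D * t\<^sup>2) z" for z
    proof -
      have "x + (z - (2 * (e \<bullet> z)) *\<^sub>R e) - y = c + (z - (2 * (e \<bullet> z)) *\<^sub>R e)" by (simp add: c_def)
      moreover have "(norm (c + (z - (2 * (e \<bullet> z)) *\<^sub>R e)))\<^sup>2
        = c \<bullet> c + z \<bullet> z + 2 * (c \<bullet> z) - 4 * (e \<bullet> c) * (e \<bullet> z)"
        by (rule norm_add_reflect[OF e])
      ultimately have "\<Theta> (x + (z - (2 * (e \<bullet> z)) *\<^sub>R e)) (t + 2 * (e \<bullet> z))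
        = A * (c \<bullet> c + z \<bullet> z + 2 * (c \<bullet> z) - 4 * (e \<bullet> c) * (e \<bullet> z))
          + B * (t + 2 * (e \<bullet> z)) - D * (t + 2 * (e \<bullet> z))\<^sup>2"
        by (simp only: \<Theta>_def)
      moreover have "z \<bullet> (M *v z) = 2 * A * (z \<bullet> z) - 8 * D * (e \<bullet> z)\<^sup>2"
        unfolding M_def matrix_vector_mult_add_rdistrib scaleR_matrix_vector_assoc[symmetric]
        by (simp add: mat_scalar_mult outer_mult inner_simps power2_eq_square inner_commute)
      ultimately show ?thesis
        by (simp add: quad_poly_def inner_simps power2_eq_square field_simps)
    qed
    then have "superjet (\<lambda>z. \<Theta> (x + (z - (2 * (e \<bullet> z)) *\<^sub>R e)) (t + 2 * (e \<bullet> z))) 0 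
       (((2 * A) *\<^sub>R (c - (2 * (e \<bullet> c)) *\<^sub>R e) + (2 * B - 4 * D * t) *\<^sub>R e) + M *v 0) M"
      using superjet_quad_poly[OF M] by presburger
    from coupling_max[OF cont open_UNIV sub super e _ max[unfolded f_def] this]
    have "- 1 \<le> trace M" by simp
    also have "trace M = 2 * n * A - 8 * D"
      using e unfolding M_def trace_add trace_scaleR
      by (simp add: trace_mat trace_outer norm_eq_1 n_def)
    finally show False by (simp add: D_def)
  qed
  then have "v (y + \<rho> *\<^sub>R e) - v y \<le> B * \<rho> - D * \<rho>\<^sup>2" by (simp add: f_def \<Theta>_def)
  also have "\<dots> \<le> B * \<rho>" using D by simp
  also have "B = (1 + n / 4) * (S / r) + r / 4"
    using r by (simp add: B_def D_def A_def power2_eq_square field_simps)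
  finally show ?thesis by (simp add: n_def)
qed

section \<open>Quadratic growth\<close>

text \<open>Taking the squared distance as the variable avoids square roots; away from the centre
  only positive values of \<open>s\<close> occur.\<close>

lemma superjet_radial:
  fixes p x :: "real ^ 'n"
  assumes x: "x \<noteq> p"
    and d1: "\<And>s. s > 0 \<Longrightarrow> (\<psi> has_real_derivative \<psi>1 s) (at s)"
    and d2: "\<And>s. s > 0 \<Longrightarrow> (\<psi>1 has_real_derivative \<psi>2 s) (at s)"
  shows "\<exists>b A. superjet (\<lambda>x. \<psi> ((x - p) \<bullet> (x - p))) x b A \<and>
    trace A = 2 * real CARD('n) * \<psi>1 ((x - p) \<bullet> (x - p)) + 4 * \<psi>2 ((x - p) \<bullet> (x - p)) * ((x - p) \<bullet> (x - p))"
proof -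
  define N where "N x = (x - p) \<bullet> (x - p)" for x
  have pos: "N z > 0" if "z \<noteq> p" for z using that by (simp add: N_def)
  have dN: "(N has_derivative (\<lambda>h. 2 * ((z - p) \<bullet> h))) (at z)" for z
    unfolding N_def by (auto intro!: derivative_eq_intros simp: inner_commute)
  define g where "g z = (2 * \<psi>1 (N z)) *\<^sub>R (z - p)" for z
  define A where "A = mat (2 * \<psi>1 (N x)) + (4 * \<psi>2 (N x)) *\<^sub>R outer (x - p)"
  have "superjet (\<lambda>x. \<psi> (N x)) x (g x) A"
  proof (rule superjet_gradient[where r = "dist x p"])
    show "((\<lambda>x. \<psi> (N x)) has_derivative (\<lambda>h. g z \<bullet> h)) (at z)" if "z \<in> ball x (dist x p)" for z
    proof -
      have "z \<noteq> p" using that by auto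
      from DERIV_compose_FDERIV[OF d1[OF pos[OF this]] dN] show ?thesis
        by (rule has_derivative_eq_rhs) (simp add: g_def fun_eq_iff)
    qed
    have "((\<lambda>z. (2 * \<psi>1 (N z)) *\<^sub>R (z - p)) has_derivative
       (\<lambda>h. (2 * \<psi>1 (N x)) *\<^sub>R h + (2 * (2 * ((x - p) \<bullet> h) * \<psi>2 (N x))) *\<^sub>R (x - p))) (at x)"
      by (rule has_derivative_scaleR has_derivative_mult_right DERIV_compose_FDERIV[OF d2[OF pos[OF x]] dN])+
         (auto intro!: derivative_eq_intros)
    then show "(g has_derivative (\<lambda>h. A *v h)) (at x)"
      unfolding g_def
      by (rule has_derivative_eq_rhs)
         (simp add: A_def fun_eq_iff matrix_vector_mult_add_rdistrib mat_scalar_mult outer_mult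
           scaleR_matrix_vector_assoc[symmetric])
    show "A \<in> symmetric_matrices"
      unfolding A_def by (intro symmetric_matrices_add symmetric_matrices_scaleR) simp_all
  qed (use x in simp)
  moreover have "trace A = 2 * real CARD('n) * \<psi>1 (N x) + 4 * \<psi>2 (N x) * N x"
    by (simp add: A_def trace_add trace_scaleR trace_mat trace_outer N_def)
  ultimately show ?thesis unfolding N_def by blast
qed

lemma DERIV_inverse_power:
  fixes s :: real
  assumes "s > 0"
  shows "((\<lambda>s. C / s ^ k) has_real_derivative - (real k * C / s ^ Suc k)) (at s)"
proof (cases k)
  case (Suc j)
  have "((\<lambda>s. C * inverse (s ^ k)) has_real_derivative
      C * (- (inverse (s ^ k) * (real k * s ^ (k - Suc 0)) * inverse (s ^ k)))) (at s)"
    by (intro DERIV_cmult DERIV_inverse' DERIV_pow) (use assms in simp)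
  moreover have "C * (- (inverse (s ^ k) * (real k * s ^ (k - Suc 0)) * inverse (s ^ k)))
      = - (real k * C / s ^ Suc k)"
    using assms by (simp add: Suc field_simps)
  ultimately have "((\<lambda>s. C * inverse (s ^ k)) has_real_derivative - (real k * C / s ^ Suc k)) (at s)"
    by (rule DERIV_cong)
  then show ?thesis by (simp only: divide_inverse)
qed simp

text \<open>Comparison on an annulus. The exponent \<open>2 * CARD('n)\<close> makes the inverse
  power subharmonic in every dimension, and the quadratic term has Laplacian two, more than
  \<open>w\<close> may have. The bound is at most \<open>N0\<close> on the inner sphere and zero on
  the outer one.\<close>

lemma supersol_lower_bound:
  fixes w :: "real ^ 'n \<Rightarrow> real"
  assumes cont: "continuous_on UNIV w" and nonneg: "\<And>x. 0 \<le> w x"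
    and super: "subsol (\<lambda>x. - w x) UNIV (-1)"
    and \<delta>: "0 < \<delta>" "\<delta> < R" and N0: "N0 \<ge> 0" and inner: "\<And>x. norm (x - p) = \<delta> \<Longrightarrow> N0 \<le> w x"
    and x: "\<delta> \<le> norm (x - p)" "norm (x - p) \<le> R"
  shows "N0 * \<delta> ^ (2 * CARD('n)) * (1 / norm (x - p) ^ (2 * CARD('n)) - 1 / R ^ (2 * CARD('n)))
     + ((norm (x - p))\<^sup>2 - R\<^sup>2) / real CARD('n) \<le> w x"
proof -
  define m where "m = CARD('n)"
  have m: "m > 0" by (simp add: m_def)
  define C where "C = - (N0 * \<delta> ^ (2 * m))"
  have C: "C \<le> 0" using N0 \<delta> by (simp add: C_def)
  define c where "c = R\<^sup>2 / real m - C / R ^ (2 * m)"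
  define \<psi> where "\<psi> s = C / s ^ m - s / real m + c" for s
  define \<psi>1 where "\<psi>1 s = - (real m * C / s ^ Suc m) - 1 / real m" for s
  define \<psi>2 where "\<psi>2 s = real (Suc m) * (real m * C) / s ^ Suc (Suc m)" for s
  have d1: "(\<psi> has_real_derivative \<psi>1 s) (at s)" if "s > 0" for s
  proof -
    have "((\<lambda>s. C / s ^ m - s / real m + c) has_real_derivative
      - (real m * C / s ^ Suc m) - 1 / real m + 0) (at s)"
      by (intro DERIV_add DERIV_diff DERIV_inverse_power that DERIV_cdivide DERIV_ident DERIV_const)
    then show ?thesis by (simp add: \<psi>_def[abs_def] \<psi>1_def)
  qed
  have d2: "(\<psi>1 has_real_derivative \<psi>2 s) (at s)" if "s > 0" for s
  proof -
    have "((\<lambda>s. - (real m * C / s ^ Suc m) - 1 / real m) has_real_derivative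
      - (- (real (Suc m) * (real m * C) / s ^ Suc (Suc m))) - 0) (at s)"
      by (intro DERIV_minus DERIV_diff DERIV_inverse_power that DERIV_const)
    then show ?thesis by (simp add: \<psi>1_def[abs_def] \<psi>2_def)
  qed
  \<comment> \<open>\<open>H\<close> is the negative of the asserted lower bound; it is compared
    with the subsolution \<open>- w\<close>.\<close>
  define H where "H x = \<psi> ((x - p) \<bullet> (x - p))" for x
  have Heq: "H x = C / norm (x - p) ^ (2 * m) - (norm (x - p))\<^sup>2 / real m + c" for x
    by (simp add: H_def \<psi>_def power_mult power2_norm_eq_inner)
  define K where "K = cball p R - ball p \<delta>"
  have K: "compact K" unfolding K_def by (intro compact_diff) auto
  have int: "norm (z - p) = \<delta> \<or> norm (z - p) = R" if "z \<in> K - interior K" for z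
  proof (rule ccontr)
    assume "\<not> ?thesis"
    then have "z \<in> ball p R - cball p \<delta>" using that by (auto simp: K_def dist_norm norm_minus_commute)
    moreover have "ball p R - cball p \<delta> \<subseteq> interior K"
      by (rule interior_maximal) (auto simp: K_def intro: open_Diff)
    ultimately show False using that by blast
  qed
  have ne: "z \<noteq> p" if "z \<in> K" for z using that \<delta> by (auto simp: K_def)
  have "- w x \<le> H x"
  proof (rule subsol_comparison[where u = "\<lambda>x. - w x" and a = "-1" and K = K, OF K])
    show "subsol (\<lambda>x. - w x) (interior K) (- 1)" using super by (rule subsol_subset) simp
    show "continuous_on K (\<lambda>x. - w x)"
      by (intro continuous_intros continuous_on_subset[OF cont]) simp
    show "continuous_on K H"
      unfolding H_def \<psi>_def using ne m by (intro continuous_intros) auto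
    show "\<exists>b A. superjet H z b A \<and> trace A < - 1" if "z \<in> interior K" for z
    proof -
      have z: "z \<noteq> p" using ne that interior_subset by blast
      define s where "s = (z - p) \<bullet> (z - p)"
      have s: "s > 0" using z by (simp add: s_def)
      obtain b A where A: "superjet H z b A" "trace A = 2 * real m * \<psi>1 s + 4 * \<psi>2 s * s"
        using superjet_radial[OF z d1 d2] unfolding H_def s_def m_def by blast
      define T where "T = C / s ^ Suc m"
      have "\<psi>2 s * s = real (Suc m) * (real m * T)" "real m * \<psi>1 s = - (real m * real m * T) - 1"
        using s m by (simp_all add: \<psi>1_def \<psi>2_def T_def field_simps)
      then have "trace A = 2 * (- (real m * real m * T) - 1) + 4 * (real (Suc m) * (real m * T))"
        unfolding A by (metis mult.assoc)
      then have "trace A = - 2 + T * (4 * (real (Suc m) * real m) - 2 * real m * real m)"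
        by (simp add: algebra_simps)
      also have "\<dots> \<le> - 2"
      proof -
        have "T \<le> 0" using C s by (simp add: T_def divide_nonpos_pos)
        moreover have "4 * (real (Suc m) * real m) - 2 * real m * real m \<ge> 0"
          by (simp add: algebra_simps)
        ultimately show ?thesis using mult_nonpos_nonneg by fastforce
      qed
      finally have "trace A < - 1" by simp
      then show ?thesis using A(1) by blast
    qed
    show "- w z \<le> H z" if "z \<in> K - interior K" for z
      using int[OF that]
    proof
      assume z: "norm (z - p) = \<delta>"
      have "C / \<delta> ^ (2 * m) = - N0" using \<delta> by (simp add: C_def)
      moreover have "\<delta>\<^sup>2 / real m \<le> R\<^sup>2 / real m"
        using \<delta> by (intro divide_right_mono power_mono) auto
      moreover have "C / R ^ (2 * m) \<le> 0" using C \<delta> by (simp add: divide_nonpos_pos)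
      ultimately show ?thesis using inner[OF z] unfolding Heq z by (simp add: c_def)
    next
      assume z: "norm (z - p) = R"
      show ?thesis using nonneg[of z] unfolding Heq z by (simp add: c_def)
    qed
    show "x \<in> K" using x by (simp add: K_def dist_norm norm_minus_commute)
  qed
  then show ?thesis
    unfolding Heq c_def C_def m_def by (simp add: algebra_simps diff_divide_distrib)
qed


text \<open>Maximising \<open>w x (1 - |x|)\<^sup>m\<close> gives a point near which \<open>w\<close> is comparable to its value there;
  the radial barrier of the same degree \<open>m\<close> transports this lower bound to the zero at the origin.\<close>

lemma quadratic_growth_unit:
  "\<exists>C>0. \<forall>w :: real ^ 'n \<Rightarrow> real. continuous_on UNIV w \<longrightarrow> (\<forall>x. 0 \<le> w x) \<longrightarrow> subsol w UNIV 0 \<longrightarrow>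
     subsol (\<lambda>x. - w x) UNIV (-1) \<longrightarrow> w 0 = 0 \<longrightarrow> (\<forall>y. norm y \<le> 1 / 2 \<longrightarrow> w y \<le> C)"
proof -
  define m where "m = 2 * CARD('n)"
  define L where "L = 1 + real CARD('n) / 4"
  \<comment> \<open>With this choice the Lipschitz bound loses at most half of the value
    \<open>N\<close> over the distance \<open>\<theta> * \<delta>\<close>.\<close>
  define \<theta> where "\<theta> = 1 / (2 * (4 * L * 2 ^ m + 1))"
  \<comment> \<open>The barrier will give
    \<open>N / 2 * (\<theta> * \<delta>) ^ m * (3 / 4) \<le> 4\<close>; the number 11 rounds up
    \<open>32 / 3\<close>.\<close>
  define C1 where "C1 = 11 * 2 ^ m / \<theta> ^ m"
  define C where "C = 2 ^ m * (1 + C1)"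
  have L: "L \<ge> 1" by (simp add: L_def)
  have "L * 2 ^ m \<ge> 1 * 1" using L by (intro mult_mono) auto
  then have \<theta>: "0 < \<theta>" "\<theta> \<le> 1 / 4" "(4 * L * 2 ^ m + 1) * \<theta> = 1 / 2"
    by (auto simp: \<theta>_def field_simps)
  have C1: "C1 > 0" using \<theta> by (simp add: C1_def)
  have "w y \<le> C" if cont: "continuous_on UNIV w" and nonneg: "\<And>x. 0 \<le> w x" and sub: "subsol w UNIV 0"
    and super: "subsol (\<lambda>x. - w x) UNIV (-1)" and w0: "w 0 = 0" and y: "norm y \<le> 1 / 2"
  for w :: "real ^ 'n \<Rightarrow> real" and y
  proof -
    define f where "f x = w x * (1 - norm x) ^ m" for x
    have "continuous_on (cball 0 1) f"
      unfolding f_def by (intro continuous_intros continuous_on_subset[OF cont]) simp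
    then obtain x0 where x0: "norm x0 \<le> 1" and fmax: "\<And>x. norm x \<le> 1 \<Longrightarrow> f x \<le> f x0"
      using continuous_attains_sup[of "cball 0 1" f] by auto
    have "f x0 \<le> 1 + C1"
    proof (cases "f x0 \<le> 1")
      case False
      \<comment> \<open>Half the distance from \<open>x0\<close> to the unit sphere: within
        \<open>\<delta>\<close> of \<open>x0\<close> the base of the weight at most halves, so
        maximality of \<open>f x0\<close> gives \<open>near\<close>.\<close>
      define \<delta> where "\<delta> = (1 - norm x0) / 2"
      define N where "N = w x0"
      have wt: "(1 - norm x0) ^ m \<le> 1" using x0 by (intro power_le_one) auto
      have "f x0 \<le> N" using mult_left_mono[OF wt nonneg[of x0]] by (simp add: f_def N_def)
      then have N: "N > 1" using False by simp
      have "norm x0 \<noteq> 1" using False by (auto simp: f_def m_def zero_power)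
      then have \<delta>: "0 < \<delta>" "\<delta> \<le> 1 / 2" using x0 by (auto simp: \<delta>_def)
      have fx0: "f x0 = N * (2 * \<delta>) ^ m" 
      proof -
        have "2 * \<delta> = 1 - norm x0" by (simp add: \<delta>_def)
        then show ?thesis by (simp add: f_def N_def)
      qed
      have near: "w x \<le> 2 ^ m * N" if "norm (x - x0) \<le> \<delta>" for x
      proof -
        have nx: "\<delta> \<le> 1 - norm x"
          using that norm_triangle_ineq[of x0 "x - x0"] by (simp add: \<delta>_def)
        have "w x * \<delta> ^ m \<le> f x"
          unfolding f_def using \<delta> nx nonneg by (intro mult_left_mono power_mono) auto
        also have "\<dots> \<le> N * (2 * \<delta>) ^ m" using fmax[of x] nx \<delta> fx0 by simp
        finally have "w x * \<delta> ^ m \<le> (2 ^ m * N) * \<delta> ^ m" by (simp add: power_mult_distrib mult_ac)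
        then show ?thesis using \<delta> by simp
      qed
      have inner: "N / 2 \<le> w x" if x: "norm (x - x0) \<le> \<theta> * \<delta>" for x
      proof (cases "x = x0")
        case True
        then show ?thesis using N by (simp add: N_def)
      next
        case False
        define e where "e = (x0 - x) /\<^sub>R norm (x0 - x)"
        define \<rho> where "\<rho> = norm (x0 - x)"
        have e: "norm e = 1" using False by (simp add: e_def)
        have \<rho>: "0 \<le> \<rho>" "\<rho> \<le> \<theta> * \<delta>" using x by (simp_all add: \<rho>_def norm_minus_commute)
        have \<theta>\<delta>: "\<theta> * \<delta> \<le> \<delta> / 4" using mult_right_mono[OF \<theta>(2), of \<delta>] \<delta> by simp
        have xe: "x + \<rho> *\<^sub>R e = x0" using False by (simp add: e_def \<rho>_def)
        \<comment> \<open>Room for \<open>lipschitz_bound\<close> with radius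
          \<open>\<delta> / 4\<close>: the doubled ball around \<open>x\<close> stays in the ball of
          radius \<open>\<delta>\<close> around \<open>x0\<close>.\<close>
        have bd: "w z \<le> 2 ^ m * N" if "z \<in> cball x (2 * (\<delta> / 4))" for z
        proof (rule near)
          have "norm (z - x0) \<le> norm (z - x) + norm (x - x0)"
            using norm_triangle_ineq[of "z - x" "x - x0"] by simp
          moreover have "norm (z - x) \<le> \<delta> / 2"
            using that by (simp add: dist_norm norm_minus_commute)
          ultimately show "norm (z - x0) \<le> \<delta>" using x \<theta>\<delta> \<delta> by linarith
        qed
        have "w (x + \<rho> *\<^sub>R e) - w x \<le> (L * (2 ^ m * N / (\<delta> / 4)) + (\<delta> / 4) / 4) * \<rho>"
          unfolding L_def
        proof (rule lipschitz_bound[OF cont nonneg sub super bd _ e])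
          show "\<rho> \<le> \<delta> / 4" using \<rho> \<theta>\<delta> by linarith
        qed (use \<delta> \<rho> in auto)
        also have "\<dots> \<le> (L * (2 ^ m * N / (\<delta> / 4)) + (\<delta> / 4) / 4) * (\<theta> * \<delta>)"
          using \<rho> L \<delta> N by (intro mult_left_mono) auto
        also have "\<dots> = (4 * L * 2 ^ m * N + \<delta> * \<delta> / 16) * \<theta>"
          using \<delta> by (simp add: field_simps)
        also have "\<dots> \<le> (4 * L * 2 ^ m * N + N) * \<theta>"
        proof -
          have "\<delta> * \<delta> \<le> 1 * 1" using \<delta> by (intro mult_mono) auto
          then show ?thesis using N \<theta> by (intro mult_right_mono) auto
        qed
        also have "\<dots> = N * ((4 * L * 2 ^ m + 1) * \<theta>)" by (simp add: algebra_simps)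
        also have "\<dots> = N / 2" unfolding \<theta>(3) by simp
        finally show ?thesis by (simp add: xe N_def)
      qed
      have \<theta>\<delta>: "0 < \<theta> * \<delta>" using \<theta> \<delta> by simp
      have \<theta>\<delta>2: "\<theta> * \<delta> < 2" using mult_mono[OF \<theta>(2) \<delta>(2)] \<delta> by simp
      have far: "\<theta> * \<delta> \<le> norm (0 - x0)"
        using inner[of 0] w0 N by fastforce
      \<comment> \<open>The origin lies in the annulus between radii
        \<open>\<theta> * \<delta>\<close> and 2 around \<open>x0\<close>. Since
        \<open>w 0 = 0\<close>, the lower bound there limits
        \<open>N * (\<theta> * \<delta>) ^ m\<close>.\<close>
      have "N / 2 * (\<theta> * \<delta>) ^ m * (1 / norm (0 - x0) ^ m - 1 / 2 ^ m)
        + ((norm (0 - x0))\<^sup>2 - 2\<^sup>2) / real CARD('n) \<le> w 0"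
        unfolding m_def
        by (rule supersol_lower_bound[OF cont nonneg super \<theta>\<delta> \<theta>\<delta>2]) (use N inner far x0 in auto)
      moreover have "((norm (0 - x0))\<^sup>2 - 2\<^sup>2) / real CARD('n) \<ge> - 4"
      proof -
        have "4 * 1 \<le> 4 * real CARD('n)" by (intro mult_left_mono) (simp_all add: Suc_leI)
        then have "(norm x0)\<^sup>2 + 4 * real CARD('n) \<ge> 4" using zero_le_power2[of "norm x0"] by linarith
        then show ?thesis by (simp add: field_simps)
      qed
      moreover have "1 / norm (0 - x0) ^ m - 1 / 2 ^ m \<ge> 3 / 4"
      proof -
        have "norm (0 - x0) > 0" using far \<theta>\<delta> by linarith
        then have "norm x0 > 0" by simp
        then have "1 / norm x0 ^ m \<ge> 1" using x0 by (simp add: power_le_one)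
        moreover have "(2 :: real) ^ 2 \<le> 2 ^ m"
          by (rule power_increasing) (auto simp: m_def Suc_leI)
        then have "1 / (2 :: real) ^ m \<le> 1 / 4" by (simp add: field_simps)
        ultimately have "1 / norm x0 ^ m - 1 / 2 ^ m \<ge> 3 / 4" by linarith
        then show ?thesis by simp
      qed
      then have "N / 2 * (\<theta> * \<delta>) ^ m * (3 / 4) \<le> N / 2 * (\<theta> * \<delta>) ^ m * (1 / norm (0 - x0) ^ m - 1 / 2 ^ m)"
        using N \<theta>\<delta> by (intro mult_left_mono) auto
      ultimately have "N / 2 * (\<theta> * \<delta>) ^ m * (3 / 4) \<le> 4" unfolding w0 by linarith
      then have "N * (\<theta> * \<delta>) ^ m \<le> 11" by simp
      then have "N * \<delta> ^ m \<le> 11 / \<theta> ^ m"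
        using \<theta> by (simp add: power_mult_distrib field_simps)
      then have "2 ^ m * (N * \<delta> ^ m) \<le> 2 ^ m * (11 / \<theta> ^ m)" by (rule mult_left_mono) simp
      then show ?thesis unfolding fx0 C1_def by (simp add: power_mult_distrib mult_ac)
    qed (use C1 in simp)
    then have "f y \<le> 1 + C1" using fmax[of y] y by simp
    moreover have "w y * (1 / 2) ^ m \<le> f y"
      unfolding f_def using y nonneg by (intro mult_left_mono power_mono) auto
    ultimately have "w y * (1 / 2) ^ m \<le> 1 + C1" by simp
    then have "2 ^ m * (w y * (1 / 2) ^ m) \<le> 2 ^ m * (1 + C1)" by (intro mult_left_mono) auto
    then show ?thesis by (simp add: C_def power_one_over)
  qed
  moreover have "C > 0" using C1 by (simp add: C_def)
  ultimately show ?thesis by blast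
qed

text \<open>Quadratic rescaling around \<open>p\<close> preserves all hypotheses;
  \<open>r = 2 * norm (y - p)\<close> moves \<open>y\<close> to norm one half.\<close>

lemma quadratic_growth:
  "\<exists>C>0. \<forall>v :: real ^ 'n \<Rightarrow> real. continuous_on UNIV v \<longrightarrow> (\<forall>x. 0 \<le> v x) \<longrightarrow> subsol v UNIV 0 \<longrightarrow>
     subsol (\<lambda>x. - v x) UNIV (-1) \<longrightarrow> (\<forall>p y. v p = 0 \<longrightarrow> v y \<le> C * (norm (y - p))\<^sup>2)"
proof -
  obtain C where C: "C > 0" and *: "\<And>w y. continuous_on UNIV w \<Longrightarrow> (\<And>x. 0 \<le> w x) \<Longrightarrow> subsol w UNIV 0 \<Longrightarrow>
     subsol (\<lambda>x. - w x) UNIV (-1) \<Longrightarrow> w 0 = 0 \<Longrightarrow> norm (y :: real ^ 'n) \<le> 1 / 2 \<Longrightarrow> w y \<le> C"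
    using quadratic_growth_unit[where ?'n = 'n] by blast
  have "v y \<le> 4 * C * (norm (y - p))\<^sup>2"
    if v: "continuous_on UNIV v" "\<And>x. 0 \<le> v x" "subsol v UNIV 0" "subsol (\<lambda>x. - v x) UNIV (-1)" and p: "v p = 0"
    for v :: "real ^ 'n \<Rightarrow> real" and p y
  proof (cases "y = p")
    case False
    define r where "r = 2 * norm (y - p)"
    have r: "r > 0" using False by (simp add: r_def)
    define w where "w z = 1 / r\<^sup>2 * v (p + r *\<^sub>R z)" for z
    have r2: "1 / r\<^sup>2 > 0" using r by simp
    have "w ((y - p) /\<^sub>R r) \<le> C"
    proof (rule *)
      show "continuous_on UNIV w"
        unfolding w_def by (intro continuous_intros continuous_on_compose2[OF v(1)]) auto
      show "0 \<le> w x" for x using v(2) by (simp add: w_def)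
      show "subsol w UNIV 0"
        using subsol_cmult[OF subsol_scale_shift[OF v(3), of r p] r2] r by (simp add: w_def[abs_def])
      show "subsol (\<lambda>x. - w x) UNIV (-1)"
        using subsol_cmult[OF subsol_scale_shift[OF v(4), of r p] r2] r by (simp add: w_def[abs_def])
      show "w 0 = 0" using p by (simp add: w_def)
      show "norm ((y - p) /\<^sub>R r) \<le> 1 / 2" using False by (simp add: r_def)
    qed
    then have "v y \<le> C * r\<^sup>2" using r by (simp add: w_def field_simps)
    then show ?thesis by (simp add: r_def power_mult_distrib mult_ac)
  qed (use p in simp)
  then show ?thesis using C by (intro exI[of _ "4 * C"]) auto
qed

section \<open>Rigidity in the half-space\<close>

text \<open>\<open>v\<close> is a nonnegative solution of an obstacle-type problem for the
  Laplacian, extended by zero below a hyperplane. The normal \<open>\<nu>\<close> need not have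
  length one, because it will be the image of a coordinate vector under a linear map.\<close>

definition half_sol :: "real ^ 'n \<Rightarrow> (real ^ 'n \<Rightarrow> real) \<Rightarrow> bool" where
  "half_sol \<nu> v \<longleftrightarrow> continuous_on UNIV v \<and> (\<forall>x. 0 \<le> v x) \<and> (\<forall>x. \<nu> \<bullet> x \<le> 0 \<longrightarrow> v x = 0) \<and>
     subsol (\<lambda>x. - v x) UNIV (-1) \<and> subsol v {x. 0 < v x} 1"

text \<open>Adding the touching inequalities at \<open>z\<close> and \<open>- z\<close> cancels the
  linear part, so every diagonal entry of \<open>A\<close> is nonnegative.\<close>

lemma subsol_zero: "subsol (\<lambda>x. 0) UNIV 0"
  unfolding subsol_def
proof (intro ballI allI impI)
  fix x0 A b c
  assume A: "A \<in> symmetric_matrices"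
    and max: "local_max_at (\<lambda>x. 0 - quad_poly A b c x) (x0 :: real ^ 'n)"
  define g where "g = b + A *v x0"
  have q: "quad_poly A b c (x0 + z) = quad_poly A b c x0 + g \<bullet> z + (z \<bullet> (A *v z)) / 2" for z
    unfolding g_def by (rule quad_poly_expand[OF A])
  have "\<forall>\<^sub>F z in nhds 0. 0 \<le> g \<bullet> z + (z \<bullet> (A *v z)) / 2"
    using max unfolding local_max_at_shift q by (rule eventually_mono) simp
  then obtain r where r: "r > 0" and nn: "\<And>z. norm z < r \<Longrightarrow> 0 \<le> g \<bullet> z + (z \<bullet> (A *v z)) / 2"
    unfolding eventually_nhds_metric by (auto simp: dist_norm)
  have "0 \<le> A $ i $ i" for i
  proof -
    define z where "z = (r / 2) *\<^sub>R (axis i 1 :: real ^ 'n)"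
    have "norm z < r" using r by (simp add: z_def norm_axis_1)
    then have "0 \<le> g \<bullet> z + (z \<bullet> (A *v z)) / 2" "0 \<le> g \<bullet> (- z) + ((- z) \<bullet> (A *v (- z))) / 2"
      by (intro nn; simp)+
    then have "0 \<le> z \<bullet> (A *v z)" 
      using matrix_vector_mult_scaleR[of A "- 1" z] by simp
    also have "z \<bullet> (A *v z) = (r / 2)\<^sup>2 * A $ i $ i"
      by (simp add: z_def inner_axis' matrix_vector_mult_scaleR matrix_vector_mult_basis column_def
          power2_eq_square)
    finally show ?thesis using r by (simp add: zero_le_mult_iff)
  qed
  then show "0 \<le> trace A" by (simp add: trace_def sum_nonneg)
qed

text \<open>At a zero of the nonnegative \<open>v\<close>, a polynomial touching \<open>v\<close>
  from above also touches the zero function from above.\<close>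

lemma half_sol_subsol:
  assumes "half_sol \<nu> v"
  shows "subsol v UNIV 0"
  unfolding subsol_def
proof (intro ballI allI impI)
  fix x0 A b c
  assume A: "A \<in> symmetric_matrices" and max: "local_max_at (\<lambda>x. v x - quad_poly A b c x) x0"
  have nn: "\<And>x. 0 \<le> v x" using assms by (simp add: half_sol_def)
  show "0 \<le> trace A"
  proof (cases "v x0 > 0")
    case True
    then have "1 \<le> trace A" using assms A max unfolding half_sol_def subsol_def by blast
    then show ?thesis by simp
  next
    case False
    then have "v x0 = 0" using nn[of x0] by simp
    have "local_max_at (\<lambda>x. 0 - quad_poly A b c x) x0"
      unfolding local_max_at_def
      using max[unfolded local_max_at_def] by (rule eventually_mono) (use \<open>v x0 = 0\<close> nn in \<open>smt (verit)\<close>)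
    then show ?thesis using subsol_zero A unfolding subsol_def by blast
  qed
qed

text \<open>Coupled barriers in height and separation become products of functions of two linear
  forms in \<open>z\<close>, with \<open>a = 2 *\<^sub>R e\<close>. Orthogonality of
  \<open>\<nu>\<close> and \<open>a\<close> then removes the mixed term of the trace.\<close>

lemma superjet_product:
  fixes \<nu> a :: "real ^ 'n"
  assumes f: "\<And>s. (f has_real_derivative f1 s) (at s)" "\<And>s. (f1 has_real_derivative f2 s) (at s)"
    and g: "\<And>s. (g has_real_derivative g1 s) (at s)" "\<And>s. (g1 has_real_derivative g2 s) (at s)"
  shows "\<exists>b A. superjet (\<lambda>z. f (s + \<nu> \<bullet> z) * g (t + a \<bullet> z)) 0 b A \<and>
     trace A = f2 s * g t * (\<nu> \<bullet> \<nu>) + 2 * f1 s * g1 t * (\<nu> \<bullet> a) + f s * g2 t * (a \<bullet> a)"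
proof -
  define G where "G z = (f1 (s + \<nu> \<bullet> z) * g (t + a \<bullet> z)) *\<^sub>R \<nu> + (f (s + \<nu> \<bullet> z) * g1 (t + a \<bullet> z)) *\<^sub>R a" for z
  \<comment> \<open>The mixed second derivative is written by polarisation, through
    \<open>outer (\<nu> + a)\<close>, to stay within rank-one matrices.\<close>
  define A where "A = (f2 s * g t) *\<^sub>R outer \<nu> + ((f1 s * g1 t) *\<^sub>R (outer (\<nu> + a) + (- 1) *\<^sub>R outer \<nu> + (- 1) *\<^sub>R outer a)
     + (f s * g2 t) *\<^sub>R outer a)"
  have l: "((\<lambda>z. k + w \<bullet> z) has_derivative (\<lambda>h. w \<bullet> h)) (at z)" for k and w z :: "real ^ 'n"
    by (auto intro!: derivative_eq_intros)
  note d = DERIV_compose_FDERIV[OF _ l]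
  have "superjet (\<lambda>z. f (s + \<nu> \<bullet> z) * g (t + a \<bullet> z)) 0 (G 0) A"
  proof (rule superjet_gradient[where r = 1])
    show "((\<lambda>z. f (s + \<nu> \<bullet> z) * g (t + a \<bullet> z)) has_derivative (\<lambda>h. G z \<bullet> h)) (at z)" for z
      by (rule has_derivative_eq_rhs, rule has_derivative_mult[OF d[OF f(1)] d[OF g(1)]])
         (simp add: G_def fun_eq_iff inner_add_left algebra_simps)
    have 1: "((\<lambda>z. f1 (s + \<nu> \<bullet> z) * g (t + a \<bullet> z)) has_derivative (\<lambda>h. f1 s * ((a \<bullet> h) * g1 t) + (\<nu> \<bullet> h) * f2 s * g t)) (at 0)"
      using has_derivative_mult[OF d[OF f(2), of s \<nu> 0] d[OF g(1), of t a 0]] by simp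
    have 2: "((\<lambda>z. f (s + \<nu> \<bullet> z) * g1 (t + a \<bullet> z)) has_derivative (\<lambda>h. f s * ((a \<bullet> h) * g2 t) + (\<nu> \<bullet> h) * f1 s * g1 t)) (at 0)"
      using has_derivative_mult[OF d[OF f(1), of s \<nu> 0] d[OF g(2), of t a 0]] by simp
    show "(G has_derivative (\<lambda>h. A *v h)) (at 0)"
      unfolding G_def
      by (rule has_derivative_eq_rhs, rule has_derivative_add[OF has_derivative_scaleR_left[OF 1] has_derivative_scaleR_left[OF 2]])
         (unfold A_def matrix_vector_mult_add_rdistrib scaleR_matrix_vector_assoc[symmetric] outer_mult,
           simp add: fun_eq_iff inner_add_left scaleR_add_left scaleR_add_right algebra_simps)
    show "A \<in> symmetric_matrices"
      unfolding A_def by (intro symmetric_matrices_add symmetric_matrices_scaleR) simp_all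
  qed simp
  moreover have "trace A = f2 s * g t * (\<nu> \<bullet> \<nu>) + 2 * f1 s * g1 t * (\<nu> \<bullet> a) + f s * g2 t * (a \<bullet> a)"
    unfolding A_def trace_add trace_scaleR trace_outer
    by (simp add: inner_add_left inner_add_right inner_commute algebra_simps)
  ultimately show ?thesis by blast
qed

lemma superjet_norm_reflect:
  assumes e: "norm e = 1"
  shows "\<exists>b. superjet (\<lambda>z. p * (norm (c + (z - (2 * (e \<bullet> z)) *\<^sub>R e)))\<^sup>2) 0 b (mat (2 * p))"
proof -
  have "p * (norm (c + (z - (2 * (e \<bullet> z)) *\<^sub>R e)))\<^sup>2
     = quad_poly (mat (2 * p)) ((2 * p) *\<^sub>R (c - (2 * (e \<bullet> c)) *\<^sub>R e)) (p * (c \<bullet> c)) z" for z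
  proof -
    have "p * (norm (c + (z - (2 * (e \<bullet> z)) *\<^sub>R e)))\<^sup>2
      = p * (c \<bullet> c + z \<bullet> z + 2 * (c \<bullet> z) - 4 * (e \<bullet> c) * (e \<bullet> z))"
      unfolding norm_add_reflect[OF e] ..
    then show ?thesis
      by (simp add: quad_poly_def mat_scalar_mult inner_simps field_simps)
  qed
  then have "(\<lambda>z. p * (norm (c + (z - (2 * (e \<bullet> z)) *\<^sub>R e)))\<^sup>2)
     = quad_poly (mat (2 * p)) ((2 * p) *\<^sub>R (c - (2 * (e \<bullet> c)) *\<^sub>R e)) (p * (c \<bullet> c))" by (rule ext)
  then show ?thesis using superjet_quad_poly[OF symmetric_matrices_mat] by metis
qed

lemma sinh_le_mult_cosh:
  assumes "(x :: real) \<ge> 0"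
  shows "sinh x \<le> x * cosh x"
proof -
  define g where "g t = t * cosh t - sinh t" for t :: real
  have "g 0 \<le> g x"
  proof (rule DERIV_nonneg_imp_nondecreasing[OF assms])
    fix t :: real assume "0 \<le> t"
    moreover have "(g has_real_derivative t * sinh t) (at t)"
      unfolding g_def by (auto intro!: derivative_eq_intros)
    ultimately show "\<exists>y. (g has_real_derivative y) (at t) \<and> 0 \<le> y" by auto
  qed
  then show ?thesis by (simp add: g_def)
qed

lemma sinh_ge: "(x :: real) \<ge> 0 \<Longrightarrow> x \<le> sinh x"
proof -
  assume x: "x \<ge> 0"
  define g where "g t = sinh t - t" for t :: real
  have "g 0 \<le> g x"
  proof (rule DERIV_nonneg_imp_nondecreasing[OF x])
    fix t :: real assume "0 \<le> t"
    have "(g has_real_derivative cosh t - 1) (at t)"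
      unfolding g_def by (auto intro!: derivative_eq_intros)
    then show "\<exists>y. (g has_real_derivative y) (at t) \<and> 0 \<le> y"
      using cosh_real_ge_1[of t] by (intro exI[of _ "cosh t - 1"]) simp
  qed
  then show ?thesis by (simp add: g_def)
qed


text \<open>The Hopf step at unit height, on the strip where \<open>s\<close> lies between
  \<open>1 / 2\<close> and \<open>3 / 2\<close>. The sine vanishes on both edges, where the
  hypothesis with constant \<open>c\<close> applies, and the hyperbolic sine vanishes at
  \<open>t = 0\<close>. At the far end \<open>t = T\<close> the growth bound leaves room for the
  barrier. In the middle, \<open>s = 1\<close>, the sine is one and the constant drops by
  \<open>\<eta> * \<kappa>\<close>.\<close>

lemma half_sol_reflection_bound:
  fixes \<nu> e :: "real ^ 'n"
  assumes v: "half_sol \<nu> v" and \<nu>: "\<nu> \<noteq> 0" and e: "norm e = 1" "\<nu> \<bullet> e = 0"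
    and C: "C > 0" "\<And>x. 0 < \<nu> \<bullet> x \<Longrightarrow> v x \<le> C * (\<nu> \<bullet> x)\<^sup>2"
    and c: "c > 0" "\<And>x \<rho>. 0 < \<nu> \<bullet> x \<Longrightarrow> 0 \<le> \<rho> \<Longrightarrow> v (x + \<rho> *\<^sub>R e) - v x \<le> c * (\<nu> \<bullet> x) * \<rho>"
  defines "\<kappa> \<equiv> pi * sqrt (\<nu> \<bullet> \<nu>) / 2"
  defines "\<eta> \<equiv> c / (4 * \<kappa> * cosh (\<kappa> * (3 * C / c)))"
  assumes x: "\<nu> \<bullet> xs = 1" and \<rho>: "0 \<le> \<rho>s" "\<rho>s \<le> 3 * C / c"
  shows "v (xs + \<rho>s *\<^sub>R e) - v xs \<le> (c - \<eta> * \<kappa>) * \<rho>s"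
proof -
  define q where "q = \<nu> \<bullet> \<nu>"
  define T where "T = 3 * C / c"
  have cT: "c * T = 3 * C" using c by (simp add: T_def)
  have T: "T > 0" using C c by (simp add: T_def)
  have q: "q > 0" using \<nu> by (simp add: q_def)
  have \<kappa>: "\<kappa> > 0" "4 * \<kappa>\<^sup>2 = pi\<^sup>2 * q"
    using q by (simp_all add: \<kappa>_def q_def[symmetric] power_mult_distrib power_divide)
  have \<eta>: "\<eta> > 0" using c \<kappa> by (simp add: \<eta>_def cosh_real_pos)
  have cont: "continuous_on UNIV v" and nonneg: "\<And>x. 0 \<le> v x"
    and super: "subsol (\<lambda>x. - v x) UNIV (-1)" and sub: "subsol v {x. 0 < v x} 1"
    using v by (auto simp: half_sol_def)
  have Vopen: "open {x. 0 < v x}" using cont by (simp add: open_Collect_less)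
  \<comment> \<open>\<open>\<eta>\<close> is chosen for this bound: as \<open>s \<ge> 1 / 2\<close>,
    the correction removes at most half of \<open>c * s * t\<close>.\<close>
  have bar: "\<eta> * (sin (pi * (s - 1 / 2)) * sinh (\<kappa> * t)) \<le> c * t / 4" if "0 \<le> t" "t \<le> T" for s t
  proof -
    have "sin (pi * (s - 1 / 2)) * sinh (\<kappa> * t) \<le> 1 * sinh (\<kappa> * t)"
      using that \<kappa> by (intro mult_right_mono sin_le_one) simp
    also have "\<dots> \<le> (\<kappa> * t) * cosh (\<kappa> * t)" using sinh_le_mult_cosh[of "\<kappa> * t"] that \<kappa> by simp
    also have "\<dots> \<le> (\<kappa> * t) * cosh (\<kappa> * T)"
      using that \<kappa> T by (intro mult_left_mono) (auto simp: cosh_real_nonneg_le_iff)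
    finally have "\<eta> * (sin (pi * (s - 1 / 2)) * sinh (\<kappa> * t)) \<le> \<eta> * ((\<kappa> * t) * cosh (\<kappa> * T))"
      using \<eta> by (intro mult_left_mono) auto
    also have "\<dots> = c * t / 4"
      using \<kappa> cosh_real_pos[of "\<kappa> * T"] by (simp add: \<eta>_def T_def[symmetric])
    finally show ?thesis .
  qed
  define \<Phi> where "\<Phi> s t = c * s * t - \<eta> * (sin (pi * (s - 1 / 2)) * sinh (\<kappa> * t))" for s t
  have "v (xs + \<rho>s *\<^sub>R e) - v xs \<le> \<Phi> 1 \<rho>s"
  proof (rule ccontr)
    assume neg: "\<not> ?thesis"
    define E where "E = v (xs + \<rho>s *\<^sub>R e) - v xs - \<Phi> 1 \<rho>s"
    have E: "E > 0" using neg by (simp add: E_def)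
    define \<mu> where "\<mu> = E / 4"
    have \<mu>: "\<mu> > 0" using E by (simp add: \<mu>_def)
    define n where "n = real CARD('n)"
    have n: "n > 0" by (simp add: n_def)
    \<comment> \<open>\<open>p * (norm x)\<^sup>2\<close> confines the maximum to a bounded part of
      the strip. Its trace contribution \<open>2 * p * n\<close> is outweighed by
      \<open>- 2 * q * \<mu>\<close> from the concave term with \<open>\<mu>\<close>, and both terms
      together leave part of the excess \<open>E\<close>.\<close>
    define p where "p = min (q * \<mu> / (2 * n)) (E / (4 * (1 + (norm xs)\<^sup>2)))"
    have xs1: "1 + (norm xs)\<^sup>2 > 0" by (simp add: add_pos_nonneg)
    have p: "p > 0" "p * n < q * \<mu>" "p * (norm xs)\<^sup>2 \<le> E / 4"
    proof -
      show "p > 0" using q \<mu> n E xs1 by (simp add: p_def)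
      have "p * n \<le> q * \<mu> / (2 * n) * n" using n by (intro mult_right_mono) (auto simp: p_def)
      also have "\<dots> < q * \<mu>" using n q \<mu> by simp
      finally show "p * n < q * \<mu>" .
      have "p * (norm xs)\<^sup>2 \<le> p * (1 + (norm xs)\<^sup>2)" using \<open>p > 0\<close> by simp
      also have "\<dots> \<le> E / (4 * (1 + (norm xs)\<^sup>2)) * (1 + (norm xs)\<^sup>2)"
        using xs1 by (intro mult_right_mono) (auto simp: p_def)
      also have "\<dots> = E / 4"
      proof -
        have "E / (4 * X) * X = E / 4" if "X > 0" for X using that by simp
        then show ?thesis using xs1 by blast
      qed
      finally show "p * (norm xs)\<^sup>2 \<le> E / 4" .
    qed
    define Rb where "Rb = norm xs + sqrt (9 * C / (4 * p)) + 1"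
    have Rb: "norm xs < Rb" "Rb > 0" "p * Rb\<^sup>2 \<ge> 9 * C / 4"
    proof -
      have s0: "sqrt (9 * C / (4 * p)) \<ge> 0" using C p by simp
      then show "norm xs < Rb" "Rb > 0" by (simp_all add: Rb_def add_nonneg_pos)
      have "(sqrt (9 * C / (4 * p)))\<^sup>2 \<le> Rb\<^sup>2" using s0 by (intro power_mono) (auto simp: Rb_def)
      then have "9 * C / (4 * p) \<le> Rb\<^sup>2" using C p by simp
      then show "p * Rb\<^sup>2 \<ge> 9 * C / 4" using p by (simp add: field_simps)
    qed
    define \<Theta> where "\<Theta> x t = \<Phi> (\<nu> \<bullet> x) t + \<mu> * (9 / 4 - (\<nu> \<bullet> x)\<^sup>2) + p * (norm x)\<^sup>2" for x t
    define f where "f = (\<lambda>(x, t). v (x + t *\<^sub>R e) - v x - \<Theta> x t)"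
    define S where "S = {x :: real ^ 'n. 1 / 2 \<le> \<nu> \<bullet> x \<and> \<nu> \<bullet> x \<le> 3 / 2}"
    define K where "K = (cball 0 Rb \<inter> S) \<times> {0..T}"
    have "closed S" unfolding S_def
      by (intro closed_Collect_conj closed_Collect_le continuous_intros)
    then have "compact K" unfolding K_def by (intro compact_Times compact_Int_closed) auto
    moreover have "continuous_on K f"
      unfolding f_def \<Theta>_def \<Phi>_def case_prod_beta
      by (intro continuous_intros continuous_on_compose2[OF cont]; simp)
    moreover have xK: "(xs, \<rho>s) \<in> K"
      using x \<rho> Rb by (simp add: K_def S_def T_def)
    ultimately obtain P where P: "P \<in> K" "\<And>y. y \<in> K \<Longrightarrow> f y \<le> f P"
      using continuous_attains_sup[of K f] by blast
    obtain y t where yt: "P = (y, t)" by (cases P)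
    define s where "s = \<nu> \<bullet> y"
    have y: "norm y \<le> Rb" "1 / 2 \<le> s" "s \<le> 3 / 2" and t: "0 \<le> t" "t \<le> T"
      using P(1) by (auto simp: K_def S_def yt s_def)
    have "f (xs, \<rho>s) = E - \<mu> * (5 / 4) - p * (norm xs)\<^sup>2"
      by (simp add: f_def \<Theta>_def x E_def)
    then have "f (xs, \<rho>s) > 0" using p(3) E unfolding \<mu>_def by linarith
    then have fpos: "v (y + t *\<^sub>R e) - v y > \<Theta> y t"
      using P(2)[OF xK] by (simp add: f_def yt)
    have \<mu>s: "\<mu> * (9 / 4 - s\<^sup>2) \<ge> 0"
    proof -
      have "s\<^sup>2 \<le> (3 / 2)\<^sup>2" using y by (intro power_mono) auto
      then show ?thesis using \<mu> by (simp add: power2_eq_square)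
    qed
    have pn: "p * (norm y)\<^sup>2 \<ge> 0" using p by simp
    have vC: "v (y + t *\<^sub>R e) - v y \<le> C * s\<^sup>2"
      using C(2)[of "y + t *\<^sub>R e"] nonneg[of y] y e by (simp add: inner_add_right s_def)
    have \<Phi>0: "\<Phi> s t \<ge> c * t / 2 * s + c * t / 2 * s - c * t / 4" using bar[OF t, of s] by (simp add: \<Phi>_def)
    have ct: "c * t / 2 * s \<ge> c * t / 4"
    proof -
      have "c * t / 2 * s \<ge> c * t / 2 * (1 / 2)" using y t c by (intro mult_left_mono) auto
      then show ?thesis by simp
    qed
    have \<Phi>1: "\<Phi> s t \<ge> 0" using \<Phi>0 ct t c by (smt (verit) divide_nonneg_nonneg mult_nonneg_nonneg)
    have \<Theta>: "\<Theta> y t \<ge> \<Phi> s t" "\<Theta> y t \<ge> \<Phi> s t + p * (norm y)\<^sup>2" using \<mu>s pn by (simp_all add: \<Theta>_def s_def)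
    have "t \<noteq> 0" using fpos \<Theta> \<Phi>1 by auto
    moreover have "t \<noteq> T"
    proof
      assume "t = T"
      \<comment> \<open>Half of \<open>c * s * T\<close> is \<open>3 / 2 * C * s\<close>, which is
        at least \<open>C * s\<^sup>2\<close> because \<open>s \<le> 3 / 2\<close>; this explains
        the choice of \<open>T\<close>.\<close>
      have "\<Phi> s t \<ge> c * T / 2 * s" using \<Phi>0 ct unfolding \<open>t = T\<close> by linarith
      also have "c * T / 2 * s = C * (3 / 2) * s" unfolding cT by simp
      also have "C * (3 / 2) * s \<ge> C * s * s" using C y by (simp add: mult_right_mono)
      finally show False using vC fpos \<Theta> by (simp add: power2_eq_square)
    qed
    moreover have "s \<noteq> 1 / 2"
    proof
      assume s: "s = 1 / 2"
      have "\<Phi> s t = c * s * t" unfolding \<Phi>_def s by simp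
      moreover have "v (y + t *\<^sub>R e) - v y \<le> c * s * t" using c(2)[of y t] y t by (simp add: s_def)
      ultimately show False using fpos \<Theta> by simp
    qed
    moreover have "s \<noteq> 3 / 2"
    proof
      assume s: "s = 3 / 2"
      have "\<Phi> s t = c * s * t" unfolding \<Phi>_def s by simp
      moreover have "v (y + t *\<^sub>R e) - v y \<le> c * s * t" using c(2)[of y t] y t by (simp add: s_def)
      ultimately show False using fpos \<Theta> by simp
    qed
    moreover have "norm y \<noteq> Rb"
    proof
      assume "norm y = Rb"
      have "s\<^sup>2 \<le> (3 / 2)\<^sup>2" using y by (intro power_mono) auto
      then have "C * s\<^sup>2 \<le> C * (9 / 4)" using C by (intro mult_left_mono) (auto simp: power2_eq_square)
      then show False using vC fpos \<Theta>(2) \<Phi>1 Rb(3) \<open>norm y = Rb\<close> by simp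
    qed
    ultimately have P': "norm y < Rb" "1 / 2 < \<nu> \<bullet> y" "\<nu> \<bullet> y < 3 / 2" "0 < t" "t < T"
      using y t by (auto simp: s_def)
    define O' where "O' = (ball 0 Rb \<inter> {x. 1 / 2 < \<nu> \<bullet> x \<and> \<nu> \<bullet> x < 3 / 2}) \<times> {0<..<T}"
    have "open O'"
      unfolding O'_def by (intro open_Times open_Int open_Collect_conj open_Collect_less continuous_intros) auto
    moreover have "O' \<subseteq> K" by (auto simp: O'_def K_def S_def)
    ultimately have "O' \<subseteq> interior K" by (rule interior_maximal[rotated])
    moreover have "(y, t) \<in> O'" using P' by (simp add: O'_def)
    ultimately have max: "local_max_at f (y, t)"
      using P(2) unfolding yt by (intro local_max_at_interior) auto
    \<comment> \<open>A positive maximum forces \<open>v\<close> to be positive at the shifted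
      point, so the lower bound one for its Laplacian is available there and cancels the upper bound
      one at \<open>y\<close>.\<close>
    have Y: "y + t *\<^sub>R e \<in> {x. 0 < v x}" using fpos \<Theta>(1) \<Phi>1 nonneg[of y] by simp
    have a: "(2 *\<^sub>R e) \<bullet> (2 *\<^sub>R e) = 4" "\<nu> \<bullet> (2 *\<^sub>R e) = 0" using e by (simp_all add: norm_eq_1)
    obtain b1 A1 where j1: "superjet (\<lambda>z. c * (s + \<nu> \<bullet> z) * (t + (2 *\<^sub>R e) \<bullet> z)) 0 b1 A1" "trace A1 = 0"
      using superjet_product[of "\<lambda>s. c * s" "\<lambda>s. c" "\<lambda>s. 0" "\<lambda>t. t" "\<lambda>t. 1" "\<lambda>t. 0" s \<nu> t "2 *\<^sub>R e"] a(2)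
      by (auto intro!: derivative_eq_intros)
    obtain b2 A2 where j2: "superjet (\<lambda>z. - \<eta> * sin (pi * (s + \<nu> \<bullet> z - 1 / 2)) * sinh (\<kappa> * (t + (2 *\<^sub>R e) \<bullet> z))) 0 b2 A2"
      "trace A2 = \<eta> * pi * pi * sin (pi * (s - 1 / 2)) * sinh (\<kappa> * t) * q
         + - \<eta> * sin (pi * (s - 1 / 2)) * (\<kappa> * \<kappa> * sinh (\<kappa> * t)) * 4"
    proof -
      have 1: "((\<lambda>s. - \<eta> * sin (pi * (s - 1 / 2))) has_real_derivative - \<eta> * pi * cos (pi * (s - 1 / 2))) (at s)" for s
        by (auto intro!: derivative_eq_intros)
      have 2: "((\<lambda>s. - \<eta> * pi * cos (pi * (s - 1 / 2))) has_real_derivative \<eta> * pi * pi * sin (pi * (s - 1 / 2))) (at s)" for s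
        by (auto intro!: derivative_eq_intros)
      have 3: "((\<lambda>t. sinh (\<kappa> * t)) has_real_derivative \<kappa> * cosh (\<kappa> * t)) (at t)" for t
        by (auto intro!: derivative_eq_intros)
      have 4: "((\<lambda>t. \<kappa> * cosh (\<kappa> * t)) has_real_derivative \<kappa> * \<kappa> * sinh (\<kappa> * t)) (at t)" for t
        by (auto intro!: derivative_eq_intros)
      show ?thesis
        using superjet_product[OF 1 2 3 4, of s \<nu> t "2 *\<^sub>R e"] that unfolding a q_def by auto
    qed
    \<comment> \<open>Under the coupling the operator in \<open>s\<close> and \<open>t\<close> is
      \<open>q\<close> times the second \<open>s\<close>-derivative plus four times the second
      \<open>t\<close>-derivative; \<open>\<kappa>\<close> makes the barrier a solution.\<close>
    have "trace A2 = \<eta> * sin (pi * (s - 1 / 2)) * sinh (\<kappa> * t) * (pi\<^sup>2 * q - 4 * \<kappa>\<^sup>2)"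
      unfolding j2 by (simp add: power2_eq_square algebra_simps)
    then have tr2: "trace A2 = 0" using \<kappa>(2) by simp
    obtain b3 A3 where j3: "superjet (\<lambda>z. \<mu> * (9 / 4 - (s + \<nu> \<bullet> z)\<^sup>2) * 1) 0 b3 A3" "trace A3 = - 2 * \<mu> * q"
    proof -
      have 1: "((\<lambda>s. \<mu> * (9 / 4 - s\<^sup>2)) has_real_derivative - 2 * \<mu> * s) (at s)" for s
        by (auto intro!: derivative_eq_intros)
      have 2: "((\<lambda>s. - 2 * \<mu> * s) has_real_derivative - 2 * \<mu>) (at s)" for s
        by (auto intro!: derivative_eq_intros)
      show ?thesis
        using superjet_product[OF 1 2 DERIV_const[of 1] DERIV_const[of 0], of s \<nu> "2 *\<^sub>R e"] that a
        unfolding q_def by auto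
    qed
    obtain b4 where j4: "superjet (\<lambda>z. p * (norm (y + (z - (2 * (e \<bullet> z)) *\<^sub>R e)))\<^sup>2) 0 b4 (mat (2 * p))"
      using superjet_norm_reflect[OF e(1)] by blast
    have "superjet (\<lambda>z. \<Theta> (y + (z - (2 * (e \<bullet> z)) *\<^sub>R e)) (t + 2 * (e \<bullet> z))) 0
       (b1 + b2 + b3 + b4) (A1 + A2 + A3 + mat (2 * p))"
    proof -
      have "\<nu> \<bullet> (y + (z - (2 * (e \<bullet> z)) *\<^sub>R e)) = s + \<nu> \<bullet> z" for z
        using e(2) by (simp add: inner_simps s_def)
      then have "\<Theta> (y + (z - (2 * (e \<bullet> z)) *\<^sub>R e)) (t + 2 * (e \<bullet> z))
        = c * (s + \<nu> \<bullet> z) * (t + (2 *\<^sub>R e) \<bullet> z) + - \<eta> * sin (pi * (s + \<nu> \<bullet> z - 1 / 2)) * sinh (\<kappa> * (t + (2 *\<^sub>R e) \<bullet> z))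
          + \<mu> * (9 / 4 - (s + \<nu> \<bullet> z)\<^sup>2) * 1 + p * (norm (y + (z - (2 * (e \<bullet> z)) *\<^sub>R e)))\<^sup>2" for z
        by (simp add: \<Theta>_def \<Phi>_def)
      then show ?thesis
        using superjet_add[OF superjet_add[OF superjet_add[OF j1(1) j2(1)] j3(1)] j4] by simp
    qed
    from coupling_max[OF cont Vopen sub super e(1) Y max[unfolded f_def] this]
    have "0 \<le> trace (A1 + A2 + A3 + mat (2 * p))" by simp
    also have "\<dots> = 2 * (p * n) - 2 * (q * \<mu>)"
      by (simp add: trace_add j1 tr2 j3 trace_mat n_def mult_ac)
    finally show False using p(2) by simp
  qed
  also have "\<Phi> 1 \<rho>s = c * \<rho>s - \<eta> * sinh (\<kappa> * \<rho>s)" by (simp add: \<Phi>_def)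
  also have "\<dots> \<le> c * \<rho>s - \<eta> * (\<kappa> * \<rho>s)"
    using sinh_ge[of "\<kappa> * \<rho>s"] \<rho> \<kappa> \<eta> by (simp add: mult_left_mono)
  finally show ?thesis by (simp add: algebra_simps)
qed


section \<open>Scaling, growth and tangential rigidity\<close>

lemma half_sol_scale:
  fixes v :: "real ^ 'n \<Rightarrow> real"
  assumes v: "half_sol \<nu> v" and s: "s > 0"
  shows "half_sol \<nu> (\<lambda>z. 1 / s\<^sup>2 * v (s *\<^sub>R z))"
  unfolding half_sol_def
proof (intro conjI allI impI)
  have v': "continuous_on UNIV v" "\<And>x. 0 \<le> v x" "\<And>x. \<nu> \<bullet> x \<le> 0 \<Longrightarrow> v x = 0"
    "subsol (\<lambda>x. - v x) UNIV (-1)" "subsol v {x. 0 < v x} 1"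
    using v by (auto simp: half_sol_def)
  have s2: "1 / s\<^sup>2 > 0" using s by simp
  show "continuous_on UNIV (\<lambda>z. 1 / s\<^sup>2 * v (s *\<^sub>R z))"
    by (intro continuous_intros continuous_on_compose2[OF v'(1)]) auto
  show "0 \<le> 1 / s\<^sup>2 * v (s *\<^sub>R x)" for x using v'(2) by simp
  show "1 / s\<^sup>2 * v (s *\<^sub>R x) = 0" if "\<nu> \<bullet> x \<le> 0" for x
    using v'(3)[of "s *\<^sub>R x"] that s by (simp add: mult_nonneg_nonpos)
  show "subsol (\<lambda>x. - (1 / s\<^sup>2 * v (s *\<^sub>R x))) UNIV (- 1)"
    using subsol_cmult[OF subsol_scale_shift[OF v'(4), of s 0] s2] s by simp
  have "{z. 0 < 1 / s\<^sup>2 * v (s *\<^sub>R z)} = {z. 0 + s *\<^sub>R z \<in> {x. 0 < v x}}"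
    using s by (auto simp: zero_less_divide_iff)
  then show "subsol (\<lambda>z. 1 / s\<^sup>2 * v (s *\<^sub>R z)) {z. 0 < 1 / s\<^sup>2 * v (s *\<^sub>R z)} 1"
    using subsol_cmult[OF subsol_scale_shift[OF v'(5), of s 0] s2] s by simp
qed

text \<open>The orthogonal projection \<open>p\<close> of \<open>x\<close> to the hyperplane is a
  zero of \<open>v\<close>, so growth away from \<open>p\<close> is growth in the height.\<close>

lemma half_sol_growth:
  fixes \<nu> :: "real ^ 'n"
  assumes v: "half_sol \<nu> v" and \<nu>: "\<nu> \<noteq> 0"
  obtains C where "C > 0" "\<And>x. v x \<le> C * (\<nu> \<bullet> x)\<^sup>2"
proof -
  obtain C where C: "C > 0" and *: "\<And>p y. v p = 0 \<Longrightarrow> v y \<le> C * (norm (y - p))\<^sup>2"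
    using quadratic_growth[where ?'n = 'n] half_sol_subsol[OF v] v unfolding half_sol_def by blast
  define q where "q = \<nu> \<bullet> \<nu>"
  have q: "q > 0" using \<nu> by (simp add: q_def)
  show ?thesis
  proof (rule that[of "C / q"])
    show "C / q > 0" using C q by simp
    fix x
    define p where "p = x - ((\<nu> \<bullet> x) / q) *\<^sub>R \<nu>"
    have "\<nu> \<bullet> p = 0" using q by (simp add: p_def inner_diff_right q_def)
    then have "v p = 0" using v by (simp add: half_sol_def)
    from *[OF this, of x] have "v x \<le> C * (norm (((\<nu> \<bullet> x) / q) *\<^sub>R \<nu>))\<^sup>2" by (simp add: p_def)
    also have "(norm (((\<nu> \<bullet> x) / q) *\<^sub>R \<nu>))\<^sup>2 = (\<nu> \<bullet> x)\<^sup>2 / q"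
      using q unfolding power2_norm_eq_inner by (simp add: q_def[symmetric] power2_eq_square)
    finally show "v x \<le> C / q * (\<nu> \<bullet> x)\<^sup>2" by simp
  qed
qed

text \<open>Makes the best constant in \<open>half_sol_nonincreasing\<close> finite. Displacements
  short relative to the height are handled by \<open>lipschitz_bound\<close>, long ones by the
  growth bound alone.\<close>

lemma half_sol_lipschitz:
  fixes \<nu> :: "real ^ 'n"
  assumes v: "half_sol \<nu> v" and \<nu>: "\<nu> \<noteq> 0" and e: "norm e = 1" "\<nu> \<bullet> e = 0"
  obtains c where "\<And>x \<rho>. 0 < \<nu> \<bullet> x \<Longrightarrow> 0 \<le> \<rho> \<Longrightarrow> v (x + \<rho> *\<^sub>R e) - v x \<le> c * ((\<nu> \<bullet> x) * \<rho>)"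
proof -
  obtain C where C: "C > 0" "\<And>x. v x \<le> C * (\<nu> \<bullet> x)\<^sup>2" using half_sol_growth[OF v \<nu>] by blast
  have v': "continuous_on UNIV v" "\<And>x. 0 \<le> v x" "\<And>x. \<nu> \<bullet> x \<le> 0 \<Longrightarrow> v x = 0"
    "subsol (\<lambda>x. - v x) UNIV (-1)"
    using v by (auto simp: half_sol_def)
  define k where "k = norm \<nu>"
  have k: "k > 0" using \<nu> by (simp add: k_def)
  define L where "L = 1 + real CARD('n) / 4"
  have L: "L > 0" by (simp add: L_def add_pos_nonneg)
  define c1 where "c1 = 9 * C * L * k + 1 / (16 * k)"
  have c1: "c1 > 0" using C L k by (simp add: c1_def add_pos_pos)
  show ?thesis
  proof (rule that[of "c1 + 4 * C * k"])
    fix x \<rho> assume x: "0 < \<nu> \<bullet> x" and \<rho>: "0 \<le> (\<rho> :: real)"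
    define s where "s = \<nu> \<bullet> x"
    have s: "s > 0" using x by (simp add: s_def)
    \<comment> \<open>On the ball of radius \<open>2 * r\<close> around \<open>x\<close> the height
      stays below \<open>3 / 2 * s\<close>.\<close>
    define r where "r = s / (4 * k)"
    have r: "r > 0" using s k by (simp add: r_def)
    have "v (x + \<rho> *\<^sub>R e) - v x \<le> (c1 + 4 * C * k) * (s * \<rho>)"
    proof (cases "\<rho> \<le> r")
      case True
      have bd: "v z \<le> C * (9 / 4 * s\<^sup>2)" if z: "z \<in> cball x (2 * r)" for z
      proof (cases "\<nu> \<bullet> z \<le> 0")
        case True
        then show ?thesis using v'(3) C by simp
      next
        case False
        have "\<nu> \<bullet> (z - x) \<le> k * norm (z - x)" unfolding k_def by (rule norm_cauchy_schwarz)
        also have "\<dots> \<le> k * (2 * r)" using z k by (intro mult_left_mono) (auto simp: dist_norm norm_minus_commute)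
        also have "\<dots> = s / 2" using k by (simp add: r_def)
        finally have "\<nu> \<bullet> z \<le> 3 / 2 * s" by (simp add: inner_diff_right s_def)
        then have "(\<nu> \<bullet> z)\<^sup>2 \<le> (3 / 2 * s)\<^sup>2" using False by (intro power_mono) auto
        then have "C * (\<nu> \<bullet> z)\<^sup>2 \<le> C * (3 / 2 * s)\<^sup>2" using C by (intro mult_left_mono) auto
        then show ?thesis using C(2)[of z] by (simp add: power2_eq_square)
      qed
      have "v (x + \<rho> *\<^sub>R e) - v x \<le> (L * (C * (9 / 4 * s\<^sup>2) / r) + r / 4) * \<rho>"
        unfolding L_def
        by (rule lipschitz_bound[OF v'(1,2) half_sol_subsol[OF v] v'(4) bd r e(1) \<rho> True])
      also have "\<dots> = c1 * (s * \<rho>)"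
        using s k by (simp add: r_def c1_def power2_eq_square field_simps)
      also have "\<dots> \<le> (c1 + 4 * C * k) * (s * \<rho>)"
        using s \<rho> C k by (intro mult_right_mono) auto
      finally show ?thesis .
    next
      case False
      have "v (x + \<rho> *\<^sub>R e) - v x \<le> C * s\<^sup>2"
        using C(2)[of "x + \<rho> *\<^sub>R e"] v'(2)[of x] e by (simp add: inner_add_right s_def)
      also have "C * s\<^sup>2 = 4 * C * k * (s * r)" using k by (simp add: r_def power2_eq_square)
      also have "\<dots> \<le> 4 * C * k * (s * \<rho>)" using False s C k by (intro mult_left_mono) auto
      also have "\<dots> \<le> (c1 + 4 * C * k) * (s * \<rho>)"
        using s \<rho> c1 by (intro mult_right_mono) auto
      finally show ?thesis .
    qed
    then show "v (x + \<rho> *\<^sub>R e) - v x \<le> (c1 + 4 * C * k) * ((\<nu> \<bullet> x) * \<rho>)" by (simp add: s_def)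
  qed
qed

text \<open>\<open>c\<close> is the supremum of quotients invariant under quadratic rescaling, so an
  improvement at unit height is an improvement at every height. Using \<open>- e\<close> as well as
  \<open>e\<close> later turns monotonicity into constancy.\<close>

lemma half_sol_nonincreasing:
  fixes \<nu> :: "real ^ 'n"
  assumes v: "half_sol \<nu> v" and \<nu>: "\<nu> \<noteq> 0" and e: "norm e = 1" "\<nu> \<bullet> e = 0"
    and x: "0 < \<nu> \<bullet> x" and \<rho>: "0 \<le> \<rho>"
  shows "v (x + \<rho> *\<^sub>R e) \<le> v x"
proof -
  obtain C where C: "C > 0" "\<And>x. v x \<le> C * (\<nu> \<bullet> x)\<^sup>2" using half_sol_growth[OF v \<nu>] by blast
  obtain c1 where c1: "\<And>x \<rho>. 0 < \<nu> \<bullet> x \<Longrightarrow> 0 \<le> \<rho> \<Longrightarrow> v (x + \<rho> *\<^sub>R e) - v x \<le> c1 * ((\<nu> \<bullet> x) * \<rho>)"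
    using half_sol_lipschitz[OF v \<nu> e] by blast
  define Q where "Q = (\<lambda>(x, \<rho>). (v (x + \<rho> *\<^sub>R e) - v x) / ((\<nu> \<bullet> x) * \<rho>))"
  define D where "D = {x. 0 < \<nu> \<bullet> x} \<times> {0 :: real<..}"
  define c where "c = Sup (Q ` D)"
  have "(\<nu>, 1) \<in> D" using \<nu> by (simp add: D_def)
  then have ne: "Q ` D \<noteq> {}" by blast
  have bdd: "bdd_above (Q ` D)"
    by (rule bdd_aboveI[of _ c1]) (use c1 in \<open>auto simp: Q_def D_def divide_le_eq\<close>)
  have cb: "v (x + \<rho> *\<^sub>R e) - v x \<le> c * (\<nu> \<bullet> x) * \<rho>" if "0 < \<nu> \<bullet> x" "0 \<le> \<rho>" for x \<rho>
  proof (cases "\<rho> = 0")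
    case False
    then have "(x, \<rho>) \<in> D" using that by (simp add: D_def)
    then have "Q (x, \<rho>) \<le> c" unfolding c_def by (intro cSup_upper bdd) blast
    then show ?thesis using that False by (simp add: Q_def divide_le_eq mult.assoc)
  qed simp
  have "c \<le> 0"
  proof (rule ccontr)
    assume "\<not> c \<le> 0"
    then have c: "c > 0" by simp
    define \<kappa> where "\<kappa> = pi * sqrt (\<nu> \<bullet> \<nu>) / 2"
    define \<eta> where "\<eta> = c / (4 * \<kappa> * cosh (\<kappa> * (3 * C / c)))"
    have \<kappa>: "\<kappa> > 0" using \<nu> by (simp add: \<kappa>_def)
    then have \<eta>: "\<eta> * \<kappa> > 0" using c cosh_real_pos[of "\<kappa> * (3 * C / c)"] by (simp add: \<eta>_def)
    have small: "v (x + \<rho> *\<^sub>R e) - v x \<le> (c - \<eta> * \<kappa>) * (\<nu> \<bullet> x) * \<rho>"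
      if x: "0 < \<nu> \<bullet> x" and \<rho>: "0 \<le> \<rho>" "\<rho> \<le> 3 * C / c * (\<nu> \<bullet> x)" for x \<rho>
    proof -
      define s where "s = \<nu> \<bullet> x"
      have s: "s > 0" using x by (simp add: s_def)
      \<comment> \<open>Rescales to unit height; the constants \<open>C\<close> and \<open>c\<close>
        are unchanged.\<close>
      define w where "w z = 1 / s\<^sup>2 * v (s *\<^sub>R z)" for z
      have w: "half_sol \<nu> w" unfolding w_def by (rule half_sol_scale[OF v s])
      have "w ((1 / s) *\<^sub>R x + (\<rho> / s) *\<^sub>R e) - w ((1 / s) *\<^sub>R x) \<le> (c - \<eta> * \<kappa>) * (\<rho> / s)"
        unfolding \<eta>_def \<kappa>_def
      proof (rule half_sol_reflection_bound[OF w \<nu> e C(1) _ c])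
        fix z assume "0 < \<nu> \<bullet> z"
        show "w z \<le> C * (\<nu> \<bullet> z)\<^sup>2"
          using C(2)[of "s *\<^sub>R z"] s by (simp add: w_def field_simps power_mult_distrib)
      next
        fix z \<rho>' assume z: "0 < \<nu> \<bullet> z" "0 \<le> (\<rho>' :: real)"
        have "v (s *\<^sub>R z + (s * \<rho>') *\<^sub>R e) - v (s *\<^sub>R z) \<le> c * (\<nu> \<bullet> (s *\<^sub>R z)) * (s * \<rho>')"
          using cb[of "s *\<^sub>R z" "s * \<rho>'"] z s by simp
        also have "\<dots> = s\<^sup>2 * (c * (\<nu> \<bullet> z) * \<rho>')" by (simp add: power2_eq_square)
        finally have "1 / s\<^sup>2 * (v (s *\<^sub>R z + (s * \<rho>') *\<^sub>R e) - v (s *\<^sub>R z)) \<le> c * (\<nu> \<bullet> z) * \<rho>'"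
          using s by (simp add: field_simps)
        then show "w (z + \<rho>' *\<^sub>R e) - w z \<le> c * (\<nu> \<bullet> z) * \<rho>'"
          by (simp add: w_def scaleR_add_right right_diff_distrib diff_divide_distrib)
      next
        show "\<nu> \<bullet> (1 / s) *\<^sub>R x = 1" using s by (simp add: s_def)
        show "0 \<le> \<rho> / s" "\<rho> / s \<le> 3 * C / c"
          using \<rho> s by (simp_all add: s_def[symmetric] pos_divide_le_eq)
      qed
      then have "1 / s\<^sup>2 * (v (x + \<rho> *\<^sub>R e) - v x) \<le> (c - \<eta> * \<kappa>) * (\<rho> / s)"
        using s by (simp add: w_def scaleR_add_right right_diff_distrib diff_divide_distrib)
      then have "s\<^sup>2 * (1 / s\<^sup>2 * (v (x + \<rho> *\<^sub>R e) - v x)) \<le> s\<^sup>2 * ((c - \<eta> * \<kappa>) * (\<rho> / s))"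
        by (rule mult_left_mono) simp
      then show ?thesis using s by (simp add: s_def[symmetric] power2_eq_square mult_ac)
    qed
    have all: "v (x + \<rho> *\<^sub>R e) - v x \<le> (c - \<eta> * \<kappa>) * (\<nu> \<bullet> x) * \<rho>"
      if x: "0 < \<nu> \<bullet> x" and \<rho>: "0 \<le> \<rho>" for x \<rho>
    proof -
      define \<rho>1 where "\<rho>1 = 3 * C / c * (\<nu> \<bullet> x)"
      have \<rho>1: "\<rho>1 > 0" using C c x by (simp add: \<rho>1_def)
      \<comment> \<open>The segment is cut into \<open>j\<close> pieces no longer than
        \<open>\<rho>1\<close>. Each piece starts at the same height, as \<open>e\<close> is
        orthogonal to \<open>\<nu>\<close>, so the improved constant sums up.\<close>
      obtain j :: nat where j: "\<rho> / \<rho>1 < real j" using reals_Archimedean2 by blast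
      have "real j > 0" using j \<rho> \<rho>1 by (smt (verit) divide_nonneg_pos)
      define h where "h = \<rho> / real j"
      have h: "0 \<le> h" "h \<le> \<rho>1"
        using j \<rho> \<rho>1 \<open>real j > 0\<close> by (simp_all add: h_def field_simps)
      have "v (x + (real i * h) *\<^sub>R e) - v x \<le> real i * ((c - \<eta> * \<kappa>) * (\<nu> \<bullet> x) * h)" for i
      proof (induction i)
        case (Suc i)
        have nu: "\<nu> \<bullet> (x + (real i * h) *\<^sub>R e) = \<nu> \<bullet> x" using e by (simp add: inner_add_right)
        have "v (x + (real i * h) *\<^sub>R e + h *\<^sub>R e) - v (x + (real i * h) *\<^sub>R e) \<le> (c - \<eta> * \<kappa>) * (\<nu> \<bullet> x) * h"
          using small[of "x + (real i * h) *\<^sub>R e" h] x h unfolding nu \<rho>1_def by simp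
        moreover have "x + (real i * h) *\<^sub>R e + h *\<^sub>R e = x + (real (Suc i) * h) *\<^sub>R e"
          by (simp add: scaleR_add_left distrib_right)
        ultimately show ?case using Suc by (simp add: distrib_right)
      qed simp
      from this[of j] show ?thesis using \<open>real j > 0\<close> by (simp add: h_def)
    qed
    have "c \<le> c - \<eta> * \<kappa>"
      unfolding c_def
    proof (rule cSup_least[OF ne])
      fix t assume "t \<in> Q ` D"
      then obtain x \<rho> where t: "t = Q (x, \<rho>)" and D: "0 < \<nu> \<bullet> x" "0 < \<rho>" by (auto simp: D_def)
      have "v (x + \<rho> *\<^sub>R e) - v x \<le> (c - \<eta> * \<kappa>) * ((\<nu> \<bullet> x) * \<rho>)"
        using all[of x \<rho>] D by (simp add: mult.assoc)
      then show "t \<le> Sup (Q ` D) - \<eta> * \<kappa>"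
        using D by (simp add: t Q_def divide_le_eq c_def)
    qed
    then show False using \<eta> by simp
  qed
  then have "c * (\<nu> \<bullet> x) * \<rho> \<le> 0" using x \<rho> by (simp add: mult_nonpos_nonneg)
  then show ?thesis using cb[OF x \<rho>] by simp
qed

lemma half_sol_one_dim:
  fixes \<nu> :: "real ^ 'n"
  assumes v: "half_sol \<nu> v" and \<nu>: "\<nu> \<noteq> 0" and eq: "\<nu> \<bullet> x = \<nu> \<bullet> y" and x: "0 < \<nu> \<bullet> x"
  shows "v x = v y"
proof -
  have le: "v y \<le> v x" if "\<nu> \<bullet> x = \<nu> \<bullet> y" "0 < \<nu> \<bullet> x" for x y
  proof (cases "x = y")
    case False
    define e where "e = (y - x) /\<^sub>R norm (y - x)"
    have "v (x + norm (y - x) *\<^sub>R e) \<le> v x"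
      by (rule half_sol_nonincreasing[OF v \<nu>]) (use False that in \<open>auto simp: e_def inner_diff_right\<close>)
    then show ?thesis using False by (simp add: e_def)
  qed simp
  show ?thesis using le[of x y] le[of y x] eq x by simp
qed

text \<open>As a function of the height alone, a subsolution is convex. It is zero at height zero
  and at \<open>a\<close>, hence it cannot be positive in between.\<close>

lemma half_sol_vanishes_below:
  fixes \<nu> :: "real ^ 'n"
  assumes v: "half_sol \<nu> v" and \<nu>: "\<nu> \<noteq> 0" and x0: "0 < \<nu> \<bullet> x0" "v x0 = 0"
    and y: "\<nu> \<bullet> y < \<nu> \<bullet> x0"
  shows "v y = 0"
proof (rule ccontr)
  assume "v y \<noteq> 0"
  have v': "continuous_on UNIV v" "\<And>x. 0 \<le> v x" "\<And>x. \<nu> \<bullet> x \<le> 0 \<Longrightarrow> v x = 0"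
    using v by (auto simp: half_sol_def)
  define q where "q = \<nu> \<bullet> \<nu>"
  have q: "q > 0" using \<nu> by (simp add: q_def)
  define a b where "a = \<nu> \<bullet> x0" and "b = \<nu> \<bullet> y"
  have pos: "v y > 0" using \<open>v y \<noteq> 0\<close> v'(2)[of y] by simp
  have b: "0 < b" "b < a" using v'(3)[of y] \<open>v y \<noteq> 0\<close> y unfolding a_def b_def by fastforce+
  define f where "f t = v ((t / q) *\<^sub>R \<nu>)" for t
  have vf: "v x = f (\<nu> \<bullet> x)" if "0 < \<nu> \<bullet> x" for x
    unfolding f_def by (rule half_sol_one_dim[OF v \<nu>]) (use that q in \<open>simp_all add: q_def\<close>)
  \<comment> \<open>The perturbation \<open>\<epsilon> * t\<^sup>2\<close> makes the contradiction
    strict; at \<open>t = a\<close> it is only half of \<open>f b\<close>, so the maximum of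
    \<open>G\<close> is interior.\<close>
  define \<epsilon> where "\<epsilon> = f b / (2 * a\<^sup>2)"
  have fb: "f b > 0" using vf[of y] pos b by (simp add: b_def)
  have \<epsilon>: "\<epsilon> > 0" "\<epsilon> * a\<^sup>2 < f b" using fb b by (simp_all add: \<epsilon>_def)
  define G where "G t = f t + \<epsilon> * t\<^sup>2" for t
  have "continuous_on {0..a} G"
    unfolding G_def f_def using q by (intro continuous_intros continuous_on_compose2[OF v'(1)]) auto
  then obtain t where t: "t \<in> {0..a}" and max: "\<And>s. s \<in> {0..a} \<Longrightarrow> G s \<le> G t"
    using continuous_attains_sup[of "{0..a}" G] b by auto
  have Gt: "G t \<ge> G b" using max b by simp
  have Gb: "G b \<ge> f b" using \<epsilon> by (simp add: G_def)
  have "t \<noteq> 0" using Gt Gb fb v'(3)[of 0] by (auto simp: G_def f_def)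
  moreover have "t \<noteq> a"
  proof
    assume "t = a"
    then have "G t = \<epsilon> * a\<^sup>2" using vf[OF x0(1)] x0(2) by (simp add: G_def a_def)
    then show False using Gt Gb \<epsilon> by linarith
  qed
  ultimately have t': "0 < t" "t < a" using t by auto
  define x1 where "x1 = (t / q) *\<^sub>R \<nu>"
  have nx1: "\<nu> \<bullet> x1 = t" using q by (simp add: x1_def q_def)
  define A where "A = (- (2 * \<epsilon>)) *\<^sub>R outer \<nu>"
  have A: "A \<in> symmetric_matrices" unfolding A_def by (intro symmetric_matrices_scaleR) simp
  have qp: "quad_poly A 0 0 x = - (\<epsilon> * (\<nu> \<bullet> x)\<^sup>2)" for x
    unfolding A_def quad_poly_def scaleR_matrix_vector_assoc[symmetric] outer_mult
    by (simp add: power2_eq_square inner_commute)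
  have "open {x. 0 < \<nu> \<bullet> x \<and> \<nu> \<bullet> x < a}"
    by (intro open_Collect_conj open_Collect_less continuous_intros)
  then have "\<forall>\<^sub>F x in nhds x1. x \<in> {x. 0 < \<nu> \<bullet> x \<and> \<nu> \<bullet> x < a}"
    using nx1 t' by (intro eventually_nhds_in_open) auto
  then have "local_max_at (\<lambda>x. v x - quad_poly A 0 0 x) x1"
    unfolding local_max_at_def
  proof eventually_elim
    case (elim x)
    then have "v x - quad_poly A 0 0 x = G (\<nu> \<bullet> x)" using vf by (simp add: qp G_def)
    moreover have "v x1 - quad_poly A 0 0 x1 = G t" using vf[of x1] nx1 t' by (simp add: qp G_def)
    ultimately show ?case using max[of "\<nu> \<bullet> x"] elim by simp
  qed
  then have "0 \<le> trace A" using half_sol_subsol[OF v] A unfolding subsol_def by blast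
  also have "trace A = - (2 * \<epsilon>) * q" unfolding A_def trace_scaleR trace_outer q_def ..
  finally show False using \<epsilon> q by (simp add: mult_le_0_iff)
qed

section \<open>Reduction to the Laplacian\<close>

text \<open>Gram-Schmidt for the form \<open>B\<close>, by induction over finite subsets of the
  index type; a dimension count supplies each next vector outside the span.\<close>

lemma exists_orthonormal_columns:
  fixes B :: "real ^ 'n \<Rightarrow> real ^ 'n \<Rightarrow> real"
  assumes add: "\<And>x y z. B (x + y) z = B x z + B y z" and scale: "\<And>c x z. B (c *\<^sub>R x) z = c * B x z"
    and sym: "\<And>x y. B x y = B y x" and pos: "\<And>x. x \<noteq> 0 \<Longrightarrow> B x x > 0"
  shows "\<exists>t :: 'n \<Rightarrow> real ^ 'n. \<forall>i j. B (t i) (t j) = (if i = j then 1 else 0)"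
proof -
  have lin: "linear (\<lambda>x. B x z)" for z by (rule linearI) (simp_all add: add scale)
  have sum: "B (\<Sum>i\<in>I. f i) z = (\<Sum>i\<in>I. B (f i) z)" for I and f :: "'n \<Rightarrow> real ^ 'n" and z
    by (rule linear_sum[OF lin])
  have diff: "B (x - y) z = B x z - B y z" for x y z by (rule linear_diff[OF lin])
  have "\<exists>t :: 'n \<Rightarrow> real ^ 'n. \<forall>i\<in>I. \<forall>j\<in>I. B (t i) (t j) = (if i = j then 1 else 0)" if "finite I" for I :: "'n set"
    using that
  proof (induction I)
    case (insert k I)
    then obtain t :: "'n \<Rightarrow> real ^ 'n" where t: "\<And>i j. i \<in> I \<Longrightarrow> j \<in> I \<Longrightarrow> B (t i) (t j) = (if i = j then 1 else 0)"
      by blast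
    have "dim (t ` I) \<le> card (t ` I)" using insert by (intro dim_le_card') simp
    also have "\<dots> \<le> card I" using insert by (intro card_image_le)
    also have "\<dots> < CARD('n)" using insert by (intro psubset_card_mono) auto
    finally have "span (t ` I) \<noteq> UNIV"
      by (metis DIM_cart DIM_real dim_UNIV dim_span mult.right_neutral nat_neq_iff)
    then obtain x where x: "x \<notin> span (t ` I)" by blast
    define w where "w = x - (\<Sum>i\<in>I. B x (t i) *\<^sub>R t i)"
    have "(\<Sum>i\<in>I. B x (t i) *\<^sub>R t i) \<in> span (t ` I)"
      by (intro span_sum span_scale span_base) auto
    then have "w \<noteq> 0" using x by (auto simp: w_def)
    then have ww: "B w w > 0" by (rule pos)
    have orth: "B w (t j) = 0" if "j \<in> I" for j
    proof -
      have "(\<Sum>i\<in>I. B x (t i) * B (t i) (t j)) = (\<Sum>i\<in>I. if i = j then B x (t j) else 0)"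
        using t that by (intro sum.cong) auto
      then show ?thesis using insert that by (simp add: w_def diff sum scale)
    qed
    define c where "c = 1 / sqrt (B w w)"
    have "B (c *\<^sub>R w) (c *\<^sub>R w) = 1"
    proof -
      have "B (c *\<^sub>R w) (c *\<^sub>R w) = c * (c * B w w)" by (metis scale sym)
      then show ?thesis using ww by (simp add: c_def)
    qed
    moreover have "B (c *\<^sub>R w) (t j) = 0" "B (t j) (c *\<^sub>R w) = 0" if "j \<in> I" for j
      using orth[OF that] sym[of "t j"] by (simp_all add: scale)
    ultimately show ?case
      using t insert(2) by (intro exI[of _ "t(k := c *\<^sub>R w)"]) auto
  qed simp
  from this[of UNIV] show ?thesis by simp
qed

text \<open>Polarisation of \<open>outer\<close>; symmetric, so that \<open>F\<close> may be applied
  to it.\<close>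

definition cross_outer :: "real ^ 'n \<Rightarrow> real ^ 'n \<Rightarrow> real ^ 'n ^ 'n" where
  "cross_outer x y = (\<chi> i j. x $ i * y $ j + y $ i * x $ j)"

lemma cross_outer_symmetric [simp]: "cross_outer x y \<in> symmetric_matrices"
  by (simp add: cross_outer_def symmetric_matrices_def transpose_def vec_eq_iff)

text \<open>Convexity at the midpoint with homogeneity gives subadditivity; applied to
  \<open>- A\<close> and \<open>- B\<close> it reverses, because \<open>F\<close> is odd.\<close>

lemma operator_additive:
  assumes hom: "homogeneous_degree_one F" and conv: "convex_on symmetric_matrices F"
    and A: "A \<in> symmetric_matrices" and B: "B \<in> symmetric_matrices"
  shows "F (A + B) = F A + F B"
proof -
  have le: "F (X + Y) \<le> F X + F Y" if "X \<in> symmetric_matrices" "Y \<in> symmetric_matrices" for X Y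
  proof -
    have "F ((1 - 1 / 2) *\<^sub>R X + (1 / 2) *\<^sub>R Y) \<le> (1 - 1 / 2) * F X + (1 / 2) * F Y"
      using that by (intro convex_onD[OF conv]) auto
    also have "(1 - 1 / 2) *\<^sub>R X + (1 / 2) *\<^sub>R Y = (1 / 2) *\<^sub>R (X + Y)" by (simp add: scaleR_add_right)
    also have "F \<dots> = 1 / 2 * F (X + Y)"
      using hom that unfolding homogeneous_degree_one_def by (metis symmetric_matrices_add)
    finally show ?thesis by simp
  qed
  have neg: "F (- X) = - F X" if "X \<in> symmetric_matrices" for X
    using hom that unfolding homogeneous_degree_one_def by (metis mult_minus1 scaleR_minus1_left)
  have "F (- A + - B) \<le> F (- A) + F (- B)" using A B by (intro le) auto
  moreover have "F (- A + - B) = - F (A + B)" using neg[of "A + B"] A B by auto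
  ultimately show ?thesis using le[OF A B] neg A B by simp
qed

text \<open>The linear operator \<open>F\<close> defines the symmetric form
  \<open>B x y = F (cross_outer x y) / 2\<close>, which ellipticity makes positive definite. With
  \<open>B\<close>-orthonormal columns in \<open>T\<close>, expanding
  \<open>T ** A ** transpose T\<close> into \<open>cross_outer\<close> terms leaves the diagonal of
  \<open>A\<close>.\<close>

lemma exists_diagonalising_matrix:
  fixes F :: "real ^ 'n ^ 'n \<Rightarrow> real"
  assumes lam: "0 < lam" and ell: "uniformly_elliptic lam Lam F"
    and hom: "homogeneous_degree_one F" and conv: "convex_on symmetric_matrices F"
  obtains T T' :: "real ^ 'n ^ 'n" where "T ** T' = mat 1" "T' ** T = mat 1"
    "\<And>A. A \<in> symmetric_matrices \<Longrightarrow> F (T ** A ** transpose T) = trace A"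
proof -
  note Fadd = operator_additive[OF hom conv]
  have Fsc: "F (c *\<^sub>R A) = c * F A" if "A \<in> symmetric_matrices" for c A
    using hom that unfolding homogeneous_degree_one_def by blast
  have F0: "F 0 = 0" using Fsc[of 0 0] by simp
  have symsum: "(\<Sum>i\<in>I. f i) \<in> symmetric_matrices \<and> F (\<Sum>i\<in>I. f i) = (\<Sum>i\<in>I. F (f i))"
    if "finite I" "\<And>i. i \<in> I \<Longrightarrow> f i \<in> symmetric_matrices" for I :: "'n set" and f
    using that by (induction I) (auto simp: F0 Fadd)
  define B where "B x y = F (cross_outer x y) / 2" for x y
  have co: "cross_outer (x + y) z = cross_outer x z + cross_outer y z"
    "cross_outer (c *\<^sub>R x) z = c *\<^sub>R cross_outer x z" "cross_outer x z = cross_outer z x"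
    "cross_outer x x = 2 *\<^sub>R outer x" for x y z :: "real ^ 'n" and c
    by (simp_all add: cross_outer_def outer_def vec_eq_iff algebra_simps)
  have "B x x > 0" if "x \<noteq> 0" for x
  proof -
    have psd: "psd (outer x)"
      unfolding psd_def outer_mult by (simp add: inner_commute)
    have "lam * spectral_norm (outer x) \<le> F (0 + outer x) - F 0"
      using ell psd unfolding uniformly_elliptic_def by blast
    moreover have "spectral_norm (outer x) > 0"
    proof -
      have "norm (outer x *v x) \<le> spectral_norm (outer x) * norm x"
        by (intro onorm) simp
      moreover have "norm (outer x *v x) > 0" using that by (simp add: outer_mult)
      ultimately have "0 < spectral_norm (outer x) * norm x" by linarith
      then show ?thesis using that by (simp add: zero_less_mult_iff)
    qed
    ultimately have "F (0 + outer x) - F 0 > 0" using lam by (meson less_le_trans mult_pos_pos)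
    then have "F (outer x) > 0" using F0 by simp
    then show ?thesis by (simp add: B_def co(4) Fsc)
  qed
  then obtain t :: "'n \<Rightarrow> real ^ 'n" where t: "\<And>i j. B (t i) (t j) = (if i = j then 1 else 0)"
  proof -
    have "B (x + y) z = B x z + B y z" for x y z by (simp add: B_def co(1) Fadd add_divide_distrib)
    moreover have "B (c *\<^sub>R x) z = c * B x z" for c x z by (simp add: B_def co(2) Fsc)
    moreover have "B x y = B y x" for x y unfolding B_def using co(3)[of x y] by simp
    ultimately show ?thesis
      using exists_orthonormal_columns[of B] \<open>\<And>x. x \<noteq> 0 \<Longrightarrow> B x x > 0\<close> that by blast
  qed
  define T where "T = (\<chi> a i. t i $ a)"
  have FT: "F (T ** A ** transpose T) = trace A" if A: "A \<in> symmetric_matrices" for A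
  proof -
    have sy: "A $ i $ j = A $ j $ i" for i j
      using A by (simp add: symmetric_matrices_def transpose_def vec_eq_iff)
    have "T ** A ** transpose T = (\<Sum>i\<in>UNIV. \<Sum>j\<in>UNIV. (A $ i $ j / 2) *\<^sub>R cross_outer (t i) (t j))"
    proof -
      have "(T ** A ** transpose T) $ a $ b = (\<Sum>i\<in>UNIV. \<Sum>j\<in>UNIV. (A $ i $ j / 2) *\<^sub>R cross_outer (t i) (t j)) $ a $ b" for a b
      proof -
        have 1: "(T ** A ** transpose T) $ a $ b = (\<Sum>j\<in>UNIV. \<Sum>i\<in>UNIV. A $ i $ j * t i $ a * t j $ b)"
          by (simp add: matrix_matrix_mult_def T_def transpose_def sum_distrib_left mult_ac)
        have 2: "(\<Sum>j\<in>UNIV. \<Sum>i\<in>UNIV. A $ i $ j * t i $ a * t j $ b) = (\<Sum>i\<in>UNIV. \<Sum>j\<in>UNIV. A $ i $ j * t i $ a * t j $ b)"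
          by (rule sum.swap)
        have 3: "(\<Sum>j\<in>UNIV. \<Sum>i\<in>UNIV. A $ i $ j * t i $ a * t j $ b) = (\<Sum>i\<in>UNIV. \<Sum>j\<in>UNIV. A $ i $ j * t j $ a * t i $ b)"
          by (simp add: sy)
        have "(\<Sum>i\<in>UNIV. \<Sum>j\<in>UNIV. (A $ i $ j / 2) *\<^sub>R cross_outer (t i) (t j)) $ a $ b
          = (\<Sum>i\<in>UNIV. \<Sum>j\<in>UNIV. A $ i $ j * t i $ a * t j $ b / 2) + (\<Sum>i\<in>UNIV. \<Sum>j\<in>UNIV. A $ i $ j * t j $ a * t i $ b / 2)"
          by (simp add: cross_outer_def sum.distrib algebra_simps add_divide_distrib)
        then show ?thesis
          using 1 2 3 by (simp add: sum_divide_distrib[symmetric])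
      qed
      then show ?thesis by (simp add: vec_eq_iff)
    qed
    also have "F \<dots> = (\<Sum>i\<in>UNIV. F (\<Sum>j\<in>UNIV. (A $ i $ j / 2) *\<^sub>R cross_outer (t i) (t j)))"
      by (rule conjunct2[OF symsum]) (auto intro!: conjunct1[OF symsum] symmetric_matrices_scaleR)
    also have "\<dots> = (\<Sum>i\<in>UNIV. \<Sum>j\<in>UNIV. F ((A $ i $ j / 2) *\<^sub>R cross_outer (t i) (t j)))"
      by (rule sum.cong[OF refl], rule conjunct2[OF symsum]) (auto intro!: symmetric_matrices_scaleR)
    also have "\<dots> = (\<Sum>i\<in>UNIV. \<Sum>j\<in>UNIV. A $ i $ j * B (t i) (t j))"
      by (simp add: Fsc B_def)
    also have "\<dots> = trace A" by (simp add: t trace_def if_distrib cong: if_cong)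
    finally show ?thesis .
  qed
  \<comment> \<open>\<open>FT\<close> at \<open>outer z\<close> turns the squared norm of
    \<open>z\<close> into \<open>F (outer (T *v z))\<close>, so \<open>T\<close> has trivial
    kernel.\<close>
  have "z = 0" if z: "T *v z = 0" for z
  proof -
    have "T ** outer z ** transpose T = outer (T *v z)"
      unfolding matrix_eq
    proof
      fix x
      have "z \<bullet> (transpose T *v x) = (T *v z) \<bullet> x"
        using inner_transpose_mult[of T x z] by (simp only: inner_commute)
      then show "(T ** outer z ** transpose T) *v x = outer (T *v z) *v x"
        unfolding matrix_vector_mul_assoc[symmetric] outer_mult matrix_vector_mult_scaleR by (simp only:)
    qed
    moreover have "outer (0 :: real ^ 'n) = 0" by (simp add: outer_def vec_eq_iff)
    ultimately have "trace (outer z) = F 0" using FT[of "outer z"] z by simp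
    then show ?thesis by (simp add: F0 trace_outer)
  qed
  then have "\<exists>T' :: real ^ 'n ^ 'n. T' ** T = mat 1" unfolding matrix_left_invertible_ker by blast
  then obtain T' :: "real ^ 'n ^ 'n" where "T' ** T = mat 1" by blast
  then show ?thesis using that[of T T'] FT by (simp add: matrix_left_right_inverse)
qed


section \<open>Transport of the equation and behaviour across the flat boundary\<close>

lemma halfspace_closure: "closure (half_space k) = {x :: real ^ 'n. 0 \<le> x $ k}"
proof -
  have "half_space k = {x. axis k 1 \<bullet> x > (0 :: real)}" by (simp add: half_space_def inner_axis')
  moreover have "axis k (1 :: real) \<noteq> (0 :: real ^ 'n)" by (simp add: axis_eq_0_iff)
  ultimately show ?thesis by (simp add: closure_halfspace_gt inner_axis')
qed

text \<open>Composing a test polynomial with \<open>transpose T\<close> changes its Hessian to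
  \<open>T ** A ** transpose T\<close>, where \<open>F\<close> takes the value
  \<open>trace A\<close>.\<close>

lemma subsol_transform:
  fixes F :: "real ^ 'n ^ 'n \<Rightarrow> real" and T T' :: "real ^ 'n ^ 'n"
  assumes T: "T ** T' = mat 1" "T' ** T = mat 1"
    and FT: "\<And>A. A \<in> symmetric_matrices \<Longrightarrow> F (T ** A ** transpose T) = trace A"
    and w: "\<And>x0 A b c. x0 \<in> V \<Longrightarrow> A \<in> symmetric_matrices \<Longrightarrow>
       local_max_at (\<lambda>x. w x - quad_poly A b c x) x0 \<Longrightarrow> a \<le> F A"
  shows "subsol (\<lambda>x. w (transpose T' *v x)) {x. transpose T' *v x \<in> V} a"
  unfolding subsol_def
proof (intro ballI allI impI)
  fix x0 A b c
  assume x0: "x0 \<in> {x. transpose T' *v x \<in> V}" and A: "A \<in> symmetric_matrices"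
    and max: "local_max_at (\<lambda>x. w (transpose T' *v x) - quad_poly A b c x) x0"
  define g where "g y = transpose T *v y" for y
  define y0 where "y0 = transpose T' *v x0"
  have 1: "transpose T' *v g y = y" for y
  proof -
    have "transpose T' ** transpose T = mat 1"
      unfolding matrix_transpose_mul[symmetric] T by simp
    then show ?thesis unfolding g_def matrix_vector_mul_assoc by simp
  qed
  have 2: "g (transpose T' *v x) = x" for x
  proof -
    have "transpose T ** transpose T' = mat 1"
      unfolding matrix_transpose_mul[symmetric] T by simp
    then show ?thesis unfolding g_def matrix_vector_mul_assoc by simp
  qed
  obtain b' c' where q: "\<And>y. quad_poly A b c (g y) = quad_poly (T ** A ** transpose T) b' c' y"
    using quad_poly_affine[OF A, of b c 0 "transpose T"] by (auto simp: g_def)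
  have "isCont g y0" unfolding g_def by (intro continuous_intros)
  moreover have "g y0 = x0" unfolding y0_def by (rule 2)
  ultimately have "local_max_at (\<lambda>y. w (transpose T' *v g y) - quad_poly A b c (g y)) y0"
    using max local_max_at_compose[of "\<lambda>x. w (transpose T' *v x) - quad_poly A b c x" g y0] by (simp only:)
  then have "local_max_at (\<lambda>y. w y - quad_poly (T ** A ** transpose T) b' c' y) y0"
    unfolding 1 q .
  moreover have "T ** A ** transpose T \<in> symmetric_matrices"
    using symmetric_matrices_conj[OF A, of "transpose T"] by simp
  ultimately have "a \<le> F (T ** A ** transpose T)" using w[of y0] x0 by (simp add: y0_def)
  then show "a \<le> trace A" by (simp add: FT[OF A])
qed

text \<open>Supplies the supersolution inequality on and below the flat boundary, with
  \<open>w\<close> the negative of the zero extension. A vanishing derivative of \<open>w\<close>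
  forces \<open>g = 0\<close>. Rays on which \<open>w\<close> is zero then give nonnegativity in a
  half-space of directions, which suffices because a quadratic form is even.\<close>

lemma psd_of_second_order:
  fixes w :: "real ^ 'n \<Rightarrow> real"
  assumes A: "A \<in> symmetric_matrices"
    and max: "local_max_at (\<lambda>x. w x - quad_poly A b c x) x0"
    and w0: "w x0 = 0" and der: "(w has_derivative (\<lambda>h. 0)) (at x0)"
    and zero: "\<And>z. z $ k \<le> 0 \<Longrightarrow> \<forall>\<^sub>F t in at_right 0. w (x0 + t *\<^sub>R z) = 0"
  shows "psd A"
proof -
  define g where "g = b + A *v x0"
  have q: "quad_poly A b c (x0 + z) = quad_poly A b c x0 + g \<bullet> z + (z \<bullet> (A *v z)) / 2" for z
    unfolding g_def by (rule quad_poly_expand[OF A])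
  have ev: "\<forall>\<^sub>F t in at_right 0. w (x0 + t *\<^sub>R z) \<le> t * (g \<bullet> z) + t\<^sup>2 * (z \<bullet> (A *v z)) / 2" for z
  proof -
    have "\<forall>\<^sub>F z in nhds 0. w (x0 + z) \<le> g \<bullet> z + (z \<bullet> (A *v z)) / 2"
      using max unfolding local_max_at_shift q by (rule eventually_mono) (simp add: w0)
    moreover have "filterlim (\<lambda>t. t *\<^sub>R z) (nhds 0) (at_right 0)"
      by (auto intro!: tendsto_eq_intros)
    ultimately have "\<forall>\<^sub>F t in at_right 0. w (x0 + t *\<^sub>R z) \<le> g \<bullet> (t *\<^sub>R z) + ((t *\<^sub>R z) \<bullet> (A *v (t *\<^sub>R z))) / 2"
      by (rule eventually_compose_filterlim)
    then show ?thesis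
      by (rule eventually_mono) (simp add: matrix_vector_mult_scaleR power2_eq_square mult.assoc)
  qed
  have pos: "\<forall>\<^sub>F t in at_right (0::real). 0 < t" by (simp add: eventually_at_right_less)
  have gz: "0 \<le> g \<bullet> z" for z
  proof -
    have "((\<lambda>t. w (x0 + t *\<^sub>R z)) has_real_derivative 0) (at 0)"
    proof -
      have "((\<lambda>t. w (x0 + t *\<^sub>R z)) has_derivative (\<lambda>h. 0)) (at 0)"
        by (rule has_derivative_compose[where g = w and g' = "\<lambda>h. 0"])
           (use der in \<open>auto intro!: derivative_eq_intros\<close>)
      then show ?thesis by (simp add: has_field_derivative_def lambda_zero)
    qed
    then have "((\<lambda>t. w (x0 + t *\<^sub>R z) / t) \<longlongrightarrow> 0) (at 0)"
      using w0 by (simp add: has_field_derivative_iff)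
    then have lim: "((\<lambda>t. w (x0 + t *\<^sub>R z) / t) \<longlongrightarrow> 0) (at_right 0)"
      by (rule filterlim_mono) (simp_all add: at_within_le_at)
    have "((\<lambda>t. g \<bullet> z + t * (z \<bullet> (A *v z)) / 2) \<longlongrightarrow> g \<bullet> z) (at_right 0)"
      by (auto intro!: tendsto_eq_intros)
    moreover have "\<forall>\<^sub>F t in at_right 0. w (x0 + t *\<^sub>R z) / t \<le> g \<bullet> z + t * (z \<bullet> (A *v z)) / 2"
      using ev[of z] pos by eventually_elim (simp add: field_simps power2_eq_square)
    ultimately show ?thesis
      by (intro tendsto_le[OF _ _ lim]) auto
  qed
  have g0: "g \<bullet> z = 0" for z using gz[of z] gz[of "- z"] by simp
  have nn: "0 \<le> z \<bullet> (A *v z)" if zk: "z $ k \<le> 0" for z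
  proof -
    obtain t where "w (x0 + t *\<^sub>R z) \<le> t * (g \<bullet> z) + t\<^sup>2 * (z \<bullet> (A *v z)) / 2" "0 < t" "w (x0 + t *\<^sub>R z) = 0"
      using eventually_happens[OF eventually_conj[OF ev[of z] eventually_conj[OF pos zero[OF zk]]]]
      by auto
    then have "0 \<le> t\<^sup>2 * (z \<bullet> (A *v z))" by (simp add: g0)
    then show ?thesis using \<open>0 < t\<close> by (simp add: zero_le_mult_iff)
  qed
  show ?thesis
    unfolding psd_def
  proof
    fix z
    show "0 \<le> z \<bullet> (A *v z)"
    proof (cases "z $ k \<le> 0")
      case False
      then have "0 \<le> (- z) \<bullet> (A *v (- z))" by (intro nn) simp
      then show ?thesis using matrix_vector_mult_scaleR[of A "- 1" z] by simp
    qed (rule nn)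
  qed
qed


theorem theoremB:
  fixes F :: "real ^ 'n ^ 'n \<Rightarrow> real"
    and k :: 'n
    and lam Lam M :: real
    and u :: "real ^ 'n \<Rightarrow> real"
  assumes dim: "CARD('n) \<ge> 2"
    and lam_pos: "0 < lam" and lam_le: "lam \<le> Lam"
    and elliptic: "uniformly_elliptic lam Lam F"
    and homogeneous: "homogeneous_degree_one F"
    and convex: "convex_on symmetric_matrices F"
    and C1: "C1_on_symmetric F"
    and M_pos: "M > 0"
    and u_sol: "u \<in> P_inf_plus F k 0 M"
    and u_nonneg: "\<forall>x\<in>closure (half_space k). u x \<ge> 0"
    and grad_boundary: "\<forall>x\<in>flat_boundary k. grad_zero_at k u x"
  shows "contact_set k u = flat_boundary k"
proof
  note cl = halfspace_closure[of k]
  obtain \<Omega> where \<Omega>: "open \<Omega>" "\<Omega> \<subseteq> half_space k" and visc: "viscosity_solution F \<Omega> (half_space k) u"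
    and out: "\<And>x. x \<in> half_space k - \<Omega> \<Longrightarrow> u x = 0" and flat: "\<And>x. x \<in> flat_boundary k \<Longrightarrow> u x = 0"
    and origin: "0 \<in> frontier \<Omega>" and cont: "continuous_on (closure (half_space k)) u"
    using u_sol unfolding P_inf_plus_def by blast
  have F0: "F 0 = 0"
    using homogeneous unfolding homogeneous_degree_one_def
    by (metis mult_zero_left scaleR_zero_left symmetric_matrices_0)
  have Fneg: "F (- A) = - F A" if "A \<in> symmetric_matrices" for A
    using homogeneous that unfolding homogeneous_degree_one_def by (metis mult_minus1 scaleR_minus1_left)
  have Fpsd: "0 \<le> F A" if A: "A \<in> symmetric_matrices" "psd A" for A
  proof -
    have "lam * spectral_norm A \<le> F (0 + A) - F 0"
      using elliptic A unfolding uniformly_elliptic_def by blast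
    moreover have "0 \<le> lam * spectral_norm A"
      using lam_pos by (intro mult_nonneg_nonneg onorm_pos_le) simp_all
    ultimately have "0 \<le> F (0 + A) - F 0" by (rule order_trans[rotated])
    then show ?thesis using F0 by simp
  qed
  show "flat_boundary k \<subseteq> contact_set k u"
    using flat grad_boundary by (auto simp: contact_set_def cl flat_boundary_def)
  show "contact_set k u \<subseteq> flat_boundary k"
  proof
    fix x1 assume x1: "x1 \<in> contact_set k u"
    then have x1k: "0 \<le> x1 $ k" and ux1: "u x1 = 0" by (auto simp: contact_set_def cl)
    show "x1 \<in> flat_boundary k"
    proof (rule ccontr)
      assume "x1 \<notin> flat_boundary k"
      then have x1pos: "0 < x1 $ k" using x1k by (simp add: flat_boundary_def)
      \<comment> \<open>The extension by zero; it is continuous because \<open>u\<close> vanishes on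
        the flat boundary.\<close>
      define U where "U x = (if x $ k \<le> 0 then 0 else u x)" for x
      have Uu: "U x = u x" if "0 \<le> x $ k" for x
        using flat[of x] that by (simp add: U_def flat_boundary_def)
      have Uz: "U x = 0" if "x $ k \<le> 0" for x using that by (simp add: U_def)
      have Unn: "0 \<le> U x" for x using u_nonneg by (simp add: U_def cl)
      have Uclose: "open {x :: real ^ 'n. 0 < x $ k}" "open {x :: real ^ 'n. x $ k < 0}"
        by (intro open_Collect_less continuous_intros)+
      have "continuous_on ({x. x $ k \<le> 0} \<union> {x. 0 \<le> x $ k}) U"
        unfolding U_def
      proof (rule continuous_on_If)
        show "closed {x :: real ^ 'n. x $ k \<le> 0}" "closed {x :: real ^ 'n. 0 \<le> x $ k}"
          by (intro closed_Collect_le continuous_intros)+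
        show "continuous_on {x. 0 \<le> x $ k} u" using cont by (simp add: cl)
        show "0 = u x" if "x \<in> {x. 0 \<le> x $ k}" "x $ k \<le> 0" for x
          using flat[of x] that by (simp add: flat_boundary_def)
      qed auto
      moreover have "{x :: real ^ 'n. x $ k \<le> 0} \<union> {x. 0 \<le> x $ k} = UNIV" by auto
      ultimately have Ucont: "continuous_on UNIV U" by simp
      have near: "\<forall>\<^sub>F x in nhds x0. U x = u x" if "0 < x0 $ k" for x0
        using eventually_nhds_in_open[OF Uclose(1), of x0] that
        by (auto elim!: eventually_mono simp: U_def)
      \<comment> \<open>Positivity of \<open>U\<close> places the point in \<open>\<Omega>\<close>,
        since \<open>u\<close> is zero in the rest of the half-space.\<close>
      have sub: "1 \<le> F A" if x0: "x0 \<in> {x. 0 < U x}" and A: "A \<in> symmetric_matrices"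
        and max: "local_max_at (\<lambda>x. U x - quad_poly A b c x) x0" for x0 A b c
      proof -
        have x0k: "0 < x0 $ k" using x0 Uz[of x0] by force
        have "u x0 \<noteq> 0" using x0 x0k by (simp add: U_def)
        then have "x0 \<in> \<Omega>" using out[of x0] x0k by (auto simp: half_space_def)
        have "local_max_at (\<lambda>x. u x - quad_poly A b c x) x0"
          unfolding local_max_at_def
          by (rule eventually_mono[OF eventually_conj[OF near[OF x0k] max[unfolded local_max_at_def]]])
             (use x0k in \<open>auto simp: U_def\<close>)
        then have "indicator \<Omega> x0 \<le> F A"
          using visc A x0k unfolding viscosity_solution_def half_space_def by blast
        then show ?thesis using \<open>x0 \<in> \<Omega>\<close> by simp
      qed
      \<comment> \<open>In the open half-space this is the equation with signs reversed. Elsewhere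
        the test matrix is even positive semidefinite, so that \<open>F A \<ge> 0\<close>.\<close>
      have super: "- 1 \<le> F A" if A: "A \<in> symmetric_matrices"
        and max: "local_max_at (\<lambda>x. - U x - quad_poly A b c x) x0" for x0 A b c
      proof (cases "0 < x0 $ k")
        case True
        have nq: "quad_poly (- A) (- b) (- c) x = - quad_poly A b c x" for x
        proof -
          have "(- A) *v x = - (A *v x)" using scaleR_matrix_vector_assoc[of "- 1" A x] by simp
          then show ?thesis by (simp add: quad_poly_def)
        qed
        have "local_min_at (\<lambda>x. u x - quad_poly (- A) (- b) (- c) x) x0"
          unfolding local_min_at_def nq
          by (rule eventually_mono[OF eventually_conj[OF near[OF True] max[unfolded local_max_at_def]]])
             (use True in \<open>auto simp: U_def\<close>)
        then have "F (- A) \<le> indicator \<Omega> x0"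
          using visc symmetric_matrices_uminus[OF A] True unfolding viscosity_solution_def half_space_def by blast
        also have "\<dots> \<le> 1" by (simp add: indicator_def)
        finally show ?thesis by (simp add: Fneg[OF A])
      next
        case False
        then have x0k: "x0 $ k \<le> 0" by simp
        have "psd A"
        proof (rule psd_of_second_order[OF A max])
          show "- U x0 = 0" using Uz[OF x0k] by simp
          show "((\<lambda>x. - U x) has_derivative (\<lambda>h. 0)) (at x0)"
          \<comment> \<open>On the flat boundary the one-sided zero gradient of \<open>u\<close> and
            the zero values below combine to a full derivative; this is where
            \<open>grad_boundary\<close> enters the equation for \<open>U\<close>.\<close>
          proof (cases "x0 $ k = 0")
            case True
            then have "(u has_derivative (\<lambda>h. 0)) (at x0 within closure (half_space k))"
              using grad_boundary by (simp add: flat_boundary_def grad_zero_at_def)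
            moreover have "u x0 = 0" using flat True by (simp add: flat_boundary_def)
            ultimately have d: "\<exists>d>0. \<forall>y. 0 \<le> y $ k \<longrightarrow> norm (y - x0) < d \<longrightarrow> \<bar>u y\<bar> \<le> e * norm (y - x0)" if "e > 0" for e
              using that unfolding has_derivative_within_alt cl by fastforce
            show ?thesis
              unfolding has_derivative_at_alt
            proof (intro conjI allI impI)
              fix e :: real assume "e > 0"
              then obtain d where d: "d > 0" "\<And>y. 0 \<le> y $ k \<Longrightarrow> norm (y - x0) < d \<Longrightarrow> \<bar>u y\<bar> \<le> e * norm (y - x0)"
                using d by blast
              show "\<exists>d>0. \<forall>y. norm (y - x0) < d \<longrightarrow> norm (- U y - - U x0 - 0) \<le> e * norm (y - x0)"
                using d \<open>e > 0\<close> Uz[OF x0k] by (intro exI[of _ d]) (auto simp: U_def)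
            qed simp
          next
            case False
            then have "\<forall>\<^sub>F x in nhds x0. 0 = - U x"
              using x0k eventually_nhds_in_open[OF Uclose(2), of x0]
              by (auto elim!: eventually_mono simp: U_def)
            then show ?thesis
              using has_derivative_transform_eventually[of "\<lambda>x. 0" "\<lambda>h. 0" x0 UNIV "\<lambda>x. - U x"] Uz[OF x0k]
              by (auto simp: eventually_nhds_conv_at)
          qed
          show "\<forall>\<^sub>F t in at_right 0. - U (x0 + t *\<^sub>R z) = 0" if "z $ k \<le> 0" for z
            using eventually_at_right_less[of "0::real"]
          proof eventually_elim
            case (elim t)
            then have "(x0 + t *\<^sub>R z) $ k \<le> 0" using x0k that by (simp add: mult_nonneg_nonpos add_nonpos_nonpos)
            then show ?case using Uz by simp
          qed
        qed
        then show ?thesis using Fpsd[OF A] by simp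
      qed
      obtain T T' :: "real ^ 'n ^ 'n" where T: "T ** T' = mat 1" "T' ** T = mat 1"
        and FT: "\<And>A. A \<in> symmetric_matrices \<Longrightarrow> F (T ** A ** transpose T) = trace A"
        using exists_diagonalising_matrix[OF lam_pos elliptic homogeneous convex] by blast
      \<comment> \<open>In the new coordinates the height \<open>\<nu> \<bullet> x\<close> is the
        distinguished coordinate of \<open>transpose T' *v x\<close>.\<close>
      define \<nu> where "\<nu> = T' *v axis k 1"
      define v where "v x = U (transpose T' *v x)" for x
      have \<nu>: "\<nu> \<bullet> x = (transpose T' *v x) $ k" for x
        unfolding \<nu>_def cart_eq_inner_axis[of _ k] inner_transpose_mult by (rule inner_commute)
      have "\<nu> \<noteq> 0"
      proof
        assume "\<nu> = 0"
        then have "T *v (T' *v axis k (1 :: real)) = 0" by (simp add: \<nu>_def)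
        then show False by (simp add: matrix_vector_mul_assoc T axis_eq_0_iff)
      qed
      have inv: "transpose T' *v (transpose T *v y) = y" for y
      proof -
        have "transpose T' ** transpose T = mat 1" unfolding matrix_transpose_mul[symmetric] T by simp
        then show ?thesis unfolding matrix_vector_mul_assoc by simp
      qed
      have "half_sol \<nu> v"
        unfolding half_sol_def
      proof (intro conjI allI impI)
        show "continuous_on UNIV v"
          unfolding v_def by (intro continuous_on_compose2[OF Ucont] continuous_intros) auto
        show "0 \<le> v x" for x by (simp add: v_def Unn)
        show "v x = 0" if "\<nu> \<bullet> x \<le> 0" for x using that by (simp add: v_def \<nu> Uz)
        show "subsol (\<lambda>x. - v x) UNIV (- 1)"
          using subsol_transform[OF T FT, of UNIV "\<lambda>x. - U x" "- 1"] super by (simp add: v_def)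
        show "subsol v {x. 0 < v x} 1"
          using subsol_transform[OF T FT, of "{x. 0 < U x}" U 1] sub by (simp add: v_def[abs_def])
      qed
      note vanish = half_sol_vanishes_below[OF this \<open>\<nu> \<noteq> 0\<close>]
      have Uvan: "U y = 0" if "y $ k < x1 $ k" for y
      proof -
        have "v (transpose T *v y) = 0"
        proof (rule vanish)
          show "0 < \<nu> \<bullet> (transpose T *v x1)" using x1pos by (simp only: \<nu> inv)
          show "v (transpose T *v x1) = 0" using Uu[OF x1k] ux1 by (simp only: v_def inv)
          show "\<nu> \<bullet> (transpose T *v y) < \<nu> \<bullet> (transpose T *v x1)" using that by (simp only: \<nu> inv)
        qed
        then show ?thesis by (simp only: v_def inv)
      qed
      \<comment> \<open>Some point \<open>y\<close> of \<open>\<Omega>\<close> lies so near the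
        origin that \<open>u\<close> vanishes around it. The zero polynomial then touches
        \<open>u\<close> from above at \<open>y\<close>, which would give
        \<open>1 \<le> F 0 = 0\<close>.\<close>
      have "0 \<in> closure \<Omega>" using origin by (simp add: frontier_def)
      then obtain y where y: "y \<in> \<Omega>" "dist y 0 < x1 $ k"
        using x1pos unfolding closure_approachable by blast
      have yk: "y $ k < x1 $ k" using y(2) component_le_norm_cart[of y k] by simp
      have yH: "y \<in> half_space k" using y \<Omega> by blast
      have "open {x :: real ^ 'n. x $ k < x1 $ k}" by (intro open_Collect_less continuous_intros)
      then have "open (\<Omega> \<inter> {x. x $ k < x1 $ k})" using \<Omega>(1) by (intro open_Int)
      then have "\<forall>\<^sub>F x in nhds y. x \<in> \<Omega> \<inter> {x. x $ k < x1 $ k}"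
        using y(1) yk by (intro eventually_nhds_in_open) auto
      moreover have uz: "u x = 0" if "x \<in> \<Omega> \<inter> {x. x $ k < x1 $ k}" for x
        using that Uvan[of x] Uu[of x] \<Omega>(2) by (force simp: half_space_def)
      ultimately have "\<forall>\<^sub>F x in nhds y. u x - quad_poly 0 0 0 x \<le> u y - quad_poly 0 0 0 y"
        using uz[of y] y(1) yk by (auto elim!: eventually_mono simp: quad_poly_def)
      then have "indicator \<Omega> y \<le> F 0"
        using visc yH unfolding viscosity_solution_def local_max_at_def by (meson symmetric_matrices_0)
      then show False using F0 y(1) by simp
    qed
  qed
qed

end
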